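(* For any completely positive maps $\mathcal N,\mathcal M$ from $\mathscr L(X)$ to $\mathscr L(Y)$ and any $\alpha>1$, $\widetilde D^{\mathrm a}_\alpha(\mathcal N\|\mathcal M)=\widetilde D^{\mathrm{reg}}_\alpha(\mathcal N\|\mathcal M)$.
   Context: Sandwiched divergence: for positive semidefinite $\rho,\sigma$, $\widetilde D_\alpha(\rho\|\sigma)=\frac{1}{\alpha-1}\log_2\mathrm{tr}\big((\sigma^{\frac{1-\alpha}{2\alpha}}\rho\sigma^{\frac{1-\alpha}{2\alpha}})^\alpha\big)$ if $\mathrm{supp}\rho\subseteq\mathrm{supp}\sigma$ (generalized inverses; same formula if $\rho$ unnormalized), $+\infty$ otherwise. Choi operator $J^{\mathcal N}_{X'Y}=(\mathcal I_{X'}\otimes\mathcal N)(\Phi_{X'X})$, $\Phi=\sum_{x,x'}|x\rangle\langle x'|\otimes|x\rangle\langle x'|$, $X'$ a copy of $X$. Channel divergence: $\widetilde D_\alpha(\mathcal N\|\mathcal M):=\sup_{\omega\in\mathscr D(X')}\widetilde D_\alpha\big((\omega^{1/2}\otimes I_Y)J^{\mathcal N}(\omega^{1/2}\otimes I_Y)\,\|\,(\omega^{1/2}\otimes I_Y)J^{\mathcal M}(\omega^{1/2}\otimes I_Y)\big)$. Regularized: $\widetilde D^{\mathrm{reg}}_\alpha(\mathcal N\|\mathcal M):=\lim_{n\to\infty}\frac1n\widetilde D_\alpha(\mathcal N^{\otimes n}\|\mathcal M^{\otimes n})$. Amortized: $\widetilde D^{\mathrm a}_\alpha(\mathcal N\|\mathcal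 M):=\sup\big[\widetilde D_\alpha((\mathcal I_R\otimes\mathcal N)(\rho_{RX})\|(\mathcal I_R\otimes\mathcal M)(\sigma_{RX}))-\widetilde D_\alpha(\rho_{RX}\|\sigma_{RX})\big]$, the supremum over all finite-dimensional systems $R$ and density operators $\rho_{RX},\sigma_{RX}\in\mathscr D(R\otimes X)$. *)

theory Defs
  imports "HOL-Library.Extended_Real" "Jordan_Normal_Form.Matrix"
begin

definition adj :: "complex mat \<Rightarrow> complex mat" where
  "adj A = mat (dim_col A) (dim_row A) (\<lambda>(i,j). cnj (A $$ (j,i)))"

definition unitary_m :: "nat \<Rightarrow> complex mat \<Rightarrow> bool" where
  "unitary_m n U \<longleftrightarrow> U \<in> carrier_mat n n \<and> adj U * U = 1\<^sub>m n"

definition psd :: "nat \<Rightarrow> complex mat \<Rightarrow> bool" where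
  "psd n A \<longleftrightarrow> A \<in> carrier_mat n n \<and>
     (\<forall>v\<in>carrier_vec n. let q = (\<Sum>i<n. cnj (v $ i) * (A *\<^sub>v v) $ i)
                          in Im q = 0 \<and> Re q \<ge> 0)"

definition mtrace :: "complex mat \<Rightarrow> complex" where
  "mtrace A = (\<Sum>i<dim_row A. A $$ (i,i))"

definition density :: "nat \<Rightarrow> complex mat \<Rightarrow> bool" where
  "density n \<rho> \<longleftrightarrow> psd n \<rho> \<and> mtrace \<rho> = 1"

text \<open>Power of a positive semidefinite matrix via functional calculus, with
  the generalized-inverse convention: the power is taken on the support only
  (eigenvalue 0 is mapped to 0).  The result is independent of the chosen
  spectral decomposition.\<close>
definition mpow :: "complex mat \<Rightarrow> real \<Rightarrow> complex mat" where
  "mpow A p = (SOME B. \<exists>U d. unitary_m (dim_row A) U \<and> (\<forall>i. d i \<ge> 0) \<and>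
      A = U * mat_diag (dim_row A) (\<lambda>i. complex_of_real (d i)) * adj U \<and>
      B = U * mat_diag (dim_row A)
                 (\<lambda>i. if d i > 0 then complex_of_real (d i powr p) else 0) * adj U)"

definition supp_le :: "nat \<Rightarrow> complex mat \<Rightarrow> complex mat \<Rightarrow> bool" where
  "supp_le n \<rho> \<sigma> \<longleftrightarrow>
     (\<forall>v\<in>carrier_vec n. \<exists>w\<in>carrier_vec n. \<rho> *\<^sub>v v = \<sigma> *\<^sub>v w)"

definition sandwiched :: "real \<Rightarrow> nat \<Rightarrow> complex mat \<Rightarrow> complex mat \<Rightarrow> ereal" where
  "sandwiched \<alpha> n \<rho> \<sigma> =
     (if supp_le n \<rho> \<sigma> then
        (let s = (1 - \<alpha>) / (2 * \<alpha>);
             Q = Re (mtrace (mpow (mpow \<sigma> s * \<rho> * mpow \<sigma> s) \<alpha>))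
         in ereal (1 / (\<alpha> - 1)) * (if Q = 0 then - \<infinity> else ereal (log 2 Q)))
      else \<infinity>)"

definition kron :: "complex mat \<Rightarrow> complex mat \<Rightarrow> complex mat" where
  "kron A B = mat (dim_row A * dim_row B) (dim_col A * dim_col B)
     (\<lambda>(i,j). A $$ (i div dim_row B, j div dim_col B) * B $$ (i mod dim_row B, j mod dim_col B))"

definition E :: "nat \<Rightarrow> nat \<Rightarrow> nat \<Rightarrow> complex mat" where
  "E n i j = mat n n (\<lambda>(k,l). if k = i \<and> l = j then 1 else 0)"

text \<open>(I_R (x) N)(rho) for rho on R (x) X with dim R = r, dim X = dx, dim Y = dy:
  block (a,b) of rho (a dx x dx matrix) is mapped to N of that block.\<close>
definition id_tensor :: "nat \<Rightarrow> nat \<Rightarrow> nat \<Rightarrow> (complex mat \<Rightarrow> complex mat) \<Rightarrow> complex mat \<Rightarrow> complex mat" where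
  "id_tensor r dx dy N \<rho> = mat (r * dy) (r * dy)
     (\<lambda>(i,j). N (mat dx dx (\<lambda>(k,l). \<rho> $$ ((i div dy) * dx + k, (j div dy) * dx + l)))
              $$ (i mod dy, j mod dy))"

definition lin_map :: "nat \<Rightarrow> nat \<Rightarrow> (complex mat \<Rightarrow> complex mat) \<Rightarrow> bool" where
  "lin_map dx dy N \<longleftrightarrow>
     (\<forall>A\<in>carrier_mat dx dx. N A \<in> carrier_mat dy dy) \<and>
     (\<forall>A\<in>carrier_mat dx dx. \<forall>B\<in>carrier_mat dx dx. N (A + B) = N A + N B) \<and>
     (\<forall>c. \<forall>A\<in>carrier_mat dx dx. N (c \<cdot>\<^sub>m A) = c \<cdot>\<^sub>m N A)"

definition cp_map :: "nat \<Rightarrow> nat \<Rightarrow> (complex mat \<Rightarrow> complex mat) \<Rightarrow> bool" where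
  "cp_map dx dy N \<longleftrightarrow> lin_map dx dy N \<and>
     (\<forall>r \<rho>. psd (r * dx) \<rho> \<longrightarrow> psd (r * dy) (id_tensor r dx dy N \<rho>))"

text \<open>Tensor product N (x) M of linear maps, defined by linear extension of
  E_ij (x) E_kl to N(E_ij) (x) M(E_kl).\<close>
definition tensor_map :: "nat \<Rightarrow> nat \<Rightarrow> (complex mat \<Rightarrow> complex mat) \<Rightarrow>
    nat \<Rightarrow> nat \<Rightarrow> (complex mat \<Rightarrow> complex mat) \<Rightarrow> complex mat \<Rightarrow> complex mat" where
  "tensor_map dx1 dy1 N dx2 dy2 M A = mat (dy1 * dy2) (dy1 * dy2)
     (\<lambda>(p,q). \<Sum>i<dx1. \<Sum>j<dx1. \<Sum>k<dx2. \<Sum>l<dx2.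
        A $$ (i * dx2 + k, j * dx2 + l) *
        N (E dx1 i j) $$ (p div dy2, q div dy2) * M (E dx2 k l) $$ (p mod dy2, q mod dy2))"

fun tpow :: "nat \<Rightarrow> nat \<Rightarrow> nat \<Rightarrow> (complex mat \<Rightarrow> complex mat) \<Rightarrow> complex mat \<Rightarrow> complex mat" where
  "tpow dx dy 0 N = (\<lambda>A. A)"
| "tpow dx dy (Suc n) N = tensor_map (dx ^ n) (dy ^ n) (tpow dx dy n N) dx dy N"

text \<open>Maximally entangled (unnormalized) operator Phi on X' (x) X and the Choi operator.\<close>
definition Phi :: "nat \<Rightarrow> complex mat" where
  "Phi dx = mat (dx * dx) (dx * dx)
     (\<lambda>(i,j). if i div dx = i mod dx \<and> j div dx = j mod dx then 1 else 0)"

definition choi :: "nat \<Rightarrow> nat \<Rightarrow> (complex mat \<Rightarrow> complex mat) \<Rightarrow> complex mat" where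
  "choi dx dy N = id_tensor dx dx dy N (Phi dx)"

definition chan_div :: "real \<Rightarrow> nat \<Rightarrow> nat \<Rightarrow> (complex mat \<Rightarrow> complex mat) \<Rightarrow>
    (complex mat \<Rightarrow> complex mat) \<Rightarrow> ereal" where
  "chan_div \<alpha> dx dy N M =
     (SUP \<omega> \<in> {\<omega>. density dx \<omega>}.
        (let W = kron (mpow \<omega> (1/2)) (1\<^sub>m dy)
         in sandwiched \<alpha> (dx * dy) (W * choi dx dy N * W) (W * choi dx dy M * W)))"

text \<open>Amortized divergence: supremum over finite-dimensional reference systems R
  (dim R = r) and density operators rho, sigma on R (x) X.  Pairs with
  D(rho||sigma) = +infinity are excluded (the difference would be undefined).\<close>
definition amort_div :: "real \<Rightarrow> nat \<Rightarrow> nat \<Rightarrow> (complex mat \<Rightarrow> complex mat) \<Rightarrow>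
    (complex mat \<Rightarrow> complex mat) \<Rightarrow> ereal" where
  "amort_div \<alpha> dx dy N M =
     (SUP (r, \<rho>, \<sigma>) \<in> {(r, \<rho>, \<sigma>). density (r * dx) \<rho> \<and> density (r * dx) \<sigma> \<and>
                              sandwiched \<alpha> (r * dx) \<rho> \<sigma> < \<infinity>}.
        sandwiched \<alpha> (r * dy) (id_tensor r dx dy N \<rho>) (id_tensor r dx dy M \<sigma>)
        - sandwiched \<alpha> (r * dx) \<rho> \<sigma>)"

end

theory Submission
  imports Defs "Jordan_Normal_Form.Schur_Decomposition" "HOL-Analysis.Convex"
begin

text \<open>
  Write $Q(\rho,\sigma) = \mathrm{tr}\,(\sigma^{s}\rho\,\sigma^{s})^\alpha$ with $s = (1-\alpha)/(2\alpha)$.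
  Pinching $\rho$ onto an eigenbasis of $\sigma$ loses at most a factor equal to the number $v$ of
  distinct eigenvalues of $\sigma$, and for $\sigma^{\otimes n}$ this number is polynomial in $n$;
  as $Q$ is multiplicative under tensor products, polynomial factors disappear after taking $n$-th roots.

  Chain rule. Pinching turns $\rho^{\otimes n}$ and $\sigma^{\otimes n}$ into mixtures, with weights $t_i$ and $s_i$,
  of common pure states $\psi_i$, and pinching onto $\mathcal M(\sigma)^{\otimes n}$ replaces
  $Q$ of the outputs by its classical counterpart in one basis $e_k$. Joint subadditivity of
  $(x,y) \mapsto x^\alpha y^{1-\alpha}$ then bounds $Q(\mathcal N(\rho),\mathcal M(\sigma))^n$ by
  $\sum_i t_i^\alpha s_i^{1-\alpha} \le Q(\rho,\sigma)^n$ times the largest value of the measured quantity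
  for $\mathcal N^{\otimes n}(\psi_i)$ and $\mathcal M^{\otimes n}(\psi_i)$, up to polynomial factors.
  The latter is at most $2^{(\alpha-1) D(\mathcal N^{\otimes n} \| \mathcal M^{\otimes n})}$
  because measuring does not increase $Q$ (the same pinching argument) and $\psi_i$ is the image of $\omega^{1/2}$
  under a contraction on the reference system. Hence the amortized divergence is at most the regularized one.

  Converse. The amortized bound holds for all positive operators by homogeneity, so applying the
  $n$ channel uses one at a time costs at most the amortized divergence each time, starting from
  two equal inputs, for which $Q = 1$.
\<close>

section \<open>Operators on finite index sets\<close>

text \<open>Noncommutativity enters the estimates only through pinching; the other inequalities are
  scalar: Jensen for x^\<alpha>, its perspective form y (x/y)^\<alpha>, and Cauchy-Schwarz. The
  comparisons are first proved with the loss of pinching and then repaired on tensor powers. The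
  loss stays polynomial there because an n-fold product of elements of a finite set D is determined
  by multiplicities, so a set D of possible eigenvalues travels with the value of Q. Two facts shape
  the bookkeeping. Since 0 powr (1 - \<alpha>) = 0, a violated support condition is invisible in the
  classical sums, and the estimates are accompanied by inclusions of kernels. Outputs of completely
  positive maps have arbitrary trace, so intermediate statements concern positive operators;
  normalization returns only where a definition speaks of densities. Operators are functions on
  finite index sets, compared only on those sets. A permutation of tensor factors is then a
  bijection of indices, which lets the reference system absorb the idle factors of a product
  channel.\<close>

type_synonym 'a op = "'a \<Rightarrow> 'a \<Rightarrow> complex"

definition ip :: "'a set \<Rightarrow> ('a \<Rightarrow> complex) \<Rightarrow> ('a \<Rightarrow> complex) \<Rightarrow> complex" where
  "ip I u v = (\<Sum>i\<in>I. cnj (u i) * v i)"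

definition ap :: "'a set \<Rightarrow> ('b \<Rightarrow> 'a \<Rightarrow> complex) \<Rightarrow> ('a \<Rightarrow> complex) \<Rightarrow> 'b \<Rightarrow> complex" where
  "ap I A v = (\<lambda>i. \<Sum>j\<in>I. A i j * v j)"

definition qf :: "'a set \<Rightarrow> 'a op \<Rightarrow> ('a \<Rightarrow> complex) \<Rightarrow> real" where
  "qf I A v = Re (ip I v (ap I A v))"

definition nrm2 :: "'a set \<Rightarrow> ('a \<Rightarrow> complex) \<Rightarrow> real" where
  "nrm2 I v = (\<Sum>i\<in>I. (cmod (v i))\<^sup>2)"

definition herm :: "'a set \<Rightarrow> 'a op \<Rightarrow> bool" where
  "herm I A \<longleftrightarrow> (\<forall>i\<in>I. \<forall>j\<in>I. A j i = cnj (A i j))"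

text \<open>\<open>qf\<close> keeps only the real part of the form, so Hermiticity does not follow
  from the inequality and is a clause of its own.\<close>

definition pos :: "'a set \<Rightarrow> 'a op \<Rightarrow> bool" where
  "pos I A \<longleftrightarrow> herm I A \<and> (\<forall>v. 0 \<le> qf I A v)"

text \<open>\<open>U k\<close> is the k-th vector, so the first argument is its label. Completeness
  is a clause of its own, so that expansions in the basis involve no dimension count.\<close>

definition onb :: "'a set \<Rightarrow> 'a op \<Rightarrow> bool" where
  "onb I U \<longleftrightarrow> (\<forall>k\<in>I. \<forall>l\<in>I. ip I (U k) (U l) = (if k = l then 1 else 0)) \<and>
     (\<forall>i\<in>I. \<forall>j\<in>I. (\<Sum>k\<in>I. U k i * cnj (U k j)) = (if i = j then 1 else 0))"

text \<open>The functional calculus: with \<open>h k = f (d k)\<close> it is f(A) for eigenvalues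
  \<open>d\<close>. Indexing by labels makes products and tensor products of such operators
  pointwise in \<open>h\<close>.\<close>

definition spc :: "'a set \<Rightarrow> 'a op \<Rightarrow> ('a \<Rightarrow> real) \<Rightarrow> 'a \<Rightarrow> 'a \<Rightarrow> complex" where
  "spc I U h = (\<lambda>i j. \<Sum>k\<in>I. of_real (h k) * U k i * cnj (U k j))"

definition spec :: "'a set \<Rightarrow> 'a op \<Rightarrow> 'a op \<Rightarrow> ('a \<Rightarrow> real) \<Rightarrow> bool" where
  "spec I A U d \<longleftrightarrow> onb I U \<and> (\<forall>i\<in>I. \<forall>j\<in>I. A i j = spc I U d i j)"

definition mm :: "'b set \<Rightarrow> ('a \<Rightarrow> 'b \<Rightarrow> complex) \<Rightarrow> ('b \<Rightarrow> 'c \<Rightarrow> complex) \<Rightarrow> 'a \<Rightarrow> 'c \<Rightarrow> complex" where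
  "mm I A B = (\<lambda>i j. \<Sum>k\<in>I. A i k * B k j)"

lemma ip_cong: "(\<And>i. i \<in> I \<Longrightarrow> u i = u' i) \<Longrightarrow> (\<And>i. i \<in> I \<Longrightarrow> v i = v' i) \<Longrightarrow> ip I u v = ip I u' v'"
  by (simp add: ip_def)

lemma ap_cong: "(\<And>j. j \<in> I \<Longrightarrow> A i j = A' i j) \<Longrightarrow> (\<And>i. i \<in> I \<Longrightarrow> v i = v' i) \<Longrightarrow> ap I A v i = ap I A' v' i"
  by (simp add: ap_def)

lemma qf_cong: "(\<And>i j. i \<in> I \<Longrightarrow> j \<in> I \<Longrightarrow> A i j = A' i j) \<Longrightarrow> (\<And>i. i \<in> I \<Longrightarrow> v i = v' i) \<Longrightarrow> qf I A v = qf I A' v'"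
  unfolding qf_def by (intro arg_cong[where f=Re] ip_cong ap_cong) auto

lemma herm_cong: "(\<And>i j. i \<in> I \<Longrightarrow> j \<in> I \<Longrightarrow> A i j = A' i j) \<Longrightarrow> herm I A = herm I A'"
  by (simp add: herm_def)

lemma pos_cong: "(\<And>i j. i \<in> I \<Longrightarrow> j \<in> I \<Longrightarrow> A i j = A' i j) \<Longrightarrow> pos I A = pos I A'"
  unfolding pos_def using herm_cong[of I A A'] qf_cong[of I A A'] by metis

lemma cnj_ip: "cnj (ip I u v) = ip I v u"
  by (simp add: ip_def mult.commute)

lemma cmod_ip_swap: "cmod (ip I u v) = cmod (ip I v u)"
  by (metis cnj_ip complex_mod_cnj)

lemma ip_sum_right: "ip I u (\<lambda>i. \<Sum>k\<in>K. f k i) = (\<Sum>k\<in>K. ip I u (f k))"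
  unfolding ip_def by (simp add: sum_distrib_left sum.swap[of _ I])

lemma ip_scale_right: "ip I u (\<lambda>i. c * v i) = c * ip I u v"
  unfolding ip_def by (simp add: sum_distrib_left mult_ac)

lemma ip_scale_left: "ip I (\<lambda>i. c * v i) u = cnj c * ip I v u"
  unfolding ip_def by (simp add: sum_distrib_left mult_ac)

lemma ip_add_right: "ip I u (\<lambda>i. v i + w i) = ip I u v + ip I u w"
  unfolding ip_def by (simp add: sum.distrib algebra_simps)

lemma ip_diff_right: "ip I u (\<lambda>i. v i - w i) = ip I u v - ip I u w"
  unfolding ip_def by (simp add: sum_subtractf algebra_simps)

lemma ip_self: "ip I v v = of_real (nrm2 I v)"
  unfolding ip_def nrm2_def by (simp add: mult.commute[of "cnj _"] complex_norm_square[symmetric])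

lemma nrm2_nonneg: "0 \<le> nrm2 I v"
  unfolding nrm2_def by (simp add: sum_nonneg)

lemma nrm2_eq_0: "finite I \<Longrightarrow> nrm2 I v = 0 \<longleftrightarrow> (\<forall>i\<in>I. v i = 0)"
  unfolding nrm2_def by (subst sum_nonneg_eq_0_iff) auto

lemma ap_mm: "ap I (mm J A B) v = ap J A (ap I B v)"
  unfolding ap_def mm_def by (rule ext) (simp add: sum_distrib_left sum_distrib_right mult_ac sum.swap[of _ I])

lemma ap_spc: "ap I (spc I U h) v = (\<lambda>i. \<Sum>k\<in>I. of_real (h k) * ip I (U k) v * U k i)"
proof
  fix i
  have "ap I (spc I U h) v i = (\<Sum>j\<in>I. \<Sum>k\<in>I. of_real (h k) * U k i * cnj (U k j) * v j)"
    unfolding ap_def spc_def by (simp add: sum_distrib_right)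
  also have "\<dots> = (\<Sum>k\<in>I. \<Sum>j\<in>I. of_real (h k) * U k i * cnj (U k j) * v j)" by (rule sum.swap)
  also have "\<dots> = (\<Sum>k\<in>I. of_real (h k) * ip I (U k) v * U k i)"
    unfolding ip_def by (simp add: sum_distrib_left sum_distrib_right mult_ac)
  finally show "ap I (spc I U h) v i = (\<Sum>k\<in>I. of_real (h k) * ip I (U k) v * U k i)" .
qed

lemma ap_sum: "ap I A (\<lambda>i. \<Sum>k\<in>K. f k i) = (\<lambda>i. \<Sum>k\<in>K. ap I A (f k) i)"
  unfolding ap_def by (rule ext) (simp add: sum_distrib_left sum.swap[of _ I])

lemma ap_scale: "ap I A (\<lambda>i. c * v i) = (\<lambda>i. c * ap I A v i)"
  unfolding ap_def by (rule ext) (simp add: sum_distrib_left mult_ac)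

lemma herm_ip: "herm I A \<Longrightarrow> ip I u (ap I A v) = ip I (ap I A u) v"
proof -
  assume h: "herm I A"
  have "ip I u (ap I A v) = (\<Sum>i\<in>I. \<Sum>j\<in>I. cnj (u i) * A i j * v j)"
    unfolding ip_def ap_def by (simp add: sum_distrib_left mult_ac)
  also have "\<dots> = (\<Sum>j\<in>I. \<Sum>i\<in>I. cnj (u i) * A i j * v j)" by (rule sum.swap)
  also have "\<dots> = (\<Sum>j\<in>I. \<Sum>i\<in>I. cnj (A j i * u i) * v j)"
  proof (intro sum.cong refl)
    fix i j assume "j \<in> I" "i \<in> I"
    then have "A i j = cnj (A j i)" using h unfolding herm_def by blast
    then show "cnj (u i) * A i j * v j = cnj (A j i * u i) * v j" by simp
  qed
  also have "\<dots> = ip I (ap I A u) v" unfolding ip_def ap_def by (simp add: sum_distrib_right)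
  finally show ?thesis .
qed

lemma herm_spc: "herm I (spc I U h)"
  unfolding herm_def spc_def by (simp add: mult_ac)

lemma herm_qf_ip: assumes "herm I A" shows "ip I v (ap I A v) = of_real (qf I A v)"
proof -
  have "cnj (ip I v (ap I A v)) = ip I v (ap I A v)" 
    using herm_ip[OF assms, of v v] cnj_ip[of I v "ap I A v"] by simp
  then show ?thesis unfolding qf_def by (simp add: complex_eq_iff)
qed

lemma spec_herm: "spec I A U d \<Longrightarrow> herm I A"
  using herm_spc herm_cong spec_def by metis

lemma spec_onb: "spec I A U d \<Longrightarrow> onb I U" by (simp add: spec_def)

lemma onb_expand: assumes "onb I U" "i \<in> I" "finite I"
  shows "v i = (\<Sum>k\<in>I. ip I (U k) v * U k i)"
proof -
  have "(\<Sum>k\<in>I. ip I (U k) v * U k i) = (\<Sum>k\<in>I. \<Sum>j\<in>I. U k i * cnj (U k j) * v j)"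
    unfolding ip_def by (simp add: sum_distrib_left mult_ac)
  also have "\<dots> = (\<Sum>j\<in>I. \<Sum>k\<in>I. U k i * cnj (U k j) * v j)" by (rule sum.swap)
  also have "\<dots> = (\<Sum>j\<in>I. (\<Sum>k\<in>I. U k i * cnj (U k j)) * v j)" by (simp add: sum_distrib_right)
  also have "\<dots> = (\<Sum>j\<in>I. (if i = j then v j else 0))"
    using assms unfolding onb_def by (intro sum.cong) auto
  finally show ?thesis using assms by simp
qed

lemma onb_ip: assumes "onb I U" "finite I"
  shows "ip I u v = (\<Sum>k\<in>I. cnj (ip I (U k) u) * ip I (U k) v)"
proof -
  have "ip I u v = ip I u (\<lambda>i. \<Sum>k\<in>I. ip I (U k) v * U k i)"
    by (rule ip_cong) (auto intro: onb_expand assms)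
  also have "\<dots> = (\<Sum>k\<in>I. ip I (U k) v * ip I u (U k))"
    by (simp add: ip_sum_right ip_scale_right)
  finally show ?thesis by (simp add: cnj_ip mult.commute)
qed

lemma parseval: assumes "onb I U" "finite I"
  shows "(\<Sum>k\<in>I. (cmod (ip I (U k) v))\<^sup>2) = nrm2 I v"
proof -
  have "of_real (\<Sum>k\<in>I. (cmod (ip I (U k) v))\<^sup>2) = ip I v v"
    by (subst onb_ip[OF assms]) (simp add: mult.commute[of "cnj _"] complex_norm_square[symmetric])
  then show ?thesis unfolding ip_self by (simp only: of_real_eq_iff)
qed

lemma onb_ipD: "onb I U \<Longrightarrow> k \<in> I \<Longrightarrow> l \<in> I \<Longrightarrow> ip I (U k) (U l) = (if k = l then 1 else 0)"
  by (simp add: onb_def)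

lemma onb_nrm2: "onb I U \<Longrightarrow> k \<in> I \<Longrightarrow> nrm2 I (U k) = 1"
  using ip_self[of I "U k"] onb_ipD[of I U k k] by (metis of_real_eq_1_iff)

lemma qf_spc: "qf I (spc I U d) v = (\<Sum>k\<in>I. d k * (cmod (ip I (U k) v))\<^sup>2)"
proof -
  have "ip I v (ap I (spc I U d) v) = (\<Sum>k\<in>I. of_real (d k) * (ip I (U k) v * ip I v (U k)))"
    unfolding ap_spc ip_sum_right ip_scale_right by (simp add: mult_ac)
  also have "\<dots> = of_real (\<Sum>k\<in>I. d k * (cmod (ip I (U k) v))\<^sup>2)"
    by (subst cnj_ip[symmetric]) (simp add: complex_norm_square[symmetric])
  finally show ?thesis unfolding qf_def by simp
qed

lemma spec_qf: assumes "spec I A U d" shows "qf I A v = (\<Sum>k\<in>I. d k * (cmod (ip I (U k) v))\<^sup>2)"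
  using qf_cong[of I A "spc I U d" v v] qf_spc assms by (metis spec_def)

lemma spec_ap: assumes "spec I A U d" "i \<in> I" shows "ap I A v i = ap I (spc I U d) v i"
  using assms by (intro ap_cong) (auto simp: spec_def)

lemma spc_eigen: assumes "onb I U" "finite I" "k \<in> I"
  shows "ap I (spc I U h) (U k) i = of_real (h k) * U k i"
proof -
  have "ap I (spc I U h) (U k) i = (\<Sum>l\<in>I. if l = k then of_real (h k) * U k i else 0)"
    unfolding ap_spc using assms by (intro sum.cong) (auto simp: onb_ipD)
  then show ?thesis using assms by simp
qed

lemma spec_eigen: assumes "spec I A U d" "finite I" "k \<in> I" "i \<in> I"
  shows "ap I A (U k) i = of_real (d k) * U k i"
  using assms spc_eigen spec_ap by (metis spec_def)

lemma spec_qf_basis: assumes "spec I A U d" "finite I" "k \<in> I"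
  shows "qf I A (U k) = d k"
proof -
  have "ip I (U k) (ap I A (U k)) = ip I (U k) (\<lambda>i. of_real (d k) * U k i)"
    by (rule ip_cong) (auto simp: spec_eigen[OF assms])
  then show ?thesis unfolding qf_def using assms by (simp add: ip_scale_right onb_ipD[OF spec_onb])
qed

lemma spec_pos: assumes "spec I A U d" "\<And>k. k \<in> I \<Longrightarrow> 0 \<le> d k" shows "pos I A"
  unfolding pos_def using spec_herm[OF assms(1)] spec_qf[OF assms(1)] assms(2) by (auto intro!: sum_nonneg)

lemma spec_nonneg: assumes "spec I A U d" "finite I" "pos I A" "k \<in> I" shows "0 \<le> d k"
  using spec_qf_basis[OF assms(1,2,4)] assms(3) unfolding pos_def by metis

text \<open>A strictly upper triangular matrix squares to a matrix of trace zero, whereas a Hermitian $A$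
  has $\mathrm{tr}\,A^2 = \sum |A_{ij}|^2$.\<close>

lemma mat_nonzero_eigen:
  fixes A :: "complex mat"
  assumes A: "A \<in> carrier_mat n n" and h: "\<And>i j. i < n \<Longrightarrow> j < n \<Longrightarrow> A $$ (j,i) = cnj (A $$ (i,j))"
    and nz: "\<exists>i<n. \<exists>j<n. A $$ (i,j) \<noteq> 0"
  shows "\<exists>\<mu> v. \<mu> \<noteq> 0 \<and> v \<in> carrier_vec n \<and> v \<noteq> 0\<^sub>v n \<and> A *\<^sub>v v = \<mu> \<cdot>\<^sub>v v"
proof (rule ccontr)
  assume c: "\<not> ?thesis"
  obtain as where as: "char_poly A = (\<Prod>a\<leftarrow>as. [:- a, 1:])" using char_poly_factorized[OF A] by blast
  \<comment> \<open>The negated goal forces every root of the characteristic polynomial to be 0, so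
    the Schur form \<open>B\<close> has zero diagonal.\<close>
  have a0: "a = 0" if "a \<in> set as" for a
  proof (rule ccontr)
    assume "a \<noteq> 0"
    have "poly (char_poly A) a = 0" unfolding as poly_prod_list using that
      by (auto simp: prod_list_zero_iff image_iff)
    hence "eigenvalue A a" using eigenvalue_root_char_poly[OF A] by simp
    then obtain v where "eigenvector A v a" unfolding eigenvalue_def by blast
    thus False using c \<open>a \<noteq> 0\<close> A unfolding eigenvector_def by auto
  qed
  obtain B P Q where sd: "schur_decomposition A as = (B,P,Q)" by (cases "schur_decomposition A as") auto
  from schur_decomposition[OF A as sd] have sim: "similar_mat_wit A B P Q"
    and ut: "upper_triangular B" and dg: "diag_mat B = as" by auto
  note w = similar_mat_witD2[OF A sim]
  have B: "B \<in> carrier_mat n n" and P: "P \<in> carrier_mat n n" and Q: "Q \<in> carrier_mat n n" using w by auto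
  have b0: "B $$ (i,j) = 0" if "i < n" "j \<le> i" for i j
  proof (cases "j = i")
    case True
    have "B $$ (i,i) \<in> set (diag_mat B)" unfolding diag_mat_def using that B by auto
    then show ?thesis using a0 dg True by auto
  next
    case False then show ?thesis using ut that B unfolding upper_triangular_def by auto
  qed
  have tr: "(\<Sum>i<n. (X * Y) $$ (i,i)) = (\<Sum>i<n. (Y * X) $$ (i,i))"
    if "X \<in> carrier_mat n n" "Y \<in> carrier_mat n n" for X Y :: "complex mat"
  proof -
    have "(\<Sum>i<n. (X * Y) $$ (i,i)) = (\<Sum>i<n. \<Sum>k<n. X $$ (i,k) * Y $$ (k,i))"
      using that by (auto simp: scalar_prod_def atLeast0LessThan intro!: sum.cong)
    also have "\<dots> = (\<Sum>k<n. \<Sum>i<n. X $$ (i,k) * Y $$ (k,i))" by (rule sum.swap)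
    also have "\<dots> = (\<Sum>i<n. (Y * X) $$ (i,i))"
      using that by (auto simp: scalar_prod_def atLeast0LessThan mult.commute intro!: sum.cong)
    finally show ?thesis .
  qed
  have "A * A = (P * (B * B)) * Q"
  proof -
    have "A * A = (P * B * Q) * (P * B * Q)" using w by simp
    also have "\<dots> = (P * B) * (Q * P) * (B * Q)" using P B Q by (simp add: assoc_mult_mat[of _ n n _ n _ n])
    also have "\<dots> = (P * (B * B)) * Q" using w P B Q by (simp add: assoc_mult_mat[of _ n n _ n _ n])
    finally show ?thesis .
  qed
  then have "(\<Sum>i<n. (A * A) $$ (i,i)) = (\<Sum>i<n. (Q * (P * (B * B))) $$ (i,i))"
    using tr[of "P * (B * B)" Q] P B Q by auto
  also have "Q * (P * (B * B)) = (Q * P) * (B * B)"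
    by (rule assoc_mult_mat[symmetric, of _ n n _ n _ n]) (use P B Q in auto)
  also have "\<dots> = B * B" using w B by simp
  also have "(\<Sum>i<n. (B * B) $$ (i,i)) = (\<Sum>i<n. \<Sum>k<n. B $$ (i,k) * B $$ (k,i))"
    using B by (auto simp: scalar_prod_def atLeast0LessThan intro!: sum.cong)
  also have "\<dots> = 0" 
  proof (intro sum.neutral ballI)
    fix i k assume "i \<in> {..<n}" "k \<in> {..<n}"
    then show "B $$ (i,k) * B $$ (k,i) = 0" using b0[of i k] b0[of k i] by (cases "k \<le> i") auto
  qed
  finally have "0 = (\<Sum>i<n. (A * A) $$ (i,i))" by simp
  also have "\<dots> = (\<Sum>i<n. \<Sum>k<n. A $$ (i,k) * A $$ (k,i))"
    using A by (auto simp: scalar_prod_def atLeast0LessThan intro!: sum.cong)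
  also have "\<dots> = of_real (\<Sum>i<n. \<Sum>k<n. (cmod (A $$ (i,k)))\<^sup>2)"
    unfolding of_real_sum
  proof (intro sum.cong refl)
    fix i k assume "i \<in> {..<n}" "k \<in> {..<n}"
    then have e: "A $$ (k,i) = cnj (A $$ (i,k))" using h by blast
    show "A $$ (i,k) * A $$ (k,i) = of_real ((cmod (A $$ (i,k)))\<^sup>2)"
      unfolding e by (rule complex_norm_square[symmetric])
  qed
  finally have "complex_of_real (\<Sum>i<n. \<Sum>k<n. (cmod (A $$ (i,k)))\<^sup>2) = 0" by (rule sym)
  hence "(\<Sum>i<n. \<Sum>k<n. (cmod (A $$ (i,k)))\<^sup>2) = 0" by (simp only: of_real_eq_0_iff)
  hence "\<forall>i<n. \<forall>k<n. A $$ (i,k) = 0"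
    by (subst (asm) sum_nonneg_eq_0_iff) (auto intro!: sum_nonneg simp: sum_nonneg_eq_0_iff)
  thus False using nz by auto
qed


text \<open>Carries the matrix statement to an arbitrary finite index set along an enumeration
  \<open>f\<close> of \<open>I\<close>; the rest of the spectral theorem is proved without
  matrices.\<close>

lemma herm_nonzero_eigen:
  assumes fin: "finite I" and h: "herm I A" and nz: "i0 \<in> I" "j0 \<in> I" "A i0 j0 \<noteq> 0"
  shows "\<exists>\<mu> v. \<mu> \<noteq> 0 \<and> (\<exists>i\<in>I. v i \<noteq> 0) \<and> (\<forall>i\<in>I. ap I A v i = \<mu> * v i)"
proof -
  define n where "n = card I"
  obtain f where f: "bij_betw f {..<n} I"
    using ex_bij_betw_nat_finite[OF fin] unfolding n_def atLeast0LessThan by blast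
  define g where "g = inv_into {..<n} f"
  have g: "g i < n" "f (g i) = i" if "i \<in> I" for i
    using that f unfolding g_def bij_betw_def by (auto simp: f_inv_into_f inv_into_into[of i f "{..<n}", simplified])
  have fI: "f i \<in> I" if "i < n" for i using f that unfolding bij_betw_def by auto
  have gf: "g (f i) = i" if "i < n" for i
    using f that unfolding g_def bij_betw_def by (auto simp: inv_into_f_f)
  define M where "M = mat n n (\<lambda>(i,j). A (f i) (f j))"
  have M: "M \<in> carrier_mat n n" by (simp add: M_def)
  have "\<exists>\<mu> v. \<mu> \<noteq> 0 \<and> v \<in> carrier_vec n \<and> v \<noteq> 0\<^sub>v n \<and> M *\<^sub>v v = \<mu> \<cdot>\<^sub>v v"
  proof (rule mat_nonzero_eigen[OF M])
    fix i j assume ij: "i < n" "j < n"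
    then have "A (f j) (f i) = cnj (A (f i) (f j))" using h fI unfolding herm_def by blast
    then show "M $$ (j,i) = cnj (M $$ (i,j))" using ij by (simp add: M_def)
  next
    have "M $$ (g i0, g j0) \<noteq> 0" using nz g by (simp add: M_def)
    then show "\<exists>i<n. \<exists>j<n. M $$ (i, j) \<noteq> 0" using g nz by blast
  qed
  then obtain \<mu> v where mv: "\<mu> \<noteq> 0" "v \<in> carrier_vec n" "v \<noteq> 0\<^sub>v n" "M *\<^sub>v v = \<mu> \<cdot>\<^sub>v v" by blast
  define w where "w i = v $ (g i)" for i
  have "\<exists>k<n. v $ k \<noteq> 0" using mv(2,3) by (metis carrier_vecD dim_vec eq_vecI index_zero_vec(1) index_zero_vec(2))
  then obtain k where "k < n" "v $ k \<noteq> 0" by blast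
  then have 1: "\<exists>i\<in>I. w i \<noteq> 0" using fI[of k] gf[of k] unfolding w_def by (intro bexI[of _ "f k"]) auto
  have "ap I A w i = \<mu> * w i" if i: "i \<in> I" for i
  proof -
    have "ap I A w i = (\<Sum>j<n. A i (f j) * w (f j))"
      unfolding ap_def by (rule sum.reindex_bij_betw[OF f, symmetric])
    also have "\<dots> = (\<Sum>j<n. M $$ (g i, j) * v $ j)"
      using g[OF i] by (intro sum.cong) (auto simp: M_def w_def gf)
    also have "\<dots> = (M *\<^sub>v v) $ (g i)"
      using M mv(2) g[OF i] by (simp add: scalar_prod_def atLeast0LessThan)
    also have "\<dots> = \<mu> * w i" using g[OF i] mv(2) unfolding mv(4) w_def by simp
    finally show ?thesis .
  qed
  then show ?thesis using mv(1) 1 by blast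
qed

section \<open>Orthonormal families and the spectral theorem\<close>

definition residual :: "'a set \<Rightarrow> 'k set \<Rightarrow> ('k \<Rightarrow> 'a \<Rightarrow> complex) \<Rightarrow> ('a \<Rightarrow> complex) \<Rightarrow> 'a \<Rightarrow> complex" where
  "residual I K u v = (\<lambda>i. v i - (\<Sum>k\<in>K. ip I (u k) v * u k i))"

definition orthon :: "'a set \<Rightarrow> 'k set \<Rightarrow> ('k \<Rightarrow> 'a \<Rightarrow> complex) \<Rightarrow> bool" where
  "orthon I K u \<longleftrightarrow> (\<forall>k\<in>K. \<forall>l\<in>K. ip I (u k) (u l) = (if k = l then 1 else 0))"

lemma residual_orth: assumes "orthon I K u" "finite K" "k \<in> K"
  shows "ip I (u k) (residual I K u v) = 0"
proof -
  have "ip I (u k) (residual I K u v) = ip I (u k) v - (\<Sum>l\<in>K. ip I (u l) v * ip I (u k) (u l))"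
    unfolding residual_def ip_diff_right ip_sum_right ip_scale_right ..
  also have "(\<Sum>l\<in>K. ip I (u l) v * ip I (u k) (u l)) = (\<Sum>l\<in>K. if k = l then ip I (u l) v else 0)"
    using assms unfolding orthon_def by (intro sum.cong) auto
  finally show ?thesis using assms by simp
qed

lemma residual_id: "(\<And>k. k \<in> K \<Longrightarrow> ip I (u k) v = 0) \<Longrightarrow> residual I K u v = v"
  unfolding residual_def by simp

lemma residual_nrm2: assumes "orthon I K u" "finite K"
  shows "nrm2 I (residual I K u v) = nrm2 I v - (\<Sum>k\<in>K. (cmod (ip I (u k) v))\<^sup>2)"
proof -
  let ?r = "residual I K u v"
  have "ip I ?r ?r = ip I ?r v - (\<Sum>k\<in>K. ip I (u k) v * ip I ?r (u k))"
    by (subst (2) residual_def) (unfold ip_diff_right ip_sum_right ip_scale_right, rule refl)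
  also have "(\<Sum>k\<in>K. ip I (u k) v * ip I ?r (u k)) = 0"
  proof (intro sum.neutral ballI)
    fix k assume "k \<in> K"
    then have "ip I ?r (u k) = 0" using residual_orth[OF assms, of k v] cnj_ip[of I "u k" ?r] by simp
    then show "ip I (u k) v * ip I ?r (u k) = 0" by simp
  qed
  also have "ip I ?r v = cnj (ip I v ?r)" by (simp add: cnj_ip)
  also have "ip I v ?r = ip I v v - (\<Sum>k\<in>K. ip I (u k) v * ip I v (u k))"
    unfolding residual_def ip_diff_right ip_sum_right ip_scale_right ..
  also have "(\<Sum>k\<in>K. ip I (u k) v * ip I v (u k)) = of_real (\<Sum>k\<in>K. (cmod (ip I (u k) v))\<^sup>2)"
    unfolding of_real_sum by (intro sum.cong refl) (metis cnj_ip complex_norm_square)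
  finally have "of_real (nrm2 I ?r) = complex_of_real (nrm2 I v - (\<Sum>k\<in>K. (cmod (ip I (u k) v))\<^sup>2))"
    by (simp add: ip_self)
  then show ?thesis by (simp only: of_real_eq_iff)
qed

lemma ip_unit_right: "finite I \<Longrightarrow> i \<in> I \<Longrightarrow> ip I u (\<lambda>j. if j = i then 1 else 0) = cnj (u i)"
  unfolding ip_def by (simp add: if_distrib cong: if_cong)

lemma ip_unit_left: "finite I \<Longrightarrow> i \<in> I \<Longrightarrow> ip I (\<lambda>j. if j = i then 1 else 0) u = u i"
  by (subst cnj_ip[symmetric]) (simp add: ip_unit_right)

text \<open>The left side is the trace of the projection onto the complement of the family, so this
  is the dimension count: a positive value yields a vector outside the span, the value 0 yields
  completeness.\<close>

lemma sum_residual_unit: assumes "orthon I K u" "finite K" "finite I"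
  shows "(\<Sum>i\<in>I. nrm2 I (residual I K u (\<lambda>j. if j = i then 1 else 0))) = real (card I) - real (card K)"
proof -
  have "(\<Sum>i\<in>I. nrm2 I (residual I K u (\<lambda>j. if j = i then 1 else 0)))
      = (\<Sum>i\<in>I. 1 - (\<Sum>k\<in>K. (cmod (u k i))\<^sup>2))"
  proof (intro sum.cong refl)
    fix i assume i: "i \<in> I"
    have "nrm2 I (\<lambda>j. if j = i then 1 else 0) = (\<Sum>j\<in>I. if j = i then 1 else 0)"
      unfolding nrm2_def by (intro sum.cong) auto
    then show "nrm2 I (residual I K u (\<lambda>j. if j = i then 1 else 0)) = 1 - (\<Sum>k\<in>K. (cmod (u k i))\<^sup>2)"
      using i assms by (simp add: residual_nrm2 ip_unit_right)
  qed
  also have "\<dots> = real (card I) - (\<Sum>k\<in>K. nrm2 I (u k))"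
    unfolding nrm2_def by (simp add: sum_subtractf sum.swap[of _ I])
  also have "(\<Sum>k\<in>K. nrm2 I (u k)) = (\<Sum>k\<in>K. 1)"
  proof (intro sum.cong refl)
    fix k assume "k \<in> K"
    then have "ip I (u k) (u k) = 1" using assms unfolding orthon_def by auto
    then show "nrm2 I (u k) = 1" unfolding ip_self by (metis of_real_eq_1_iff)
  qed
  finally show ?thesis by simp
qed

lemma herm_iff_ip: assumes "finite I" "\<And>u v. ip I u (ap I A v) = ip I (ap I A u) v" shows "herm I A"
  unfolding herm_def
proof (intro ballI)
  fix i j assume ij: "i \<in> I" "j \<in> I"
  let ?e = "\<lambda>i j. if j = i then 1 else (0::complex)"
  have e: "ap I A (?e j) i = A i j" if "j \<in> I" for i j
    using that assms(1) unfolding ap_def by (simp add: if_distrib cong: if_cong)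
  have "ip I (?e j) (ap I A (?e i)) = ip I (ap I A (?e j)) (?e i)" by (rule assms(2))
  then show "A j i = cnj (A i j)" using ij assms(1) by (simp add: ip_unit_left ip_unit_right e)
qed

text \<open>Compress $A$ to the orthogonal complement of the eigenvectors found so far: an eigenvector of the
  compression with nonzero eigenvalue lies in the complement, and if there is none then $A$ vanishes there.\<close>

lemma extend_eigenvector:
  assumes fin: "finite I" "finite K" and h: "herm I A" and o: "orthon I K u"
    and ev: "\<And>k i. k \<in> K \<Longrightarrow> i \<in> I \<Longrightarrow> ap I A (u k) i = of_real (lam k) * u k i"
    and card: "card K < card I"
  shows "\<exists>y \<mu>. (\<exists>i\<in>I. y i \<noteq> 0) \<and> (\<forall>k\<in>K. ip I (u k) y = 0) \<and> (\<forall>i\<in>I. ap I A y i = \<mu> * y i)"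
proof -
  define Q where "Q i j = (if i = j then 1 else 0) - (\<Sum>k\<in>K. u k i * cnj (u k j))" for i j
  have Q: "ap I Q v i = residual I K u v i" if "i \<in> I" for v i
  proof -
    have "ap I Q v i = (\<Sum>j\<in>I. (if i = j then v j else 0)) - (\<Sum>j\<in>I. \<Sum>k\<in>K. u k i * cnj (u k j) * v j)"
      unfolding ap_def Q_def by (simp add: left_diff_distrib sum_subtractf sum_distrib_right if_distrib[of "\<lambda>x. x * _"] cong: if_cong)
    also have "(\<Sum>j\<in>I. \<Sum>k\<in>K. u k i * cnj (u k j) * v j) = (\<Sum>k\<in>K. ip I (u k) v * u k i)"
      by (subst sum.swap) (simp add: ip_def sum_distrib_left sum_distrib_right mult_ac)
    finally show ?thesis using that fin by (simp add: residual_def)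
  qed
  have hQ: "herm I Q" unfolding herm_def Q_def by (auto simp: mult.commute)
  define H where "H = mm I Q (mm I A Q)"
  have apH: "ap I H v = ap I Q (ap I A (ap I Q v))" for v unfolding H_def ap_mm ..
  have hH: "herm I H"
    by (rule herm_iff_ip[OF fin(1)]) (simp add: apH herm_ip[OF hQ] herm_ip[OF h])
  have uA: "ip I (u k) (ap I A v) = of_real (lam k) * ip I (u k) v" if "k \<in> K" for k v
  proof -
    have "ip I (u k) (ap I A v) = ip I (ap I A (u k)) v" by (rule herm_ip[OF h])
    also have "\<dots> = ip I (\<lambda>i. of_real (lam k) * u k i) v" by (rule ip_cong) (auto simp: ev[OF that])
    finally show ?thesis by (simp add: ip_scale_left)
  qed
  have HA: "ap I H y i = ap I A y i" if y: "\<forall>k\<in>K. ip I (u k) y = 0" and i: "i \<in> I" for y i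
  proof -
    have "ap I A (ap I Q y) = ap I A y"
      by (rule ext, rule ap_cong) (use y in \<open>auto simp: Q residual_id\<close>)
    then have "ap I H y i = residual I K u (ap I A y) i" using Q[OF i] unfolding apH by simp
    also have "\<dots> = ap I A y i" using y uA by (subst residual_id) auto
    finally show ?thesis .
  qed
  show ?thesis
  proof (cases "\<exists>i\<in>I. \<exists>j\<in>I. H i j \<noteq> 0")
    case True
    then obtain \<mu> v where v: "\<mu> \<noteq> 0" "\<exists>i\<in>I. v i \<noteq> 0" "\<forall>i\<in>I. ap I H v i = \<mu> * v i"
      using herm_nonzero_eigen[OF fin(1) hH] by blast
    have o2: "ip I (u k) v = 0" if "k \<in> K" for k
    proof -
      have "\<mu> * ip I (u k) v = ip I (u k) (ap I H v)"
        unfolding ip_scale_right[symmetric] by (rule ip_cong) (use v in auto)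
      also have "\<dots> = ip I (u k) (residual I K u (ap I A (ap I Q v)))"
        unfolding apH by (rule ip_cong) (auto simp: Q)
      also have "\<dots> = 0" using residual_orth[OF o fin(2) that] .
      finally show ?thesis using v by simp
    qed
    then show ?thesis using v HA by (metis (no_types, lifting))
  next
    case False
    \<comment> \<open>The compression vanishes, but \<open>card K < card I\<close> makes the trace
      of the complement projection nonzero; the residual of a suitable unit vector is then an
      eigenvector with eigenvalue 0.\<close>
    have "(\<Sum>i\<in>I. nrm2 I (residual I K u (\<lambda>j. if j = i then 1 else 0))) \<noteq> 0"
      using sum_residual_unit[OF o fin(2,1)] card by simp
    then obtain i where i: "i \<in> I" "nrm2 I (residual I K u (\<lambda>j. if j = i then 1 else 0)) \<noteq> 0"
      by (meson sum.neutral)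
    define y where "y = residual I K u (\<lambda>j. if j = i then 1 else 0)"
    have 1: "\<exists>i\<in>I. y i \<noteq> 0" using i(2) nrm2_eq_0[OF fin(1)] unfolding y_def by blast
    have 2: "\<forall>k\<in>K. ip I (u k) y = 0" using residual_orth[OF o fin(2)] unfolding y_def by blast
    have "ap I A y i = 0 * y i" if "i \<in> I" for i
      using HA[OF 2 that] False that unfolding ap_def[of I H] by simp
    then show ?thesis using 1 2 by blast
  qed
qed

lemma eigenvalue_real: assumes "herm I A" "finite I" "i \<in> I" "y i \<noteq> 0" "\<forall>i\<in>I. ap I A y i = \<mu> * y i"
  shows "\<mu> \<in> \<real>"
proof -
  have n: "nrm2 I y \<noteq> 0" using nrm2_eq_0[OF assms(2)] assms by blast
  have "of_real (qf I A y) = ip I y (ap I A y)" using herm_qf_ip[OF assms(1)] by simp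
  also have "\<dots> = ip I y (\<lambda>i. \<mu> * y i)" by (rule ip_cong) (use assms in auto)
  also have "\<dots> = \<mu> * of_real (nrm2 I y)" by (simp add: ip_scale_right ip_self)
  finally have "\<mu> = of_real (qf I A y / nrm2 I y)" using n by (simp add: field_simps)
  then show ?thesis by simp
qed

lemma eigenfamily:
  assumes fin: "finite I" and h: "herm I A"
  shows "m \<le> card I \<Longrightarrow> \<exists>u lam. orthon I {..<m} u \<and> (\<forall>k<m. \<forall>i\<in>I. ap I A (u k) i = of_real (lam k) * u k i)"
proof (induction m)
  case 0 show ?case by (auto simp: orthon_def)
next
  case (Suc m)
  then obtain u and lam :: "nat \<Rightarrow> real" where u: "orthon I {..<m} u"
      "\<And>k i. k \<in> {..<m} \<Longrightarrow> i \<in> I \<Longrightarrow> ap I A (u k) i = of_real (lam k) * u k i" by auto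
  from extend_eigenvector[OF fin finite_lessThan h u] Suc obtain y \<mu> where
    y: "\<exists>i\<in>I. y i \<noteq> 0" "\<forall>k\<in>{..<m}. ip I (u k) y = 0" "\<forall>i\<in>I. ap I A y i = \<mu> * y i" by auto
  have "\<mu> \<in> \<real>" using eigenvalue_real[OF h fin] y by blast
  then obtain \<nu> where nu: "\<mu> = of_real \<nu>" by (auto simp: Reals_def)
  have n: "nrm2 I y > 0" using y(1) nrm2_eq_0[OF fin] nrm2_nonneg[of I y] by (metis less_eq_real_def)
  define c where "c = complex_of_real (1 / sqrt (nrm2 I y))"
  define w where "w = (\<lambda>i. c * y i)"
  have ww: "ip I w w = 1"
  proof -
    have "ip I w w = of_real ((1 / sqrt (nrm2 I y)) * (1 / sqrt (nrm2 I y)) * nrm2 I y)"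
      unfolding w_def ip_scale_left ip_scale_right ip_self c_def by (simp only: complex_cnj_complex_of_real of_real_mult mult.assoc)
    also have "(1 / sqrt (nrm2 I y)) * (1 / sqrt (nrm2 I y)) * nrm2 I y = 1"
      using n by (simp add: field_simps)
    finally show ?thesis by simp
  qed
  have uw: "ip I (u k) w = 0" if "k < m" for k
    using y(2) that by (simp add: w_def ip_scale_right)
  then have wu: "ip I w (u k) = 0" if "k < m" for k using that cnj_ip[of I "u k" w] by simp
  have Aw: "ap I A w i = of_real \<nu> * w i" if "i \<in> I" for i
    using y(3) that by (simp add: w_def ap_scale nu)
  have "orthon I {..<Suc m} (u(m := w))"
    using u(1) ww uw wu unfolding orthon_def by (auto simp: less_Suc_eq)
  moreover have "\<forall>k<Suc m. \<forall>i\<in>I. ap I A ((u(m := w)) k) i = of_real ((lam(m := \<nu>)) k) * (u(m := w)) k i"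
    using u(2) Aw by (auto simp: less_Suc_eq)
  ultimately show ?case by blast
qed

text \<open>Insert the resolution of the identity to the right of \<open>A\<close>: an orthonormal
  basis of eigenvectors determines the operator. Later decompositions, such as that of a pinched
  operator, are recognized in this way.\<close>

lemma eigenbasis_spec: assumes onb: "onb I U" and fin: "finite I"
    and ev: "\<And>k i. k \<in> I \<Longrightarrow> i \<in> I \<Longrightarrow> ap I A (U k) i = of_real (d k) * U k i"
  shows "spec I A U d"
proof -
  have compl: "(\<Sum>k\<in>I. U k i * cnj (U k j)) = (if i = j then 1 else 0)" if "i \<in> I" "j \<in> I" for i j
    using onb that unfolding onb_def by blast
  have "A i j = spc I U d i j" if ij: "i \<in> I" "j \<in> I" for i j
  proof -
    have "A i j = (\<Sum>l\<in>I. A i l * (if l = j then 1 else 0))" using ij fin by (simp add: if_distrib cong: if_cong)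
    also have "\<dots> = (\<Sum>l\<in>I. \<Sum>k\<in>I. A i l * U k l * cnj (U k j))"
      using compl ij by (intro sum.cong refl) (simp add: sum_distrib_left[symmetric] mult.assoc)
    also have "\<dots> = (\<Sum>k\<in>I. \<Sum>l\<in>I. A i l * U k l * cnj (U k j))" by (rule sum.swap)
    also have "\<dots> = (\<Sum>k\<in>I. ap I A (U k) i * cnj (U k j))" unfolding ap_def by (simp add: sum_distrib_right)
    also have "\<dots> = spc I U d i j" unfolding spc_def 
      using ev ij by (intro sum.cong) auto
    finally show ?thesis .
  qed
  then show ?thesis using onb unfolding spec_def by blast
qed

theorem spectral: assumes fin: "finite I" and h: "herm I A"
  shows "\<exists>U d. spec I A U d"
proof -
  obtain u lam where u: "orthon I {..<card I} u" 
    and ev: "\<forall>k<card I. \<forall>i\<in>I. ap I A (u k) i = of_real (lam k) * u k i"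
    using eigenfamily[OF fin h, of "card I"] by auto
  obtain g where g: "bij_betw g I {..<card I}"
    using ex_bij_betw_finite_nat[OF fin] unfolding atLeast0LessThan by blast
  have gI: "g k < card I" if "k \<in> I" for k using g that unfolding bij_betw_def by auto
  define U where "U k = u (g k)" for k
  define d where "d k = lam (g k)" for k
  have o: "ip I (U k) (U l) = (if k = l then 1 else 0)" if "k \<in> I" "l \<in> I" for k l
    using u that gI g unfolding orthon_def U_def bij_betw_def inj_on_def by auto
  have oo: "orthon I I U" using o unfolding orthon_def by blast
  \<comment> \<open>With as many vectors as indices all residuals of unit vectors vanish, and their
    components spell out the completeness relation.\<close>
  have "(\<Sum>i\<in>I. nrm2 I (residual I I U (\<lambda>j. if j = i then 1 else 0))) = 0"
    using sum_residual_unit[OF oo fin fin] by simp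
  then have r0: "nrm2 I (residual I I U (\<lambda>j. if j = i then 1 else 0)) = 0" if "i \<in> I" for i
    using that fin by (subst (asm) sum_nonneg_eq_0_iff) (auto simp: nrm2_nonneg)
  have compl: "(\<Sum>k\<in>I. U k i * cnj (U k j)) = (if i = j then 1 else 0)" if ij: "i \<in> I" "j \<in> I" for i j
  proof -
    have "residual I I U (\<lambda>j'. if j' = j then 1 else 0) i = 0"
      using r0[OF ij(2)] nrm2_eq_0[OF fin] ij(1) by blast
    then show ?thesis using ij fin unfolding residual_def by (simp add: ip_unit_right mult.commute)
  qed
  have onb: "onb I U" unfolding onb_def using o compl by blast
  have "spec I A U d"
    by (rule eigenbasis_spec[OF onb fin]) (use ev gI in \<open>auto simp: U_def d_def\<close>)
  then show ?thesis by blast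
qed

section \<open>Convexity and pinching\<close>

text \<open>Convexity as a tangent at y, by the mean value theorem on the positive axis; x = 0 is
  separate and reduces to (1 - \<alpha>) y^\<alpha> \<le> 0.\<close>

lemma powr_tangent: fixes \<alpha> x y :: real assumes "\<alpha> \<ge> 1" "0 \<le> x" "0 < y"
  shows "y powr \<alpha> + \<alpha> * y powr (\<alpha> - 1) * (x - y) \<le> x powr \<alpha>"
proof (cases "x = 0")
  case True
  have "y powr (\<alpha> - 1) * y = y powr \<alpha>" using assms by (simp add: powr_diff)
  then have "y powr \<alpha> + \<alpha> * y powr (\<alpha> - 1) * (0 - y) = (1 - \<alpha>) * y powr \<alpha>" by (simp add: algebra_simps)
  also have "\<dots> \<le> 0" using assms by (simp add: mult_nonpos_nonneg)
  finally show ?thesis using True by simp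
next
  case False
  then have x: "x > 0" using assms by simp
  have d: "((\<lambda>z. z powr \<alpha>) has_real_derivative \<alpha> * z powr (\<alpha> - 1)) (at z)" if "z > 0" for z
    using that by (auto intro!: derivative_eq_intros)
  consider "x = y" | "x < y" | "y < x" by linarith
  then have "\<alpha> * y powr (\<alpha> - 1) * (x - y) \<le> x powr \<alpha> - y powr \<alpha>"
  proof cases
    case 2
    obtain z where z: "x < z" "z < y" "y powr \<alpha> - x powr \<alpha> = (y - x) * (\<alpha> * z powr (\<alpha> - 1))"
      using MVT2[OF 2, of "\<lambda>z. z powr \<alpha>" "\<lambda>z. \<alpha> * z powr (\<alpha> - 1)"] d x by fastforce
    have "(y - x) * (\<alpha> * z powr (\<alpha> - 1)) \<le> (y - x) * (\<alpha> * y powr (\<alpha> - 1))"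
      using assms z x by (intro mult_left_mono powr_mono2) auto
    then show ?thesis using z(3) by (simp add: algebra_simps)
  next
    case 3
    obtain z where z: "y < z" "z < x" "x powr \<alpha> - y powr \<alpha> = (x - y) * (\<alpha> * z powr (\<alpha> - 1))"
      using MVT2[OF 3, of "\<lambda>z. z powr \<alpha>" "\<lambda>z. \<alpha> * z powr (\<alpha> - 1)"] d assms by fastforce
    have "(x - y) * (\<alpha> * y powr (\<alpha> - 1)) \<le> (x - y) * (\<alpha> * z powr (\<alpha> - 1))"
      using assms z by (intro mult_left_mono powr_mono2) auto
    then show ?thesis using z(3) by (simp add: algebra_simps)
  qed simp
  then show ?thesis by simp
qed

text \<open>Total mass below 1 is allowed because the missing mass may be placed at 0, where
  x^\<alpha> vanishes. The proof adds up the tangents at the mean m.\<close>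

lemma jensen_powr: fixes w x :: "'k \<Rightarrow> real" 
  assumes "\<alpha> \<ge> 1" "\<And>k. k \<in> K \<Longrightarrow> 0 \<le> w k" "\<And>k. k \<in> K \<Longrightarrow> 0 \<le> x k" "(\<Sum>k\<in>K. w k) \<le> 1"
  shows "(\<Sum>k\<in>K. w k * x k) powr \<alpha> \<le> (\<Sum>k\<in>K. w k * x k powr \<alpha>)"
proof -
  define m where "m = (\<Sum>k\<in>K. w k * x k)"
  define W where "W = (\<Sum>k\<in>K. w k)"
  have m0: "m \<ge> 0" unfolding m_def by (intro sum_nonneg mult_nonneg_nonneg assms)
  show ?thesis
  proof (cases "m = 0")
    case True
    then show ?thesis using assms unfolding m_def[symmetric] by (auto intro!: sum_nonneg)
  next
    case False
    then have mp: "m > 0" using m0 by simp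
    have gen: "(\<Sum>k\<in>K. w k * (A + B * (x k - c))) = (\<Sum>k\<in>K. w k) * A + B * ((\<Sum>k\<in>K. w k * x k) - (\<Sum>k\<in>K. w k) * c)" for A B c
      by (simp add: algebra_simps sum.distrib sum_subtractf sum_distrib_left)
    \<comment> \<open>The factor equals 1 + (\<alpha> - 1) (1 - W), so the missing weight works in
      favour of the inequality.\<close>
    have "m powr \<alpha> \<le> m powr \<alpha> * (W + \<alpha> * (1 - W))"
    proof -
      have "(\<alpha> - 1) * (1 - W) \<ge> 0" using assms unfolding W_def by auto
      then have "1 \<le> W + \<alpha> * (1 - W)" by (simp add: algebra_simps)
      then show ?thesis using mp by (metis mult_left_mono mult.right_neutral powr_ge_zero)
    qed
    also have "\<dots> = W * m powr \<alpha> + \<alpha> * m powr (\<alpha> - 1) * (m - W * m)"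
    proof -
      have e: "m powr (\<alpha> - 1) * m = m powr \<alpha>" using mp by (simp add: powr_diff)
      have "\<alpha> * m powr (\<alpha> - 1) * (m - W * m) = \<alpha> * (m powr (\<alpha> - 1) * m) * (1 - W)" by (simp add: algebra_simps)
      then show ?thesis unfolding e by (simp add: algebra_simps)
    qed
    also have "\<dots> = (\<Sum>k\<in>K. w k * (m powr \<alpha> + \<alpha> * m powr (\<alpha> - 1) * (x k - m)))"
      unfolding gen m_def[symmetric] W_def[symmetric] ..
    also have "\<dots> \<le> (\<Sum>k\<in>K. w k * x k powr \<alpha>)"
      using assms mp by (intro sum_mono mult_left_mono powr_tangent) auto
    finally show ?thesis unfolding m_def .
  qed
qed

text \<open>x^\<alpha> y^(1 - \<alpha>) is the perspective y (x/y)^\<alpha>, so this is Jensen with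
  weights \<open>y k / Y\<close>. As 0 powr (1 - \<alpha>) = 0, a term with y k = 0 < x k would be
  lost on the right; \<open>xy\<close> excludes it.\<close>

lemma powr_joint_subadditive: fixes x y :: "'k \<Rightarrow> real" 
  assumes a: "\<alpha> > 1" and fin: "finite K" and x: "\<And>k. k \<in> K \<Longrightarrow> 0 \<le> x k" and y: "\<And>k. k \<in> K \<Longrightarrow> 0 \<le> y k"
    and xy: "\<And>k. k \<in> K \<Longrightarrow> y k = 0 \<Longrightarrow> x k = 0"
  shows "(\<Sum>k\<in>K. x k) powr \<alpha> * (\<Sum>k\<in>K. y k) powr (1 - \<alpha>) \<le> (\<Sum>k\<in>K. x k powr \<alpha> * y k powr (1 - \<alpha>))"
proof -
  define Y where "Y = (\<Sum>k\<in>K. y k)"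
  have Y0: "Y \<ge> 0" unfolding Y_def by (intro sum_nonneg y)
  show ?thesis
  proof (cases "Y = 0")
    case True
    then show ?thesis unfolding Y_def[symmetric] by (auto intro!: sum_nonneg)
  next
    case False
    then have Y: "Y > 0" using Y0 by simp
    have "(\<Sum>k\<in>K. x k) / Y = (\<Sum>k\<in>K. (y k / Y) * (x k / y k))"
      unfolding sum_divide_distrib using xy by (intro sum.cong) auto
    then have "((\<Sum>k\<in>K. x k) / Y) powr \<alpha> = (\<Sum>k\<in>K. (y k / Y) * (x k / y k)) powr \<alpha>" by simp
    also have "\<dots> \<le> (\<Sum>k\<in>K. (y k / Y) * (x k / y k) powr \<alpha>)"
    proof (rule jensen_powr)
      show "(\<Sum>k\<in>K. y k / Y) \<le> 1" using Y by (simp add: sum_divide_distrib[symmetric] Y_def[symmetric])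
    qed (use a x y Y in auto)
    finally have "Y * ((\<Sum>k\<in>K. x k) / Y) powr \<alpha> \<le> Y * (\<Sum>k\<in>K. (y k / Y) * (x k / y k) powr \<alpha>)"
      using Y by (intro mult_left_mono) auto
    also have "\<dots> = (\<Sum>k\<in>K. y k * (x k / y k) powr \<alpha>)" using Y by (simp add: sum_distrib_left)
    also have "\<dots> = (\<Sum>k\<in>K. x k powr \<alpha> * y k powr (1 - \<alpha>))"
    proof (intro sum.cong refl)
      fix k assume k: "k \<in> K"
      show "y k * (x k / y k) powr \<alpha> = x k powr \<alpha> * y k powr (1 - \<alpha>)"
      proof (cases "y k = 0")
        case False
        then have "y k > 0" using y[OF k] by simp
        then show ?thesis using x[OF k] by (simp add: powr_divide powr_diff)
      qed (use xy[OF k] in simp)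
    qed
    also have "Y * ((\<Sum>k\<in>K. x k) / Y) powr \<alpha> = (\<Sum>k\<in>K. x k) powr \<alpha> * Y powr (1 - \<alpha>)"
      using Y sum_nonneg[of K x, OF x] by (simp add: powr_divide powr_diff)
    finally show ?thesis unfolding Y_def .
  qed
qed

section \<open>Positive operators, their kernels and eigenvectors, and pinching\<close>

lemma ip_spc: assumes "onb I U" "finite I" "k \<in> I"
  shows "ip I (U k) (ap I (spc I U h) v) = of_real (h k) * ip I (U k) v"
proof -
  have "ip I (U k) (ap I (spc I U h) v) = ip I (ap I (spc I U h) (U k)) v" by (rule herm_ip[OF herm_spc])
  also have "\<dots> = ip I (\<lambda>i. of_real (h k) * U k i) v" by (rule ip_cong) (auto simp: spc_eigen[OF assms])
  finally show ?thesis by (simp add: ip_scale_left)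
qed

lemma ap_spc_spc: assumes "onb I U" "finite I"
  shows "ap I (spc I U h) (ap I (spc I U h') v) = ap I (spc I U (\<lambda>k. h k * h' k)) v"
  by (rule ext, subst (1 3) ap_spc) (auto simp: ip_spc[OF assms] intro!: sum.cong)

lemma qf_conj: assumes "herm I P" shows "qf I (mm I P (mm I T P)) v = qf I T (ap I P v)"
  unfolding qf_def ap_mm herm_ip[OF assms, of v] ..

lemma herm_conj: assumes "finite I" "herm I P" "herm I T" shows "herm I (mm I P (mm I T P))"
  by (rule herm_iff_ip[OF assms(1)]) (simp add: ap_mm herm_ip[OF assms(2)] herm_ip[OF assms(3)])

lemma pos_conj: assumes "finite I" "herm I P" "pos I T" shows "pos I (mm I P (mm I T P))"
  using assms herm_conj qf_conj unfolding pos_def by metis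

lemma pos_spectral: assumes "finite I" "pos I A"
  obtains U d where "spec I A U d" "\<And>k. k \<in> I \<Longrightarrow> 0 \<le> d k"
  using assms spectral[of I A] spec_nonneg[of I A] unfolding pos_def by metis

text \<open>In an eigenbasis a vanishing form is a vanishing sum of nonnegative terms, so
  \<open>v\<close> is orthogonal to every eigenvector of nonzero eigenvalue. Kernel conditions can
  thus be stated with \<open>qf\<close> alone.\<close>

lemma pos_kernel: assumes "finite I" "pos I A" "qf I A v = 0" "i \<in> I"
  shows "ap I A v i = 0"
proof -
  obtain U d where s: "spec I A U d" and d: "\<And>k. k \<in> I \<Longrightarrow> 0 \<le> d k" using pos_spectral[OF assms(1,2)] by blast
  have "(\<Sum>k\<in>I. d k * (cmod (ip I (U k) v))\<^sup>2) = 0" using assms spec_qf[OF s] by metis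
  then have "\<forall>k\<in>I. d k * (cmod (ip I (U k) v))\<^sup>2 = 0"
    using assms(1) d by (subst (asm) sum_nonneg_eq_0_iff) auto
  then have z: "\<And>k. k \<in> I \<Longrightarrow> of_real (d k) * ip I (U k) v = 0" by auto
  show ?thesis unfolding spec_ap[OF s assms(4)] ap_spc using z by (intro sum.neutral) auto
qed

lemma cmod_sum_sq: fixes z :: "'k \<Rightarrow> complex"
  shows "(cmod (\<Sum>k\<in>K. z k))\<^sup>2 \<le> real (card K) * (\<Sum>k\<in>K. (cmod (z k))\<^sup>2)"
proof -
  have "(cmod (\<Sum>k\<in>K. z k))\<^sup>2 \<le> (\<Sum>k\<in>K. cmod (z k))\<^sup>2" by (intro power_mono norm_sum) auto
  also have "\<dots> \<le> (\<Sum>k\<in>K. (cmod (z k))\<^sup>2) * real (card K)"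
    by (rule sum_squared_le_sum_of_squares)
  finally show ?thesis by (simp add: mult.commute)
qed

text \<open>Cauchy-Schwarz in each eigendirection. The factor \<open>card K\<close> becomes the
  pinching constant when \<open>K\<close> labels eigenspaces.\<close>

lemma pos_qf_sum: assumes "finite I" "pos I A"
  shows "qf I A (\<lambda>i. \<Sum>k\<in>K. v k i) \<le> real (card K) * (\<Sum>k\<in>K. qf I A (v k))"
proof -
  obtain U d where s: "spec I A U d" and d: "\<And>k. k \<in> I \<Longrightarrow> 0 \<le> d k" using pos_spectral[OF assms] by blast
  have "qf I A (\<lambda>i. \<Sum>k\<in>K. v k i) = (\<Sum>j\<in>I. d j * (cmod (\<Sum>k\<in>K. ip I (U j) (v k)))\<^sup>2)"
    unfolding spec_qf[OF s] ip_sum_right ..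
  also have "\<dots> \<le> (\<Sum>j\<in>I. d j * (real (card K) * (\<Sum>k\<in>K. (cmod (ip I (U j) (v k)))\<^sup>2)))"
    using d by (intro sum_mono mult_left_mono cmod_sum_sq) auto
  also have "\<dots> = real (card K) * (\<Sum>j\<in>I. \<Sum>k\<in>K. d j * (cmod (ip I (U j) (v k)))\<^sup>2)"
    by (simp add: sum_distrib_left mult_ac)
  also have "(\<Sum>j\<in>I. \<Sum>k\<in>K. d j * (cmod (ip I (U j) (v k)))\<^sup>2) = (\<Sum>k\<in>K. qf I A (v k))"
    unfolding spec_qf[OF s] by (rule sum.swap)
  finally show ?thesis .
qed

lemma herm_eigen_ip: assumes "herm I S" "\<And>i. i \<in> I \<Longrightarrow> ap I S x i = c * x i"
  shows "ip I x (ap I S v) = cnj c * ip I x v"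
proof -
  have "ip I x (ap I S v) = ip I (ap I S x) v" by (rule herm_ip[OF assms(1)])
  also have "\<dots> = ip I (\<lambda>i. c * x i) v" by (rule ip_cong) (auto simp: assms(2))
  finally show ?thesis by (simp add: ip_scale_left)
qed

lemma spec_eigen_orth: assumes "spec I S U d" "finite I" "k \<in> I"
    "\<And>i. i \<in> I \<Longrightarrow> ap I S x i = of_real c * x i" "d k \<noteq> c"
  shows "ip I (U k) x = 0"
proof -
  have "of_real (d k) * ip I (U k) x = ip I (U k) (ap I S x)"
    using herm_eigen_ip[OF spec_herm[OF assms(1)], of "U k" "of_real (d k)" x] spec_eigen[OF assms(1-3)] by simp
  also have "\<dots> = ip I (U k) (\<lambda>i. of_real c * x i)" by (rule ip_cong) (auto simp: assms)
  finally have "of_real (d k) * ip I (U k) x = of_real c * ip I (U k) x" by (simp add: ip_scale_right)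
  then show ?thesis using assms by simp
qed

text \<open>Components of x along eigenvalues other than c vanish. Hence f(S) acts on eigenvectors
  of \<open>S\<close> independently of the eigenbasis by which it was formed, even for degenerate
  eigenvalues.\<close>

lemma spc_on_eigen: assumes "spec I S U d" "finite I" "i \<in> I"
    "\<And>i. i \<in> I \<Longrightarrow> ap I S x i = of_real c * x i"
  shows "ap I (spc I U (\<lambda>k. f (d k))) x i = of_real (f c) * x i"
proof -
  have "ap I (spc I U (\<lambda>k. f (d k))) x i = (\<Sum>k\<in>I. of_real (f c) * (ip I (U k) x * U k i))"
    unfolding ap_spc
  proof (intro sum.cong refl)
    fix k assume "k \<in> I"
    then show "of_real (f (d k)) * ip I (U k) x * U k i = of_real (f c) * (ip I (U k) x * U k i)"
      using spec_eigen_orth[OF assms(1,2) _ assms(4), of k] by (cases "d k = c") auto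
  qed
  also have "\<dots> = of_real (f c) * x i"
    using onb_expand[OF spec_onb[OF assms(1)] assms(3,2), of x] by (simp add: sum_distrib_left)
  finally show ?thesis .
qed

text \<open>Choosing $c$ so that $c(a-b) \neq t_k - t_l$ makes every eigenvector of $T' + cS$, for commuting
  $T'$ and $S$ with eigenvalues $t_k$ and $a, b$, a common eigenvector.\<close>

lemma ex_separating: fixes t :: "'k \<Rightarrow> real" assumes "finite K" "finite D"
  shows "\<exists>c. \<forall>k\<in>K. \<forall>l\<in>K. \<forall>a\<in>D. \<forall>b\<in>D. a \<noteq> b \<longrightarrow> c * (a - b) \<noteq> t k - t l"
proof -
  define B where "B = (\<lambda>(k,l,a,b). (t k - t l) / (a - b)) ` (K \<times> K \<times> D \<times> D)"
  have "finite B" unfolding B_def using assms by auto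
  then obtain c where c: "c \<notin> B" using ex_new_if_finite[OF infinite_UNIV_char_0] by blast
  have "c * (a - b) \<noteq> t k - t l" if "k \<in> K" "l \<in> K" "a \<in> D" "b \<in> D" "a \<noteq> b" for k l a b
  proof
    assume "c * (a - b) = t k - t l"
    then have "c = (t k - t l) / (a - b)" using that by (simp add: field_simps)
    then show False using c that unfolding B_def by (auto simp: image_iff)
  qed
  then show ?thesis by blast
qed

text \<open>Splitting a vector along the eigenspaces of \<open>S\<close> bounds T by the number of
  eigenvalues times the pinched T'. As T' commutes with \<open>S\<close>, the two have a joint
  eigenbasis; each of its vectors lies in one eigenspace of \<open>S\<close>, where T and T' have
  the same form, so the diagonal of T itself appears.\<close>

lemma pinching:
  assumes fin: "finite I" and T: "pos I T" and S: "spec I S U d"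
  shows "\<exists>e s. onb I e \<and> (\<forall>k\<in>I. s k \<in> d ` I \<and> (\<forall>i\<in>I. ap I S (e k) i = of_real (s k) * e k i)) \<and>
     (\<forall>v. qf I T v \<le> real (card (d ` I)) * (\<Sum>k\<in>I. qf I T (e k) * (cmod (ip I (e k) v))\<^sup>2))"
proof -
  let ?D = "d ` I"
  have finD: "finite ?D" using fin by simp
  note onb = spec_onb[OF S]
  have hT: "herm I T" using T by (simp add: pos_def)
  define P where "P \<delta> = spc I U (\<lambda>k. if d k = \<delta> then 1 else 0)" for \<delta>
  have hP: "herm I (P \<delta>)" for \<delta> unfolding P_def by (rule herm_spc)
  have PP: "ap I (P \<delta>) (ap I (P \<delta>') v) = (if \<delta> = \<delta>' then ap I (P \<delta>) v else (\<lambda>_. 0))" for \<delta> \<delta>' v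
    unfolding P_def ap_spc_spc[OF onb fin] by (auto simp: ap_spc intro!: ext sum.neutral sum.cong)
  have Psum: "(\<Sum>\<delta>\<in>?D. ap I (P \<delta>) v i) = v i" if "i \<in> I" for v i
  proof -
    have "(\<Sum>\<delta>\<in>?D. ap I (P \<delta>) v i) = (\<Sum>k\<in>I. \<Sum>\<delta>\<in>?D. (if d k = \<delta> then ip I (U k) v * U k i else 0))"
      unfolding P_def ap_spc by (subst sum.swap) (intro sum.cong refl, simp)
    also have "\<dots> = (\<Sum>k\<in>I. ip I (U k) v * U k i)"
      using finD by (intro sum.cong refl) simp
    finally show ?thesis using onb_expand[OF onb that fin] by metis
  qed
  have PS: "ap I (P \<delta>) (ap I S v) i = of_real \<delta> * ap I (P \<delta>) v i" for \<delta> v i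
  proof -
    have "ap I (P \<delta>) (ap I S v) i = ap I (P \<delta>) (ap I (spc I U d) v) i"
      by (rule ap_cong) (auto simp: spec_ap[OF S])
    also have "\<dots> = of_real \<delta> * ap I (P \<delta>) v i"
      unfolding P_def ap_spc_spc[OF onb fin] unfolding ap_spc sum_distrib_left by (intro sum.cong) auto
    finally show ?thesis .
  qed
  define T' where "T' i j = (\<Sum>\<delta>\<in>?D. mm I (P \<delta>) (mm I T (P \<delta>)) i j)" for i j
  have apT': "ap I T' v i = (\<Sum>\<delta>\<in>?D. ap I (P \<delta>) (ap I T (ap I (P \<delta>) v)) i)" for v i
    unfolding ap_mm[symmetric] unfolding ap_def[of _ "T'"] T'_def ap_def[of _ "mm _ _ _"] sum_distrib_right
    by (rule sum.swap)
  have hT': "herm I T'"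
    unfolding herm_def T'_def cnj_sum
  proof (intro ballI sum.cong refl)
    fix i j \<delta> assume "i \<in> I" "j \<in> I"
    then show "mm I (P \<delta>) (mm I T (P \<delta>)) j i = cnj (mm I (P \<delta>) (mm I T (P \<delta>)) i j)"
      using herm_conj[OF fin hP hT, of \<delta>] unfolding herm_def by blast
  qed
  have qfT': "qf I T' v = (\<Sum>\<delta>\<in>?D. qf I T (ap I (P \<delta>) v))" for v
  proof -
    have "ip I v (ap I T' v) = (\<Sum>\<delta>\<in>?D. ip I v (ap I (mm I (P \<delta>) (mm I T (P \<delta>))) v))"
      unfolding ip_sum_right[symmetric] by (rule ip_cong) (auto simp: apT' ap_mm)
    then show ?thesis unfolding qf_conj[OF hP, symmetric] by (simp add: qf_def)
  qed
  obtain W t where W: "spec I T' W t" using spectral[OF fin hT'] by blast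
  obtain c where c: "\<And>k l a b. k \<in> I \<Longrightarrow> l \<in> I \<Longrightarrow> a \<in> ?D \<Longrightarrow> b \<in> ?D \<Longrightarrow> a \<noteq> b \<Longrightarrow> c * (a - b) \<noteq> t k - t l"
    using ex_separating[OF fin finD, of t] by metis
  define G where "G i j = T' i j + of_real c * S i j" for i j
  have apG: "ap I G v i = ap I T' v i + of_real c * ap I S v i" for v i
    unfolding ap_def G_def by (simp add: algebra_simps sum.distrib sum_distrib_left)
  have hG: "herm I G" unfolding herm_def
  proof (intro ballI)
    fix i j assume "i \<in> I" "j \<in> I"
    then have "T' j i = cnj (T' i j)" "S j i = cnj (S i j)"
      using hT' spec_herm[OF S] unfolding herm_def by blast+
    then show "G j i = cnj (G i j)" unfolding G_def by simp
  qed
  obtain e g where e: "spec I G e g" using spectral[OF fin hG] by blast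
  note onbe = spec_onb[OF e]
  have PT': "ap I (P \<delta>) (ap I T' v) i = ap I T' (ap I (P \<delta>) v) i" if "\<delta> \<in> ?D" for \<delta> v i
  proof -
    have "ap I T' (ap I (P \<delta>) v) i = (\<Sum>\<delta>'\<in>?D. if \<delta>' = \<delta> then ap I (P \<delta>) (ap I T (ap I (P \<delta>) v)) i else 0)"
      unfolding apT' PP by (intro sum.cong refl) (auto simp: ap_def)
    moreover have "ap I (P \<delta>) (ap I T' v) i = (\<Sum>\<delta>'\<in>?D. if \<delta>' = \<delta> then ap I (P \<delta>) (ap I T (ap I (P \<delta>) v)) i else 0)"
    proof -
      have "ap I (P \<delta>) (ap I T' v) i = ap I (P \<delta>) (\<lambda>i. \<Sum>\<delta>'\<in>?D. ap I (P \<delta>') (ap I T (ap I (P \<delta>') v)) i) i"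
        by (rule ap_cong) (auto simp: apT')
      also have "\<dots> = (\<Sum>\<delta>'\<in>?D. ap I (P \<delta>) (ap I (P \<delta>') (ap I T (ap I (P \<delta>') v))) i)"
        unfolding ap_sum ..
      also have "\<dots> = (\<Sum>\<delta>'\<in>?D. if \<delta>' = \<delta> then ap I (P \<delta>) (ap I T (ap I (P \<delta>) v)) i else 0)"
        unfolding PP by (intro sum.cong refl) auto
      finally show ?thesis .
    qed
    ultimately show ?thesis by simp
  qed
  \<comment> \<open>Each P \<delta> commutes with T', so a nonzero component P \<delta> (e k) is an
    eigenvector of T' with eigenvalue g k - c \<delta>. Two nonzero components would express c
    (\<delta> - \<delta>') as a difference of eigenvalues of T', which the choice of
    \<open>c\<close> forbids.\<close>
  have key: "\<exists>\<delta>\<in>?D. \<forall>i\<in>I. ap I (P \<delta>) (e k) i = e k i" if k: "k \<in> I" for k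
  proof -
    have Tx: "ap I T' (ap I (P \<delta>) (e k)) i = of_real (g k - c * \<delta>) * ap I (P \<delta>) (e k) i" if d: "\<delta> \<in> ?D" for \<delta> i
    proof -
      have "ap I (P \<delta>) (ap I G (e k)) i = ap I (P \<delta>) (\<lambda>i. of_real (g k) * e k i) i"
        by (rule ap_cong) (auto simp: spec_eigen[OF e fin k])
      moreover have "ap I (P \<delta>) (ap I G (e k)) i = ap I (P \<delta>) (ap I T' (e k)) i + of_real c * ap I (P \<delta>) (ap I S (e k)) i"
        unfolding apG[abs_def] unfolding ap_def[of _ "P \<delta>"] by (simp add: algebra_simps sum.distrib sum_distrib_left)
      ultimately show ?thesis unfolding PT'[OF d] PS ap_scale by (simp add: algebra_simps)
    qed
    have ex_t: "\<exists>l\<in>I. t l = g k - c * \<delta>" if d: "\<delta> \<in> ?D" and nz: "\<exists>i\<in>I. ap I (P \<delta>) (e k) i \<noteq> 0" for \<delta>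
    proof (rule ccontr)
      assume "\<not> ?thesis"
      then have "ip I (W l) (ap I (P \<delta>) (e k)) = 0" if "l \<in> I" for l
        using spec_eigen_orth[OF W fin that Tx[OF d]] that by auto
      then have "ap I (P \<delta>) (e k) i = 0" if "i \<in> I" for i
        by (subst onb_expand[OF spec_onb[OF W] that fin]) simp
      then show False using nz by blast
    qed
    have "\<exists>\<delta>\<in>?D. \<exists>i\<in>I. ap I (P \<delta>) (e k) i \<noteq> 0"
    proof (rule ccontr)
      assume n: "\<not> ?thesis"
      have "e k i = 0" if i: "i \<in> I" for i
      proof -
        have "(\<Sum>\<delta>\<in>?D. ap I (P \<delta>) (e k) i) = 0" using n i by (intro sum.neutral) blast
        then show ?thesis using Psum[OF i, of "e k"] by simp
      qed
      then have "nrm2 I (e k) = 0" by (simp add: nrm2_def)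
      then show False using onb_nrm2[OF onbe k] by simp
    qed
    then obtain \<delta> where d: "\<delta> \<in> ?D" "\<exists>i\<in>I. ap I (P \<delta>) (e k) i \<noteq> 0" by blast
    have z: "ap I (P \<delta>') (e k) i = 0" if z1: "\<delta>' \<in> ?D" and z2: "\<delta>' \<noteq> \<delta>" and z3: "i \<in> I" for \<delta>' i
    proof (rule ccontr)
      assume "ap I (P \<delta>') (e k) i \<noteq> 0"
      then have "\<exists>i\<in>I. ap I (P \<delta>') (e k) i \<noteq> 0" using z3 by blast
      then obtain l where l: "l \<in> I" "t l = g k - c * \<delta>'" using ex_t[OF z1] by blast
      obtain m where m: "m \<in> I" "t m = g k - c * \<delta>" using ex_t[of \<delta>] d by blast
      show False using c[OF m(1) l(1) z1 d(1) z2] l m by (simp add: algebra_simps)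
    qed
    have "ap I (P \<delta>) (e k) i = e k i" if i: "i \<in> I" for i
    proof -
      have "e k i = (\<Sum>\<delta>'\<in>?D. if \<delta>' = \<delta> then ap I (P \<delta>) (e k) i else 0)"
        unfolding Psum[OF i, of "e k", symmetric] using z i by (intro sum.cong) auto
      then show ?thesis using d finD by simp
    qed
    then show ?thesis using d by blast
  qed
  then obtain s where s: "\<And>k. k \<in> I \<Longrightarrow> s k \<in> ?D" "\<And>k i. k \<in> I \<Longrightarrow> i \<in> I \<Longrightarrow> ap I (P (s k)) (e k) i = e k i"
    by metis
  have Se: "ap I S (e k) i = of_real (s k) * e k i" if "k \<in> I" "i \<in> I" for k i
  proof -
    have "ap I S (e k) i = ap I (spc I U d) (ap I (P (s k)) (e k)) i"
      unfolding spec_ap[OF S that(2)] by (rule ap_cong) (auto simp: s(2) that)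
    also have "\<dots> = of_real (s k) * ap I (P (s k)) (e k) i"
      unfolding P_def ap_spc_spc[OF onb fin] unfolding ap_spc sum_distrib_left by (intro sum.cong) auto
    finally show ?thesis using s(2) that by simp
  qed
  have Te: "ap I T' (e k) i = of_real (g k - c * s k) * e k i" if "k \<in> I" "i \<in> I" for k i
    using spec_eigen[OF e fin that] Se[OF that] unfolding apG by (simp add: algebra_simps)
  have spT': "spec I T' e (\<lambda>k. g k - c * s k)" by (rule eigenbasis_spec[OF onbe fin Te])
  have qe: "g k - c * s k = qf I T (e k)" if k: "k \<in> I" for k
  proof -
    have "g k - c * s k = qf I T' (e k)" using spec_qf_basis[OF spT' fin k] by simp
    also have "\<dots> = (\<Sum>\<delta>\<in>?D. if \<delta> = s k then qf I T (e k) else 0)"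
      unfolding qfT'
    proof (intro sum.cong refl)
      fix \<delta> assume "\<delta> \<in> ?D"
      have "ap I (P \<delta>) (e k) i = (if \<delta> = s k then e k i else 0)" if "i \<in> I" for i
      proof -
        have "ap I (P \<delta>) (e k) i = ap I (P \<delta>) (ap I (P (s k)) (e k)) i"
          by (rule ap_cong) (auto simp: s(2) k)
        then show ?thesis unfolding PP using s(2)[OF k that] by auto
      qed
      then have "qf I T (ap I (P \<delta>) (e k)) = qf I T (\<lambda>i. if \<delta> = s k then e k i else 0)" by (intro qf_cong) auto
      then show "qf I T (ap I (P \<delta>) (e k)) = (if \<delta> = s k then qf I T (e k) else 0)"
        by (auto simp: qf_def ip_def)
    qed
    also have "\<dots> = qf I T (e k)" using finD s(1)[OF k] by simp
    finally show ?thesis .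
  qed
  have "qf I T v \<le> real (card ?D) * (\<Sum>k\<in>I. qf I T (e k) * (cmod (ip I (e k) v))\<^sup>2)" for v
  proof -
    have "qf I T v = qf I T (\<lambda>i. \<Sum>\<delta>\<in>?D. ap I (P \<delta>) v i)" by (rule qf_cong) (auto simp: Psum)
    also have "\<dots> \<le> real (card ?D) * qf I T' v" unfolding qfT' by (rule pos_qf_sum[OF fin T])
    also have "qf I T' v = (\<Sum>k\<in>I. qf I T (e k) * (cmod (ip I (e k) v))\<^sup>2)"
      unfolding spec_qf[OF spT'] using qe by (intro sum.cong) auto
    finally show ?thesis .
  qed
  then show ?thesis using onbe s(1) Se by blast
qed

section \<open>The sandwiched quantity\<close>

text \<open>\<open>q\<close> is the trace of the $\alpha$-th power of $\sigma^s \rho\, \sigma^s$ and \<open>D\<close> contains the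
  eigenvalues of $\sigma$; since \<open>0 powr s = 0\<close>, the powers are those on the support. Being a relation, it
  needs no independence of the chosen spectral decompositions, which only follows in \<open>sandQ_unique\<close>.\<close>

definition sandQ :: "real \<Rightarrow> 'a set \<Rightarrow> 'a op \<Rightarrow> 'a op \<Rightarrow> real \<Rightarrow> real set \<Rightarrow> bool" where
  "sandQ \<alpha> I \<rho> \<sigma> q D \<longleftrightarrow> finite I \<and> finite D \<and> pos I \<rho> \<and>
     (\<exists>U d W z. spec I \<sigma> U d \<and> (\<forall>k\<in>I. 0 \<le> d k \<and> d k \<in> D \<and> (d k = 0 \<longrightarrow> qf I \<rho> (U k) = 0)) \<and>
        spec I (mm I (spc I U (\<lambda>k. d k powr ((1 - \<alpha>) / (2 * \<alpha>)))) (mm I \<rho> (spc I U (\<lambda>k. d k powr ((1 - \<alpha>) / (2 * \<alpha>)))))) W z \<and>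
        q = (\<Sum>k\<in>I. z k powr \<alpha>))"

lemma sandQ_finite: "sandQ \<alpha> I \<rho> \<sigma> q D \<Longrightarrow> finite I" "sandQ \<alpha> I \<rho> \<sigma> q D \<Longrightarrow> finite D"
  by (simp_all add: sandQ_def)

lemma sandQ_pos: assumes "sandQ \<alpha> I \<rho> \<sigma> q D" shows "pos I \<rho>" "pos I \<sigma>"
  using assms spec_pos unfolding sandQ_def by metis+

lemma sandQ_nonneg: "sandQ \<alpha> I \<rho> \<sigma> q D \<Longrightarrow> 0 \<le> q"
  unfolding sandQ_def by (auto intro!: sum_nonneg)

lemma sandQ_exists:
  assumes fin: "finite I" and r: "pos I \<rho>" and s: "pos I \<sigma>" and ker: "\<And>v. qf I \<sigma> v = 0 \<Longrightarrow> qf I \<rho> v = 0"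
  shows "\<exists>q D. sandQ \<alpha> I \<rho> \<sigma> q D"
proof -
  obtain U d where U: "spec I \<sigma> U d" "\<And>k. k \<in> I \<Longrightarrow> 0 \<le> d k" using pos_spectral[OF fin s] by blast
  let ?H = "spc I U (\<lambda>k. d k powr ((1 - \<alpha>) / (2 * \<alpha>)))"
  obtain W z where "spec I (mm I ?H (mm I \<rho> ?H)) W z"
    using pos_spectral[OF fin pos_conj[OF fin herm_spc r]] by blast
  moreover have "qf I \<rho> (U k) = 0" if "k \<in> I" "d k = 0" for k
    using ker[of "U k"] spec_qf_basis[OF U(1) fin that(1)] that by simp
  ultimately have "sandQ \<alpha> I \<rho> \<sigma> (\<Sum>k\<in>I. z k powr \<alpha>) (d ` I)"
    unfolding sandQ_def using fin r U by blast
  then show ?thesis by blast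
qed

lemma qf_zero: "(\<And>i. i \<in> I \<Longrightarrow> ap I A v i = 0) \<Longrightarrow> qf I A v = 0"
  unfolding qf_def ip_def by simp

text \<open>Extends the vanishing of \<rho> from the null vectors of the chosen eigenbasis to the
  whole kernel of \<sigma>: \<open>v\<close> is a combination of them, and \<open>pos_kernel\<close>
  turns zero forms into zero vectors.\<close>

lemma sandQ_kernel: assumes "sandQ \<alpha> I \<rho> \<sigma> q D" "qf I \<sigma> v = 0" shows "qf I \<rho> v = 0"
proof (rule qf_zero)
  fix i assume i: "i \<in> I"
  obtain U d where U: "spec I \<sigma> U d" and d: "\<And>k. k \<in> I \<Longrightarrow> 0 \<le> d k" "\<And>k. k \<in> I \<Longrightarrow> d k = 0 \<Longrightarrow> qf I \<rho> (U k) = 0"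
    and fin: "finite I" and r: "pos I \<rho>" using assms unfolding sandQ_def by blast
  have "\<forall>k\<in>I. d k * (cmod (ip I (U k) v))\<^sup>2 = 0"
    using assms(2) d fin unfolding spec_qf[OF U] by (subst (asm) sum_nonneg_eq_0_iff) auto
  then have z: "ip I (U k) v = 0 \<or> d k = 0" if "k \<in> I" for k using that by force
  have "ap I \<rho> v i = ap I \<rho> (\<lambda>i. \<Sum>k\<in>I. ip I (U k) v * U k i) i"
    by (rule ap_cong) (auto intro: onb_expand[OF spec_onb[OF U] _ fin])
  also have "\<dots> = (\<Sum>k\<in>I. ip I (U k) v * ap I \<rho> (U k) i)" unfolding ap_sum ap_scale ..
  also have "\<dots> = 0"
  proof (intro sum.neutral ballI)
    fix k assume k: "k \<in> I"
    show "ip I (U k) v * ap I \<rho> (U k) i = 0"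
      using z[OF k] d(2)[OF k] pos_kernel[OF fin r _ i, of "U k"] by auto
  qed
  finally show "ap I \<rho> v i = 0" .
qed

text \<open>The inner sums are the diagonal, in the basis \<open>U\<close>, of the operator with
  eigenvectors \<open>V\<close> and eigenvalues \<open>z\<close>. The squared overlaps are doubly
  stochastic: Jensen uses the sum over \<open>m\<close>, the final summation that over
  \<open>k\<close>.\<close>

lemma weighted_powr_sum_le:
  assumes a: "\<alpha> > 1" and fin: "finite I" and U: "onb I U" and V: "onb I V" and z: "\<And>k. k \<in> I \<Longrightarrow> 0 \<le> z k"
  shows "(\<Sum>k\<in>I. (\<Sum>m\<in>I. z m * (cmod (ip I (V m) (U k)))\<^sup>2) powr \<alpha>) \<le> (\<Sum>m\<in>I. z m powr \<alpha>)"
proof -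
  have "(\<Sum>k\<in>I. (\<Sum>m\<in>I. z m * (cmod (ip I (V m) (U k)))\<^sup>2) powr \<alpha>)
      \<le> (\<Sum>k\<in>I. \<Sum>m\<in>I. (cmod (ip I (V m) (U k)))\<^sup>2 * z m powr \<alpha>)"
  proof (rule sum_mono)
    fix k assume k: "k \<in> I"
    have "(\<Sum>m\<in>I. (cmod (ip I (V m) (U k)))\<^sup>2 * z m) powr \<alpha> \<le> (\<Sum>m\<in>I. (cmod (ip I (V m) (U k)))\<^sup>2 * z m powr \<alpha>)"
      using a z parseval[OF V fin, of "U k"] onb_nrm2[OF U k] by (intro jensen_powr) auto
    then show "(\<Sum>m\<in>I. z m * (cmod (ip I (V m) (U k)))\<^sup>2) powr \<alpha> \<le> (\<Sum>m\<in>I. (cmod (ip I (V m) (U k)))\<^sup>2 * z m powr \<alpha>)"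
      by (simp add: mult.commute)
  qed
  also have "\<dots> = (\<Sum>m\<in>I. \<Sum>k\<in>I. (cmod (ip I (V m) (U k)))\<^sup>2 * z m powr \<alpha>)" by (rule sum.swap)
  also have "\<dots> = (\<Sum>m\<in>I. (\<Sum>k\<in>I. (cmod (ip I (U k) (V m)))\<^sup>2) * z m powr \<alpha>)"
    unfolding sum_distrib_right by (subst cmod_ip_swap) (rule refl)
  also have "\<dots> = (\<Sum>m\<in>I. z m powr \<alpha>)"
    using parseval[OF U fin] onb_nrm2[OF V] by (intro sum.cong) auto
  finally show ?thesis .
qed

text \<open>The exponent (1 - \<alpha>)/(2 \<alpha>) occurs twice and is then multiplied by
  \<alpha>, which leaves 1 - \<alpha>: in a common eigenbasis the sandwiched quantity is the
  classical one. Both sides are 0 at s = 0.\<close>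

lemma sandwich_powr: fixes t s \<alpha> :: real
  assumes "\<alpha> > 1" "0 \<le> t" "0 \<le> s"
  shows "(t * (s powr ((1 - \<alpha>) / (2 * \<alpha>)))\<^sup>2) powr \<alpha> = t powr \<alpha> * s powr (1 - \<alpha>)"
proof -
  have "(s powr ((1 - \<alpha>) / (2 * \<alpha>)))\<^sup>2 = s powr ((1 - \<alpha>) / \<alpha>)"
    unfolding power2_eq_square powr_add[symmetric] by (simp add: field_simps)
  then show ?thesis using assms by (simp add: powr_mult powr_powr)
qed

text \<open>In an eigenbasis of \<sigma> the diagonal of the sandwiched operator is that of \<rho>
  times s^((1 - \<alpha>)/\<alpha>), and passing to a diagonal lowers the sum of \<alpha>-th powers.
  Degenerate eigenvalues leave room for a basis \<open>e\<close> other than the one inside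
  \<open>sandQ\<close>.\<close>

lemma sandQ_lower_eigenbasis:
  assumes a: "\<alpha> > 1" and Q: "sandQ \<alpha> I \<rho> \<sigma> q D" and e: "onb I e"
    and ev: "\<And>k i. k \<in> I \<Longrightarrow> i \<in> I \<Longrightarrow> ap I \<sigma> (e k) i = of_real (s k) * e k i"
  shows "(\<Sum>k\<in>I. qf I \<rho> (e k) powr \<alpha> * s k powr (1 - \<alpha>)) \<le> q"
proof -
  define h where "h x = x powr ((1 - \<alpha>) / (2 * \<alpha>))" for x
  obtain U d W z where fin: "finite I" and r: "pos I \<rho>" and U: "spec I \<sigma> U d"
    and W: "spec I (mm I (spc I U (\<lambda>k. h (d k))) (mm I \<rho> (spc I U (\<lambda>k. h (d k))))) W z"
    and q: "q = (\<Sum>k\<in>I. z k powr \<alpha>)" using Q unfolding sandQ_def h_def by blast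
  have z: "0 \<le> z k" if "k \<in> I" for k
    using spec_nonneg[OF W fin pos_conj[OF fin herm_spc r] that] .
  have s0: "0 \<le> s k" if "k \<in> I" for k
    using spec_nonneg[OF eigenbasis_spec[OF e fin ev] fin sandQ_pos(2)[OF Q] that] .
  have "(\<Sum>k\<in>I. qf I \<rho> (e k) powr \<alpha> * s k powr (1 - \<alpha>)) 
      = (\<Sum>k\<in>I. (\<Sum>m\<in>I. z m * (cmod (ip I (W m) (e k)))\<^sup>2) powr \<alpha>)"
  proof (intro sum.cong refl)
    fix k assume k: "k \<in> I"
    have "(\<Sum>m\<in>I. z m * (cmod (ip I (W m) (e k)))\<^sup>2) = qf I \<rho> (ap I (spc I U (\<lambda>k. h (d k))) (e k))"
      using spec_qf[OF W, of "e k"] qf_conj[OF herm_spc, of I U "\<lambda>k. h (d k)" \<rho> "e k"] by simp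
    also have "\<dots> = qf I \<rho> (\<lambda>i. of_real (h (s k)) * e k i)"
      by (rule qf_cong) (auto simp: spc_on_eigen[OF U fin _ ev[OF k]])
    also have "\<dots> = qf I \<rho> (e k) * (h (s k))\<^sup>2"
      unfolding qf_def ap_scale ip_scale_left ip_scale_right by (simp add: power2_eq_square)
    finally have "(\<Sum>m\<in>I. z m * (cmod (ip I (W m) (e k)))\<^sup>2) powr \<alpha> = (qf I \<rho> (e k) * (h (s k))\<^sup>2) powr \<alpha>" by simp
    then show "qf I \<rho> (e k) powr \<alpha> * s k powr (1 - \<alpha>) = (\<Sum>m\<in>I. z m * (cmod (ip I (W m) (e k)))\<^sup>2) powr \<alpha>"
      unfolding h_def using sandwich_powr[OF a _ s0[OF k], of "qf I \<rho> (e k)"] r unfolding pos_def by metis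
  qed
  also have "\<dots> \<le> q" unfolding q by (rule weighted_powr_sum_le[OF a fin e spec_onb[OF W] z])
  finally show ?thesis .
qed

text \<open>Converse estimate in the eigenbasis supplied by pinching: an eigenvalue
  \<open>z m\<close> is the form of \<rho> at \<sigma>^s W m, which pinching bounds through the
  diagonal of \<rho>; raising to the power \<alpha> also raises the factor
  \<open>card D\<close>.\<close>

lemma sandQ_pinch:
  assumes a: "\<alpha> > 1" and Q: "sandQ \<alpha> I \<rho> \<sigma> q D"
  obtains e s where "onb I e" "spec I \<sigma> e s" 
    "\<And>k i. k \<in> I \<Longrightarrow> i \<in> I \<Longrightarrow> ap I \<sigma> (e k) i = of_real (s k) * e k i"
    "\<And>k. k \<in> I \<Longrightarrow> 0 \<le> s k" 
    "\<And>v. qf I \<rho> v \<le> real (card D) * (\<Sum>k\<in>I. qf I \<rho> (e k) * (cmod (ip I (e k) v))\<^sup>2)"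
    "q \<le> real (card D) powr \<alpha> * (\<Sum>k\<in>I. qf I \<rho> (e k) powr \<alpha> * s k powr (1 - \<alpha>))"
proof -
  define h where "h x = x powr ((1 - \<alpha>) / (2 * \<alpha>))" for x
  obtain U d W z where fin: "finite I" and r: "pos I \<rho>" and U: "spec I \<sigma> U d"
    and d: "\<And>k. k \<in> I \<Longrightarrow> 0 \<le> d k \<and> d k \<in> D" and finD: "finite D"
    and W: "spec I (mm I (spc I U (\<lambda>k. h (d k))) (mm I \<rho> (spc I U (\<lambda>k. h (d k))))) W z"
    and q: "q = (\<Sum>k\<in>I. z k powr \<alpha>)" using Q unfolding sandQ_def h_def by blast
  obtain e s where e: "onb I e" and s: "\<And>k. k \<in> I \<Longrightarrow> s k \<in> d ` I"
    and ev: "\<And>k i. k \<in> I \<Longrightarrow> i \<in> I \<Longrightarrow> ap I \<sigma> (e k) i = of_real (s k) * e k i"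
    and le: "\<And>v. qf I \<rho> v \<le> real (card (d ` I)) * (\<Sum>k\<in>I. qf I \<rho> (e k) * (cmod (ip I (e k) v))\<^sup>2)"
    using pinching[OF fin r U] by blast
  have s0: "0 \<le> s k" if "k \<in> I" for k using s[OF that] d by auto
  have t0: "0 \<le> qf I \<rho> v" for v using r unfolding pos_def by blast
  define N where "N = real (card D)"
  have N0: "N \<ge> 0" unfolding N_def by simp
  \<comment> \<open>Passes from the number of eigenvalues to the possibly larger
    \<open>card D\<close>, which is the quantity counted for tensor powers.\<close>
  have leN: "qf I \<rho> v \<le> N * (\<Sum>k\<in>I. qf I \<rho> (e k) * (cmod (ip I (e k) v))\<^sup>2)" for v
  proof -
    have "card (d ` I) \<le> card D" using d by (intro card_mono finD) auto
    then have "real (card (d ` I)) * (\<Sum>k\<in>I. qf I \<rho> (e k) * (cmod (ip I (e k) v))\<^sup>2) \<le> 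
      N * (\<Sum>k\<in>I. qf I \<rho> (e k) * (cmod (ip I (e k) v))\<^sup>2)"
      unfolding N_def using t0 by (intro mult_right_mono sum_nonneg) auto
    then show ?thesis using le[of v] by simp
  qed
  have zW: "z m \<le> N * (\<Sum>k\<in>I. qf I \<rho> (e k) * (h (s k))\<^sup>2 * (cmod (ip I (e k) (W m)))\<^sup>2)" if m: "m \<in> I" for m
  proof -
    have "z m = qf I \<rho> (ap I (spc I U (\<lambda>k. h (d k))) (W m))"
      using spec_qf_basis[OF W fin m] unfolding qf_conj[OF herm_spc] by simp
    also have "\<dots> \<le> N * (\<Sum>k\<in>I. qf I \<rho> (e k) * (cmod (ip I (e k) (ap I (spc I U (\<lambda>k. h (d k))) (W m))))\<^sup>2)"
      by (rule leN)
    also have "(\<Sum>k\<in>I. qf I \<rho> (e k) * (cmod (ip I (e k) (ap I (spc I U (\<lambda>k. h (d k))) (W m))))\<^sup>2)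
       = (\<Sum>k\<in>I. qf I \<rho> (e k) * (h (s k))\<^sup>2 * (cmod (ip I (e k) (W m)))\<^sup>2)"
    proof (intro sum.cong refl)
      fix k assume k: "k \<in> I"
      have "ip I (e k) (ap I (spc I U (\<lambda>k. h (d k))) (W m)) = of_real (h (s k)) * ip I (e k) (W m)"
        by (subst herm_eigen_ip[OF herm_spc spc_on_eigen[OF U fin _ ev[OF k]]]) auto
      then show "qf I \<rho> (e k) * (cmod (ip I (e k) (ap I (spc I U (\<lambda>k. h (d k))) (W m))))\<^sup>2
        = qf I \<rho> (e k) * (h (s k))\<^sup>2 * (cmod (ip I (e k) (W m)))\<^sup>2"
        by (simp add: norm_mult power_mult_distrib)
    qed
    finally show ?thesis .
  qed
  have z0: "0 \<le> z k" if "k \<in> I" for k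
    using spec_nonneg[OF W fin pos_conj[OF fin herm_spc r] that] .
  have "q \<le> (\<Sum>m\<in>I. N powr \<alpha> * (\<Sum>k\<in>I. qf I \<rho> (e k) * (h (s k))\<^sup>2 * (cmod (ip I (e k) (W m)))\<^sup>2) powr \<alpha>)"
    unfolding q
  proof (rule sum_mono)
    fix m assume m: "m \<in> I"
    have "z m powr \<alpha> \<le> (N * (\<Sum>k\<in>I. qf I \<rho> (e k) * (h (s k))\<^sup>2 * (cmod (ip I (e k) (W m)))\<^sup>2)) powr \<alpha>"
      using a zW[OF m] z0[OF m] by (intro powr_mono2) auto
    also have "\<dots> = N powr \<alpha> * (\<Sum>k\<in>I. qf I \<rho> (e k) * (h (s k))\<^sup>2 * (cmod (ip I (e k) (W m)))\<^sup>2) powr \<alpha>"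
      using N0 t0 by (intro powr_mult)
    finally show "z m powr \<alpha> \<le> N powr \<alpha> * (\<Sum>k\<in>I. qf I \<rho> (e k) * (h (s k))\<^sup>2 * (cmod (ip I (e k) (W m)))\<^sup>2) powr \<alpha>" .
  qed
  also have "\<dots> \<le> N powr \<alpha> * (\<Sum>k\<in>I. (qf I \<rho> (e k) * (h (s k))\<^sup>2) powr \<alpha>)"
    unfolding sum_distrib_left[symmetric]
    using t0 by (intro mult_left_mono weighted_powr_sum_le[OF a fin spec_onb[OF W] e]) auto
  also have "(\<Sum>k\<in>I. (qf I \<rho> (e k) * (h (s k))\<^sup>2) powr \<alpha>) = (\<Sum>k\<in>I. qf I \<rho> (e k) powr \<alpha> * s k powr (1 - \<alpha>))"
    unfolding h_def using sandwich_powr[OF a t0 s0] by (intro sum.cong) auto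
  finally show thesis
    using that[OF e eigenbasis_spec[OF e fin ev] ev s0 leN[unfolded N_def]] unfolding N_def by blast
qed

text \<open>The index map \<open>f\<close> identifies an index set with a product of two, so that Kronecker products with
  any ordering of the tensor factors are instances.\<close>

definition tens :: "('k \<Rightarrow> 'l \<times> 'm) \<Rightarrow> ('a \<Rightarrow> 'b \<times> 'c) \<Rightarrow> ('l \<Rightarrow> 'b \<Rightarrow> complex) \<Rightarrow> ('m \<Rightarrow> 'c \<Rightarrow> complex) \<Rightarrow> 'k \<Rightarrow> 'a \<Rightarrow> complex" where
  "tens g f A B = (\<lambda>k i. A (fst (g k)) (fst (f i)) * B (snd (g k)) (snd (f i)))"

lemma sum_split: fixes h :: "'b \<Rightarrow> 'c \<Rightarrow> 'd::comm_monoid_add" 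
  assumes "bij_betw f I (I1 \<times> I2)"
  shows "(\<Sum>i\<in>I. h (fst (f i)) (snd (f i))) = (\<Sum>a\<in>I1. \<Sum>b\<in>I2. h a b)"
proof -
  have "(\<Sum>i\<in>I. h (fst (f i)) (snd (f i))) = (\<Sum>p\<in>I1 \<times> I2. h (fst p) (snd p))"
    by (rule sum.reindex_bij_betw[OF assms, of "\<lambda>p. h (fst p) (snd p)"])
  then show ?thesis by (simp add: sum.cartesian_product split_def)
qed

lemma sum_split_prod: fixes h1 :: "'b \<Rightarrow> 'd::comm_semiring_0" 
  assumes "bij_betw f I (I1 \<times> I2)"
  shows "(\<Sum>i\<in>I. h1 (fst (f i)) * h2 (snd (f i))) = (\<Sum>a\<in>I1. h1 a) * (\<Sum>b\<in>I2. h2 b)"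
  using sum_split[OF assms, of "\<lambda>a b. h1 a * h2 b"] by (simp add: sum_product)

context
  fixes f :: "'a \<Rightarrow> 'b \<times> 'c" and I I1 I2
  assumes f: "bij_betw f I (I1 \<times> I2)"
begin

lemma split_mem: "i \<in> I \<Longrightarrow> fst (f i) \<in> I1" "i \<in> I \<Longrightarrow> snd (f i) \<in> I2"
  using f unfolding bij_betw_def by (metis imageI mem_Times_iff)+

lemma split_eq: "i \<in> I \<Longrightarrow> j \<in> I \<Longrightarrow> i = j \<longleftrightarrow> fst (f i) = fst (f j) \<and> snd (f i) = snd (f j)"
  using f unfolding bij_betw_def inj_on_def by (metis prod_eqI)

lemma ip_tens: "ip I (tens g f A B k) (tens g' f C D l) = 
    ip I1 (A (fst (g k))) (C (fst (g' l))) * ip I2 (B (snd (g k))) (D (snd (g' l)))"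
proof -
  have "ip I (tens g f A B k) (tens g' f C D l) = (\<Sum>i\<in>I. 
     (cnj (A (fst (g k)) (fst (f i))) * C (fst (g' l)) (fst (f i))) * (cnj (B (snd (g k)) (snd (f i))) * D (snd (g' l)) (snd (f i))))"
    unfolding ip_def tens_def by (simp add: mult_ac)
  also have "\<dots> = ip I1 (A (fst (g k))) (C (fst (g' l))) * ip I2 (B (snd (g k))) (D (snd (g' l)))"
    unfolding ip_def by (rule sum_split_prod[OF f])
  finally show ?thesis .
qed

lemma ap_tens: "ap I (tens h f A B) (tens g f u v k) = tens g h (\<lambda>l. ap I1 A (u l)) (\<lambda>l. ap I2 B (v l)) k"
proof
  fix i
  have "ap I (tens h f A B) (tens g f u v k) i = (\<Sum>j\<in>I.
      (A (fst (h i)) (fst (f j)) * u (fst (g k)) (fst (f j))) * (B (snd (h i)) (snd (f j)) * v (snd (g k)) (snd (f j))))"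
    unfolding ap_def tens_def by (simp add: mult_ac)
  also have "\<dots> = tens g h (\<lambda>l. ap I1 A (u l)) (\<lambda>l. ap I2 B (v l)) k i"
    unfolding tens_def ap_def by (rule sum_split_prod[OF f])
  finally show "ap I (tens h f A B) (tens g f u v k) i = tens g h (\<lambda>l. ap I1 A (u l)) (\<lambda>l. ap I2 B (v l)) k i" .
qed

lemma mm_tens: "mm I (tens f f A B) (tens f f C D) = tens f f (mm I1 A C) (mm I2 B D)"
proof (intro ext)
  fix i j
  have "mm I (tens f f A B) (tens f f C D) i j = (\<Sum>k\<in>I.
      (A (fst (f i)) (fst (f k)) * C (fst (f k)) (fst (f j))) * (B (snd (f i)) (snd (f k)) * D (snd (f k)) (snd (f j))))"
    unfolding mm_def tens_def by (simp add: mult_ac)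
  also have "\<dots> = tens f f (mm I1 A C) (mm I2 B D) i j"
    unfolding tens_def mm_def by (rule sum_split_prod[OF f])
  finally show "mm I (tens f f A B) (tens f f C D) i j = tens f f (mm I1 A C) (mm I2 B D) i j" .
qed

lemma spc_tens: "spc I (tens f f U V) (\<lambda>k. d1 (fst (f k)) * d2 (snd (f k))) = tens f f (spc I1 U d1) (spc I2 V d2)"
proof (intro ext)
  fix i j
  have "spc I (tens f f U V) (\<lambda>k. d1 (fst (f k)) * d2 (snd (f k))) i j = (\<Sum>k\<in>I.
     (of_real (d1 (fst (f k))) * U (fst (f k)) (fst (f i)) * cnj (U (fst (f k)) (fst (f j)))) *
     (of_real (d2 (snd (f k))) * V (snd (f k)) (snd (f i)) * cnj (V (snd (f k)) (snd (f j)))))"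
    unfolding spc_def tens_def by (simp add: mult_ac)
  also have "\<dots> = tens f f (spc I1 U d1) (spc I2 V d2) i j"
    unfolding tens_def spc_def 
    by (rule sum_split_prod[OF f, of "\<lambda>k. of_real (d1 k) * U k (fst (f i)) * cnj (U k (fst (f j)))"
         "\<lambda>k. of_real (d2 k) * V k (snd (f i)) * cnj (V k (snd (f j)))"])
  finally show "spc I (tens f f U V) (\<lambda>k. d1 (fst (f k)) * d2 (snd (f k))) i j = tens f f (spc I1 U d1) (spc I2 V d2) i j" .
qed

lemma tens_cong: assumes "\<And>i j. i \<in> I1 \<Longrightarrow> j \<in> I1 \<Longrightarrow> A i j = A' i j" "\<And>i j. i \<in> I2 \<Longrightarrow> j \<in> I2 \<Longrightarrow> B i j = B' i j"
  and "i \<in> I" "j \<in> I" shows "tens f f A B i j = tens f f A' B' i j"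
  using assms split_mem unfolding tens_def by metis

lemma onb_tens: assumes "onb I1 U" "onb I2 V" shows "onb I (tens f f U V)"
  unfolding onb_def
proof (intro conjI ballI)
  fix k l assume kl: "k \<in> I" "l \<in> I"
  then show "ip I (tens f f U V k) (tens f f U V l) = (if k = l then 1 else 0)"
    unfolding ip_tens using assms split_mem split_eq[OF kl] by (simp add: onb_ipD)
next
  fix i j assume ij: "i \<in> I" "j \<in> I"
  have "(\<Sum>k\<in>I. tens f f U V k i * cnj (tens f f U V k j)) = (\<Sum>k\<in>I.
     (U (fst (f k)) (fst (f i)) * cnj (U (fst (f k)) (fst (f j)))) *
     (V (snd (f k)) (snd (f i)) * cnj (V (snd (f k)) (snd (f j)))))"
    unfolding tens_def by (simp add: mult_ac)
  also have "\<dots> = (\<Sum>k\<in>I1. U k (fst (f i)) * cnj (U k (fst (f j)))) * (\<Sum>k\<in>I2. V k (snd (f i)) * cnj (V k (snd (f j))))"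
    by (rule sum_split_prod[OF f])
  also have "\<dots> = (if fst (f i) = fst (f j) then 1 else 0) * (if snd (f i) = snd (f j) then 1 else 0)"
    using assms split_mem ij unfolding onb_def by auto
  finally show "(\<Sum>k\<in>I. tens f f U V k i * cnj (tens f f U V k j)) = (if i = j then 1 else 0)"
    using split_eq[OF ij] by simp
qed

lemma spec_tens: assumes "spec I1 A U d1" "spec I2 B V d2" 
  shows "spec I (tens f f A B) (tens f f U V) (\<lambda>k. d1 (fst (f k)) * d2 (snd (f k)))"
  unfolding spec_def spc_tens using assms onb_tens tens_cong[of A "spc I1 U d1" B "spc I2 V d2"] unfolding spec_def by blast

lemma herm_tens: assumes "herm I1 A" "herm I2 B" shows "herm I (tens f f A B)"
  unfolding herm_def
proof (intro ballI)
  fix i j assume ij: "i \<in> I" "j \<in> I"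
  have "A (fst (f j)) (fst (f i)) = cnj (A (fst (f i)) (fst (f j)))"
    "B (snd (f j)) (snd (f i)) = cnj (B (snd (f i)) (snd (f j)))"
    using assms ij split_mem unfolding herm_def by blast+
  then show "tens f f A B j i = cnj (tens f f A B i j)" unfolding tens_def by simp
qed

lemma pos_tens: assumes "finite I1" "finite I2" "pos I1 A" "pos I2 B" shows "pos I (tens f f A B)"
proof -
  obtain U d where U: "spec I1 A U d" "\<And>k. k \<in> I1 \<Longrightarrow> 0 \<le> d k" using pos_spectral[OF assms(1,3)] by blast
  obtain V c where V: "spec I2 B V c" "\<And>k. k \<in> I2 \<Longrightarrow> 0 \<le> c k" using pos_spectral[OF assms(2,4)] by blast
  show ?thesis by (rule spec_pos[OF spec_tens[OF U(1) V(1)]]) (use U V split_mem in auto)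
qed

lemma qf_tens: assumes "herm I1 A" "herm I2 B"
  shows "qf I (tens f f A B) (tens g f u v k) = qf I1 A (u (fst (g k))) * qf I2 B (v (snd (g k)))"
proof -
  have "complex_of_real (qf I (tens f f A B) (tens g f u v k)) = of_real (qf I1 A (u (fst (g k))) * qf I2 B (v (snd (g k))))"
    using herm_qf_ip[OF herm_tens[OF assms], of "tens g f u v k"] herm_qf_ip[OF assms(1)] herm_qf_ip[OF assms(2)]
    unfolding ap_tens ip_tens by simp
  then show ?thesis by (simp only: of_real_eq_iff)
qed

lemma finite_split: "finite I1 \<Longrightarrow> finite I2 \<Longrightarrow> finite I"
  using bij_betw_finite[OF f] by simp

text \<open>Products of the chosen eigenbases diagonalize \<sigma> and the sandwiched operator of
  the product. The set of pairwise products records the possible eigenvalues without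
  multiplicity.\<close>

lemma sandQ_tens: assumes a: "\<alpha> > 1" and Q1: "sandQ \<alpha> I1 \<rho>1 \<sigma>1 q1 D1" and Q2: "sandQ \<alpha> I2 \<rho>2 \<sigma>2 q2 D2"
  shows "sandQ \<alpha> I (tens f f \<rho>1 \<rho>2) (tens f f \<sigma>1 \<sigma>2) (q1 * q2) ((\<lambda>(a,b). a * b) ` (D1 \<times> D2))"
proof -
  define s where "s = (1 - \<alpha>) / (2 * \<alpha>)"
  obtain U1 d1 W1 z1 where 1: "finite I1" "finite D1" "pos I1 \<rho>1" "spec I1 \<sigma>1 U1 d1"
    "\<And>k. k \<in> I1 \<Longrightarrow> 0 \<le> d1 k" "\<And>k. k \<in> I1 \<Longrightarrow> d1 k \<in> D1" "\<And>k. k \<in> I1 \<Longrightarrow> d1 k = 0 \<Longrightarrow> qf I1 \<rho>1 (U1 k) = 0"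
    "spec I1 (mm I1 (spc I1 U1 (\<lambda>k. d1 k powr s)) (mm I1 \<rho>1 (spc I1 U1 (\<lambda>k. d1 k powr s)))) W1 z1"
    "q1 = (\<Sum>k\<in>I1. z1 k powr \<alpha>)" using Q1 unfolding sandQ_def s_def by blast
  obtain U2 d2 W2 z2 where 2: "finite I2" "finite D2" "pos I2 \<rho>2" "spec I2 \<sigma>2 U2 d2"
    "\<And>k. k \<in> I2 \<Longrightarrow> 0 \<le> d2 k" "\<And>k. k \<in> I2 \<Longrightarrow> d2 k \<in> D2" "\<And>k. k \<in> I2 \<Longrightarrow> d2 k = 0 \<Longrightarrow> qf I2 \<rho>2 (U2 k) = 0"
    "spec I2 (mm I2 (spc I2 U2 (\<lambda>k. d2 k powr s)) (mm I2 \<rho>2 (spc I2 U2 (\<lambda>k. d2 k powr s)))) W2 z2"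
    "q2 = (\<Sum>k\<in>I2. z2 k powr \<alpha>)" using Q2 unfolding sandQ_def s_def by blast
  define U where "U = tens f f U1 U2"
  define d where "d k = d1 (fst (f k)) * d2 (snd (f k))" for k
  define W where "W = tens f f W1 W2"
  define z where "z k = z1 (fst (f k)) * z2 (snd (f k))" for k
  have z1: "0 \<le> z1 k" if "k \<in> I1" for k using spec_nonneg[OF 1(8) 1(1) pos_conj[OF 1(1) herm_spc 1(3)] that] .
  have z2: "0 \<le> z2 k" if "k \<in> I2" for k using spec_nonneg[OF 2(8) 2(1) pos_conj[OF 2(1) herm_spc 2(3)] that] .
  have dd: "0 \<le> d k \<and> d k \<in> (\<lambda>(a,b). a * b) ` (D1 \<times> D2) \<and> (d k = 0 \<longrightarrow> qf I (tens f f \<rho>1 \<rho>2) (U k) = 0)" if "k \<in> I" for k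
  proof -
    note m = split_mem[OF that]
    have "d k = 0 \<Longrightarrow> qf I1 \<rho>1 (U1 (fst (f k))) * qf I2 \<rho>2 (U2 (snd (f k))) = 0"
      unfolding d_def using 1(7)[OF m(1)] 2(7)[OF m(2)] by auto
    moreover have "herm I1 \<rho>1" "herm I2 \<rho>2" using 1(3) 2(3) unfolding pos_def by auto
    ultimately have "d k = 0 \<longrightarrow> qf I (tens f f \<rho>1 \<rho>2) (U k) = 0" unfolding U_def by (simp add: qf_tens)
    moreover have "d k \<in> (\<lambda>(a,b). a * b) ` (D1 \<times> D2)"
      unfolding d_def using 1(6)[OF m(1)] 2(6)[OF m(2)] by (intro image_eqI[of _ _ "(d1 (fst (f k)), d2 (snd (f k)))"]) auto
    ultimately show ?thesis unfolding d_def using 1(5)[OF m(1)] 2(5)[OF m(2)] by auto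
  qed
  have S: "spec I (tens f f \<sigma>1 \<sigma>2) U d" unfolding U_def d_def by (rule spec_tens[OF 1(4) 2(4)])
  have H: "spc I U (\<lambda>k. d k powr s) = tens f f (spc I1 U1 (\<lambda>k. d1 k powr s)) (spc I2 U2 (\<lambda>k. d2 k powr s))"
  proof -
    have "spc I U (\<lambda>k. d k powr s) = spc I U (\<lambda>k. d1 (fst (f k)) powr s * d2 (snd (f k)) powr s)"
      unfolding spc_def d_def using 1(5) 2(5) split_mem by (intro ext sum.cong) (auto simp: powr_mult)
    then show ?thesis unfolding U_def spc_tens[where ?d1.0 = "\<lambda>k. d1 k powr s" and ?d2.0 = "\<lambda>k. d2 k powr s"] .
  qed
  have Z: "spec I (mm I (spc I U (\<lambda>k. d k powr s)) (mm I (tens f f \<rho>1 \<rho>2) (spc I U (\<lambda>k. d k powr s)))) W z"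
    unfolding H mm_tens W_def z_def by (rule spec_tens[OF 1(8) 2(8)])
  have q: "q1 * q2 = (\<Sum>k\<in>I. z k powr \<alpha>)"
  proof -
    have "(\<Sum>k\<in>I. z k powr \<alpha>) = (\<Sum>k\<in>I. z1 (fst (f k)) powr \<alpha> * z2 (snd (f k)) powr \<alpha>)"
      unfolding z_def using z1 z2 split_mem by (intro sum.cong) (auto simp: powr_mult)
    then show ?thesis unfolding 1(9) 2(9) using sum_split_prod[OF f, of "\<lambda>k. z1 k powr \<alpha>" "\<lambda>k. z2 k powr \<alpha>"] by simp
  qed
  show ?thesis unfolding sandQ_def s_def[symmetric]
    using finite_split[OF 1(1) 2(1)] 1(2) 2(2) pos_tens[OF 1(1) 2(1) 1(3) 2(3)] S dd Z q by blast
qed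

end

text \<open>The trivial system: start of tensor powers and a device for relabelling.\<close>

lemma sandQ_one: "sandQ \<alpha> {p} (\<lambda>_ _. 1) (\<lambda>_ _. 1) 1 {1}"
proof -
  have s: "spec {p} (\<lambda>_ _. 1) (\<lambda>_ _. 1) (\<lambda>_. 1)"
    by (simp add: spec_def spc_def onb_def ip_def)
  have "spec {p} (mm {p} (spc {p} (\<lambda>_ _. 1) (\<lambda>k. 1 powr ((1 - \<alpha>) / (2 * \<alpha>)))) 
      (mm {p} (\<lambda>_ _. 1) (spc {p} (\<lambda>_ _. 1) (\<lambda>k. 1 powr ((1 - \<alpha>) / (2 * \<alpha>)))))) (\<lambda>_ _. 1) (\<lambda>_. 1)"
    by (simp add: spec_def spc_def onb_def ip_def mm_def)
  moreover have "pos {p} (\<lambda>_ _. 1)" by (rule spec_pos[OF s]) simp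
  ultimately show ?thesis unfolding sandQ_def using s
    by (intro conjI exI[of _ "\<lambda>_ _. 1"] exI[of _ "\<lambda>_. 1"]) auto
qed

text \<open>A bijection onto I is one onto I times a point, so relabelling is the tensor product
  with the trivial system, and multiplication by 1 leaves \<open>D\<close> unchanged.\<close>

lemma sandQ_reindex: assumes a: "\<alpha> > 1" and g: "bij_betw g J I" and Q: "sandQ \<alpha> I \<rho> \<sigma> q D"
  shows "sandQ \<alpha> J (\<lambda>i j. \<rho> (g i) (g j)) (\<lambda>i j. \<sigma> (g i) (g j)) q D"
proof -
  have f: "bij_betw (\<lambda>j. (g j, ())) J (I \<times> {()})"
    using g unfolding bij_betw_def inj_on_def by auto
  have "(\<lambda>(a,b). a * b) ` (D \<times> {1}) = D" by (auto simp: image_iff)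
  then show ?thesis using sandQ_tens[OF f a Q sandQ_one[of \<alpha> "()"]] by (simp add: tens_def)
qed

lemma qf_reindex: assumes "bij_betw g J I"
  shows "qf J (\<lambda>i j. A (g i) (g j)) (\<lambda>i. v (g i)) = qf I A v"
proof -
  have "ap J (\<lambda>i j. A (g i) (g j)) (\<lambda>i. v (g i)) i = ap I A v (g i)" for i
    unfolding ap_def by (rule sum.reindex_bij_betw[OF assms])
  then show ?thesis unfolding qf_def ip_def
    using sum.reindex_bij_betw[OF assms, of "\<lambda>i. cnj (v i) * ap I A v i"] by simp
qed

lemma qf_reindex': assumes g: "bij_betw g J I"
  shows "qf J (\<lambda>i j. A (g i) (g j)) v = qf I A (\<lambda>i. v (inv_into J g i))"
  unfolding qf_reindex[OF g, symmetric]
  by (rule qf_cong) (use g in \<open>auto simp: bij_betw_def\<close>)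

lemma pos_reindex: assumes g: "bij_betw g J I" and p: "pos I A"
  shows "pos J (\<lambda>i j. A (g i) (g j))"
  unfolding pos_def qf_reindex'[OF g] using p g unfolding pos_def herm_def bij_betw_def by blast

text \<open>The sum of the rank-one operators of the \<open>F k\<close> is at most the identity.
  Equality would be too strict: the frames later built from a pure state resolve only the support of
  its marginal.\<close>

definition contraction :: "'a set \<Rightarrow> 'k set \<Rightarrow> ('k \<Rightarrow> 'a \<Rightarrow> complex) \<Rightarrow> bool" where
  "contraction I K F \<longleftrightarrow> (\<forall>v. (\<Sum>k\<in>K. (cmod (ip I (F k) v))\<^sup>2) \<le> nrm2 I v)"

text \<open>On slices: \<open>G\<close> acts in the second variable, then \<open>F\<close> in the
  first on the results, and the two bounds compose.\<close>

lemma contraction_tens: assumes f: "bij_betw f I (I1 \<times> I2)" and g: "bij_betw g K (K1 \<times> K2)"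
    and F: "contraction I1 K1 F" and G: "contraction I2 K2 G"
  shows "contraction I K (tens g f F G)"
  unfolding contraction_def
proof
  fix v :: "_ \<Rightarrow> complex"
  define w where "w a b = v (inv_into I f (a,b))" for a b
  have vw: "v i = w (fst (f i)) (snd (f i))" if "i \<in> I" for i
    using that f unfolding w_def bij_betw_def by simp
  have ipv: "ip I (tens g f F G k) v = ip I1 (F (fst (g k))) (\<lambda>a. ip I2 (G (snd (g k))) (w a))" for k
  proof -
    have "ip I (tens g f F G k) v = (\<Sum>i\<in>I. cnj (F (fst (g k)) (fst (f i))) * cnj (G (snd (g k)) (snd (f i))) * w (fst (f i)) (snd (f i)))"
      unfolding ip_def tens_def by (intro sum.cong) (auto simp: vw)
    also have "\<dots> = (\<Sum>a\<in>I1. \<Sum>b\<in>I2. cnj (F (fst (g k)) a) * cnj (G (snd (g k)) b) * w a b)"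
      by (rule sum_split[OF f, of "\<lambda>a b. cnj (F (fst (g k)) a) * cnj (G (snd (g k)) b) * w a b"])
    finally show ?thesis unfolding ip_def by (simp add: sum_distrib_left mult.assoc)
  qed
  have "(\<Sum>k\<in>K. (cmod (ip I (tens g f F G k) v))\<^sup>2) = (\<Sum>k\<in>K1. \<Sum>l\<in>K2. (cmod (ip I1 (F k) (\<lambda>a. ip I2 (G l) (w a))))\<^sup>2)"
    unfolding ipv by (rule sum_split[OF g, of "\<lambda>k l. (cmod (ip I1 (F k) (\<lambda>a. ip I2 (G l) (w a))))\<^sup>2"])
  also have "\<dots> = (\<Sum>l\<in>K2. \<Sum>k\<in>K1. (cmod (ip I1 (F k) (\<lambda>a. ip I2 (G l) (w a))))\<^sup>2)" by (rule sum.swap)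
  also have "\<dots> \<le> (\<Sum>l\<in>K2. nrm2 I1 (\<lambda>a. ip I2 (G l) (w a)))"
    using F unfolding contraction_def by (intro sum_mono) blast
  also have "\<dots> = (\<Sum>a\<in>I1. \<Sum>l\<in>K2. (cmod (ip I2 (G l) (w a)))\<^sup>2)" unfolding nrm2_def by (rule sum.swap)
  also have "\<dots> \<le> (\<Sum>a\<in>I1. nrm2 I2 (w a))"
    using G unfolding contraction_def by (intro sum_mono) blast
  also have "\<dots> = (\<Sum>i\<in>I. (cmod (w (fst (f i)) (snd (f i))))\<^sup>2)"
    unfolding nrm2_def by (rule sum_split[OF f, of "\<lambda>a b. (cmod (w a b))\<^sup>2", symmetric])
  also have "\<dots> = nrm2 I v" unfolding nrm2_def by (intro sum.cong) (auto simp: vw)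
  finally show "(\<Sum>k\<in>K. (cmod (ip I (tens g f F G k) v))\<^sup>2) \<le> nrm2 I v" .
qed

text \<open>Classical core of both lossy estimates. \<open>t\<close> and \<open>s\<close> are
  weights of the inputs on common pure states, \<open>A k i\<close> and \<open>C k i\<close> the
  weights of outcome \<open>k\<close> on the images of state \<open>i\<close>. \<open>X\<close> is
  only bounded, since \<rho> is merely dominated by its pinching, while \<open>Y\<close> is exact
  because \<sigma> is diagonal.\<close>

lemma powr_mixture:
  fixes X Y :: "'k \<Rightarrow> real" and t s :: "'a \<Rightarrow> real"
  assumes a: "\<alpha> > 1" and fin: "finite I" and N: "0 \<le> N"
    and t: "\<And>i. i \<in> I \<Longrightarrow> 0 \<le> t i" and s: "\<And>i. i \<in> I \<Longrightarrow> 0 \<le> s i" and ts: "\<And>i. i \<in> I \<Longrightarrow> s i = 0 \<Longrightarrow> t i = 0"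
    and A: "\<And>k i. 0 \<le> A k i" and C: "\<And>k i. 0 \<le> C k i" and AC: "\<And>k i. i \<in> I \<Longrightarrow> C k i = 0 \<Longrightarrow> A k i = 0"
    and X0: "\<And>k. 0 \<le> X k" and X: "\<And>k. X k \<le> N * (\<Sum>i\<in>I. t i * A k i)"
    and Y: "\<And>k. k \<in> K \<Longrightarrow> Y k = (\<Sum>i\<in>I. s i * C k i)"
    and B: "\<And>i. i \<in> I \<Longrightarrow> (\<Sum>k\<in>K. A k i powr \<alpha> * C k i powr (1 - \<alpha>)) \<le> B"
  shows "(\<Sum>k\<in>K. X k powr \<alpha> * Y k powr (1 - \<alpha>)) \<le> N powr \<alpha> * ((\<Sum>i\<in>I. t i powr \<alpha> * s i powr (1 - \<alpha>)) * B)"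
proof -
  define g where "g i = t i powr \<alpha> * s i powr (1 - \<alpha>)" for i
  define h where "h k i = A k i powr \<alpha> * C k i powr (1 - \<alpha>)" for k i
  have tA: "t i * A k i = 0" if "i \<in> I" "s i * C k i = 0" for k i
    using ts[OF that(1)] AC[OF that(1)] that(2) by (metis mult_eq_0_iff)
  have "(\<Sum>k\<in>K. X k powr \<alpha> * Y k powr (1 - \<alpha>)) \<le> (\<Sum>k\<in>K. N powr \<alpha> * (\<Sum>i\<in>I. g i * h k i))"
  proof (rule sum_mono)
    fix k assume k: "k \<in> K"
    have "X k powr \<alpha> * Y k powr (1 - \<alpha>) \<le> (N * (\<Sum>i\<in>I. t i * A k i)) powr \<alpha> * Y k powr (1 - \<alpha>)"
      using X X0 a by (intro mult_right_mono powr_mono2) auto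
    also have "\<dots> = N powr \<alpha> * ((\<Sum>i\<in>I. t i * A k i) powr \<alpha> * (\<Sum>i\<in>I. s i * C k i) powr (1 - \<alpha>))"
      unfolding powr_mult Y[OF k] by simp
    also have "\<dots> \<le> N powr \<alpha> * (\<Sum>i\<in>I. (t i * A k i) powr \<alpha> * (s i * C k i) powr (1 - \<alpha>))"
      using t s A C tA a fin by (intro mult_left_mono powr_joint_subadditive) simp_all
    also have "(\<Sum>i\<in>I. (t i * A k i) powr \<alpha> * (s i * C k i) powr (1 - \<alpha>)) = (\<Sum>i\<in>I. g i * h k i)"
      unfolding g_def h_def by (simp add: powr_mult mult_ac)
    finally show "X k powr \<alpha> * Y k powr (1 - \<alpha>) \<le> N powr \<alpha> * (\<Sum>i\<in>I. g i * h k i)" .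
  qed
  also have "\<dots> = N powr \<alpha> * (\<Sum>k\<in>K. \<Sum>i\<in>I. g i * h k i)" by (simp add: sum_distrib_left)
  also have "(\<Sum>k\<in>K. \<Sum>i\<in>I. g i * h k i) = (\<Sum>i\<in>I. g i * (\<Sum>k\<in>K. h k i))"
    unfolding sum_distrib_left by (rule sum.swap)
  also have "N powr \<alpha> * \<dots> \<le> N powr \<alpha> * (\<Sum>i\<in>I. g i * B)"
    using B unfolding h_def g_def by (intro mult_left_mono sum_mono) auto
  finally show ?thesis unfolding g_def sum_distrib_right .
qed

abbreviation renyi_sum :: "real \<Rightarrow> 'a set \<Rightarrow> 'a op \<Rightarrow> 'a op \<Rightarrow> 'k set \<Rightarrow> ('k \<Rightarrow> 'a \<Rightarrow> complex) \<Rightarrow> real" where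
  "renyi_sum \<alpha> I \<rho> \<sigma> K F \<equiv> (\<Sum>k\<in>K. qf I \<rho> (F k) powr \<alpha> * qf I \<sigma> (F k) powr (1 - \<alpha>))"

text \<open>Both operators are spread over the same eigenvectors of \<sigma>, so the outcome weights
  \<open>w k i\<close> agree and w^\<alpha> w^(1 - \<alpha>) = w; their sum over \<open>k\<close> is
  at most 1 because \<open>F\<close> is a contraction. The loss comes from pinching \<rho>.\<close>

lemma sandQ_lower_lossy:
  assumes a: "\<alpha> > 1" and Q: "sandQ \<alpha> I \<rho> \<sigma> q D" and K: "finite K" and F: "contraction I K F"
  shows "renyi_sum \<alpha> I \<rho> \<sigma> K F \<le> real (card D) powr \<alpha> * q"
proof -
  note fin = sandQ_finite(1)[OF Q]
  obtain e s where e: "onb I e" and sp: "spec I \<sigma> e s" 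
    and ev: "\<And>k i. k \<in> I \<Longrightarrow> i \<in> I \<Longrightarrow> ap I \<sigma> (e k) i = of_real (s k) * e k i"
    and s0: "\<And>k. k \<in> I \<Longrightarrow> 0 \<le> s k" 
    and le: "\<And>v. qf I \<rho> v \<le> real (card D) * (\<Sum>k\<in>I. qf I \<rho> (e k) * (cmod (ip I (e k) v))\<^sup>2)"
    by (rule sandQ_pinch[OF a Q]) (rule that)
  define t where "t k = qf I \<rho> (e k)" for k
  have t0: "0 \<le> qf I \<rho> v" for v using sandQ_pos(1)[OF Q] unfolding pos_def by blast
  define N where "N = real (card D)"
  define w where "w k i = (cmod (ip I (e i) (F k)))\<^sup>2" for k i
  have w0: "0 \<le> w k i" for k i unfolding w_def by simp
  have z: "t i = 0" if "i \<in> I" "s i = 0" for i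
    using sandQ_kernel[OF Q, of "e i"] spec_qf_basis[OF sp fin that(1)] that unfolding t_def by simp
  have wsum: "(\<Sum>k\<in>K. w k i) \<le> 1" if "i \<in> I" for i
  proof -
    have "(\<Sum>k\<in>K. w k i) = (\<Sum>k\<in>K. (cmod (ip I (F k) (e i)))\<^sup>2)"
      unfolding w_def by (subst cmod_ip_swap) (rule refl)
    also have "\<dots> \<le> nrm2 I (e i)" using F unfolding contraction_def by blast
    finally show ?thesis using onb_nrm2[OF e that] by simp
  qed
  have "renyi_sum \<alpha> I \<rho> \<sigma> K F \<le> N powr \<alpha> * ((\<Sum>i\<in>I. t i powr \<alpha> * s i powr (1 - \<alpha>)) * 1)"
  proof (rule powr_mixture[where A = w and C = w, OF a fin])
    show "qf I \<rho> (F k) \<le> N * (\<Sum>i\<in>I. t i * w k i)" for k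
      using le[of "F k"] unfolding N_def t_def w_def .
    show "qf I \<sigma> (F k) = (\<Sum>i\<in>I. s i * w k i)" for k unfolding spec_qf[OF sp] w_def ..
    show "(\<Sum>k\<in>K. w k i powr \<alpha> * w k i powr (1 - \<alpha>)) \<le> 1" if "i \<in> I" for i
      using wsum[OF that] w0 by (simp add: powr_add[symmetric])
  qed (use t0 s0 w0 z in \<open>simp_all add: N_def t_def\<close>)
  also have "\<dots> \<le> N powr \<alpha> * q"
    using sandQ_lower_eigenbasis[OF a Q e ev] unfolding t_def by (intro mult_left_mono) auto
  finally show ?thesis unfolding N_def .
qed

text \<open>Index \<open>(a, c)\<close> of \<open>grid r x\<close> is the basis vector $|a\rangle\otimes|c\rangle$ of $R \otimes X$. Powers
  keep the two factors apart: those of an operator on $R \otimes X$ live on $R^{n} \otimes X^{n}$.\<close>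

definition grid :: "nat \<Rightarrow> nat \<Rightarrow> (nat \<times> nat) set" where "grid r x = {..<r} \<times> {..<x}"

definition grid_split :: "nat \<Rightarrow> nat \<Rightarrow> nat \<times> nat \<Rightarrow> (nat \<times> nat) \<times> (nat \<times> nat)" where
  "grid_split r x i = ((fst i div r, snd i div x), (fst i mod r, snd i mod x))"

section \<open>Tensor powers and the removal of subexponential factors\<close>

lemma finite_grid: "finite (grid r x)" by (simp add: grid_def)

lemma mult_add_less: "a < m \<Longrightarrow> b < r \<Longrightarrow> a * r + b < m * (r::nat)"
proof -
  assume "a < m" "b < r"
  then have "a * r + b < (a + 1) * r" by simp
  also have "\<dots> \<le> m * r" using \<open>a < m\<close> by (intro mult_right_mono) auto
  finally show ?thesis .
qed

lemma div_mod_less: "a < m * x \<Longrightarrow> a div x < m \<and> a mod x < (x::nat)"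
  by (metis less_mult_imp_div_less mod_less_divisor mult_is_0 not_gr_zero not_less_zero)

lemma bij_grid_split: "bij_betw (grid_split r x) (grid (m * r) (n * x)) (grid m n \<times> grid r x)"
proof (rule bij_betw_byWitness[where f' = "\<lambda>p. (fst (fst p) * r + fst (snd p), snd (fst p) * x + snd (snd p))"])
  show "grid_split r x ` grid (m * r) (n * x) \<subseteq> grid m n \<times> grid r x"
    unfolding grid_def grid_split_def using div_mod_less by auto
  show "(\<lambda>p. (fst (fst p) * r + fst (snd p), snd (fst p) * x + snd (snd p))) ` (grid m n \<times> grid r x) \<subseteq> grid (m * r) (n * x)"
    unfolding grid_def by (auto simp: mult_add_less)
qed (auto simp: grid_def grid_split_def)

text \<open>First arguments live on the grid for \<open>s\<close>, \<open>y\<close>, second ones on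
  that for \<open>r\<close>, \<open>x\<close>, so one recursion serves square operators and families
  of vectors labelled by another grid. The zeroth power is the scalar 1 on the one-point
  grid.\<close>

primrec tens_pow :: "nat \<Rightarrow> nat \<Rightarrow> nat \<Rightarrow> nat \<Rightarrow> nat \<Rightarrow> (nat \<times> nat) op \<Rightarrow> (nat \<times> nat) op" where
  "tens_pow s y r x 0 A = (\<lambda>_ _. 1)"
| "tens_pow s y r x (Suc n) A = tens (grid_split s y) (grid_split r x) (tens_pow s y r x n A) A"

lemma grid_one: "grid (Suc 0) (Suc 0) = {(0,0)}" unfolding grid_def by auto

primrec set_pow :: "nat \<Rightarrow> real set \<Rightarrow> real set" where
  "set_pow 0 D = {1}"
| "set_pow (Suc n) D = (\<lambda>(a,b). a * b) ` (set_pow n D \<times> D)"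

text \<open>Method of types: an n-fold product is determined by how often each element of
  \<open>D\<close> occurs, and every multiplicity is one of 0, ..., n.\<close>

lemma card_set_pow: assumes D: "finite D" shows "card (set_pow n D) \<le> (n + 1) ^ card D"
proof -
  have sub: "set_pow n D \<subseteq> (\<lambda>k. \<Prod>\<delta>\<in>D. \<delta> ^ k \<delta>) ` (PiE D (\<lambda>_. {..n}))" for n
  proof (induction n)
    case 0
    have "(\<lambda>\<delta>. if \<delta> \<in> D then 0 else undefined) \<in> PiE D (\<lambda>_. {..0::nat})" by auto
    moreover have "(1::real) = (\<Prod>\<delta>\<in>D. \<delta> ^ (if \<delta> \<in> D then 0 else undefined))" by simp
    ultimately show ?case by auto
  next
    case (Suc n)
    show ?case
    proof
      fix c assume "c \<in> set_pow (Suc n) D"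
      then obtain a b where c: "c = a * b" "a \<in> set_pow n D" "b \<in> D" by auto
      with Suc obtain k where k: "k \<in> PiE D (\<lambda>_. {..n})" "a = (\<Prod>\<delta>\<in>D. \<delta> ^ k \<delta>)" by auto
      have "c = (\<Prod>\<delta>\<in>D. \<delta> ^ (k(b := Suc (k b))) \<delta>)"
        unfolding c(1) k(2) prod.remove[OF D c(3)] by simp
      moreover have "k(b := Suc (k b)) \<in> PiE D (\<lambda>_. {..Suc n})"
        using k(1) c(3) by (auto simp: PiE_iff extensional_def le_SucI)
      ultimately show "c \<in> (\<lambda>k. \<Prod>\<delta>\<in>D. \<delta> ^ k \<delta>) ` (PiE D (\<lambda>_. {..Suc n}))" by blast
    qed
  qed
  have "card (set_pow n D) \<le> card (PiE D (\<lambda>_. {..n}))"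
    by (rule surj_card_le[OF _ sub]) (use D in \<open>auto intro: finite_PiE\<close>)
  then show ?thesis using D by (simp add: card_PiE)
qed

lemma card_set_pow_powr: assumes "finite D" "\<alpha> \<ge> 0"
  shows "real (card (set_pow n D)) powr \<alpha> \<le> real (n + 1) powr (real (card D) * \<alpha>)"
proof -
  have "real (card (set_pow n D)) \<le> real ((n + 1) ^ card D)" using card_set_pow[OF assms(1)] of_nat_mono by blast
  also have "\<dots> = real (n + 1) powr real (card D)" by (simp add: powr_realpow)
  finally have "real (card (set_pow n D)) powr \<alpha> \<le> (real (n + 1) powr real (card D)) powr \<alpha>"
    using assms by (intro powr_mono2) auto
  then show ?thesis by (simp add: powr_powr)
qed

lemma sandQ_pow: assumes a: "\<alpha> > 1" and Q: "sandQ \<alpha> (grid r x) \<rho> \<sigma> q D"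
  shows "sandQ \<alpha> (grid (r ^ n) (x ^ n)) (tens_pow r x r x n \<rho>) (tens_pow r x r x n \<sigma>) (q ^ n) (set_pow n D)"
proof (induction n)
  case 0 show ?case by (simp add: grid_one sandQ_one)
next
  case (Suc n)
  show ?case using sandQ_tens[OF bij_grid_split a Suc Q] by (simp add: power_Suc2 del: power_Suc)
qed

lemma contraction_pow: assumes "contraction (grid r x) (grid s y) F"
  shows "contraction (grid (r ^ n) (x ^ n)) (grid (s ^ n) (y ^ n)) (tens_pow s y r x n F)"
proof (induction n)
  case 0 show ?case by (simp add: grid_one contraction_def ip_def nrm2_def)
next
  case (Suc n)
  show ?case using contraction_tens[OF bij_grid_split bij_grid_split Suc assms] by (simp add: power_Suc2 del: power_Suc)
qed

lemma pos_pow: assumes "pos (grid r x) A" shows "pos (grid (r ^ n) (x ^ n)) (tens_pow r x r x n A)"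
proof (induction n)
  case 0 
  have "spec {(0,0)} (\<lambda>_ _. 1) (\<lambda>_ _. 1) (\<lambda>_. 1)"
    by (simp add: spec_def spc_def onb_def ip_def)
  then have "pos {(0,0)} (\<lambda>_ _. 1)" by (rule spec_pos) simp
  then show ?case by (simp add: grid_one)
next
  case (Suc n)
  show ?case using pos_tens[OF bij_grid_split finite_grid finite_grid Suc assms] by (simp add: power_Suc2 del: power_Suc)
qed

lemma ln_le_sqrt: assumes "x > 0" shows "ln x \<le> 2 * sqrt x"
proof -
  have "ln x = 2 * ln (sqrt x)" using assms by (simp add: ln_sqrt)
  also have "ln (sqrt x) \<le> sqrt x - 1" using assms by (intro ln_le_minus_one) auto
  finally show ?thesis using assms by simp
qed

lemma ln_Suc_over_n: "(\<lambda>n. ln (real (n + 1)) / real n) \<longlonglongrightarrow> 0"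
proof (rule tendsto_sandwich[where f = "\<lambda>_. 0"])
  show "eventually (\<lambda>n. 0 \<le> ln (real (n + 1)) / real n) sequentially" by (intro always_eventually allI) simp
  show "eventually (\<lambda>n. ln (real (n + 1)) / real n \<le> 4 / sqrt (real n)) sequentially"
    using eventually_gt_at_top[of "0::nat"]
  proof eventually_elim
    case (elim n)
    have "ln (real (n + 1)) \<le> 2 * sqrt (real (n + 1))" by (rule ln_le_sqrt) simp
    also have "\<dots> \<le> 2 * sqrt (4 * real n)" using elim by simp
    also have "\<dots> = 4 * sqrt (real n)" by (simp add: real_sqrt_mult)
    finally have "ln (real (n + 1)) / real n \<le> 4 * sqrt (real n) / real n" by (intro divide_right_mono) auto
    also have "\<dots> = 4 / sqrt (real n)" using elim by (simp add: field_simps)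
    finally show ?case .
  qed
  have "(\<lambda>n. 4 * inverse (sqrt (real n))) \<longlonglongrightarrow> 4 * 0"
    by (intro tendsto_mult tendsto_const tendsto_inverse_0_at_top filterlim_compose[OF sqrt_at_top] filterlim_real_sequentially)
  then show "(\<lambda>n. 4 / sqrt (real n)) \<longlonglongrightarrow> 0" by (simp add: field_simps)
qed simp

text \<open>If q < a, then n ln (a/q) \<le> c ln (n + 1) for all n, although ln (n + 1)/n tends to
  0. The instance n = 1 excludes q = 0.\<close>

lemma le_if_pow_le_subexp: assumes "0 \<le> a" "0 \<le> q" "\<And>n. a ^ n \<le> real (n + 1) powr c * q ^ n" shows "a \<le> q"
proof (rule ccontr)
  assume "\<not> a \<le> q"
  then have aq: "q < a" by simp
  have "q > 0" using assms(3)[of 1] aq assms(2) by (cases "q = 0") auto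
  have "ln (a / q) \<le> c * (ln (real (n + 1)) / real n)" if n: "n > 0" for n
  proof -
    have "(a / q) ^ n \<le> real (n + 1) powr c" using assms(3)[of n] \<open>q > 0\<close> by (simp add: power_divide field_simps)
    then have "ln ((a / q) ^ n) \<le> ln (real (n + 1) powr c)" using \<open>q > 0\<close> aq by (subst ln_le_cancel_iff) auto
    then have "real n * ln (a / q) \<le> c * ln (real (n + 1))" using \<open>q > 0\<close> aq by (simp add: ln_realpow ln_powr)
    then show ?thesis using n by (simp add: field_simps)
  qed
  then have "eventually (\<lambda>n. ln (a / q) \<le> c * (ln (real (n + 1)) / real n)) sequentially"
    by (intro eventually_mono[OF eventually_gt_at_top[of "0::nat"]])
  moreover have "(\<lambda>n. c * (ln (real (n + 1)) / real n)) \<longlonglongrightarrow> c * 0"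
    by (intro tendsto_mult tendsto_const ln_Suc_over_n)
  ultimately have "ln (a / q) \<le> c * 0" by (intro tendsto_lowerbound) auto
  moreover have "ln (a / q) > 0" using \<open>q > 0\<close> aq by (intro ln_gt_zero) auto
  ultimately show False by simp
qed

lemma renyi_sum_pow: assumes \<rho>: "pos (grid r x) \<rho>" and \<sigma>: "pos (grid r x) \<sigma>"
  shows "renyi_sum \<alpha> (grid (r ^ n) (x ^ n)) (tens_pow r x r x n \<rho>) (tens_pow r x r x n \<sigma>) (grid (s ^ n) (y ^ n)) (tens_pow s y r x n F)
    = renyi_sum \<alpha> (grid r x) \<rho> \<sigma> (grid s y) F ^ n"
proof (induction n)
  case 0 show ?case by (simp add: grid_one qf_def ip_def ap_def)
next
  case (Suc n)
  let ?I = "grid (r ^ n) (x ^ n)" and ?J = "grid r x"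
  let ?r = "tens_pow r x r x n \<rho>" and ?s = "tens_pow r x r x n \<sigma>" and ?F = "tens_pow s y r x n F"
  have h: "herm ?I ?r" "herm ?I ?s" "herm ?J \<rho>" "herm ?J \<sigma>" using \<rho> \<sigma> pos_pow[OF \<rho>] pos_pow[OF \<sigma>] unfolding pos_def by auto
  have nn: "0 \<le> qf ?I ?r v" "0 \<le> qf ?I ?s v" "0 \<le> qf ?J \<rho> u" "0 \<le> qf ?J \<sigma> u" for u v
    using \<rho> \<sigma> pos_pow[OF \<rho>] pos_pow[OF \<sigma>] unfolding pos_def by auto
  have "(\<Sum>k\<in>grid (s ^ n * s) (y ^ n * y). qf (grid (r ^ n * r) (x ^ n * x)) (tens (grid_split r x) (grid_split r x) ?r \<rho>) (tens (grid_split s y) (grid_split r x) ?F F k) powr \<alpha>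
       * qf (grid (r ^ n * r) (x ^ n * x)) (tens (grid_split r x) (grid_split r x) ?s \<sigma>) (tens (grid_split s y) (grid_split r x) ?F F k) powr (1 - \<alpha>))
     = (\<Sum>k\<in>grid (s ^ n * s) (y ^ n * y). 
         (qf ?I ?r (?F (fst (grid_split s y k))) powr \<alpha> * qf ?I ?s (?F (fst (grid_split s y k))) powr (1 - \<alpha>)) *
         (qf ?J \<rho> (F (snd (grid_split s y k))) powr \<alpha> * qf ?J \<sigma> (F (snd (grid_split s y k))) powr (1 - \<alpha>)))"
    unfolding qf_tens[OF bij_grid_split h(1) h(3)] qf_tens[OF bij_grid_split h(2) h(4)] using nn by (intro sum.cong refl) (simp add: powr_mult)
  also have "\<dots> = (\<Sum>k\<in>grid (s ^ n) (y ^ n). qf ?I ?r (?F k) powr \<alpha> * qf ?I ?s (?F k) powr (1 - \<alpha>)) *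
      renyi_sum \<alpha> ?J \<rho> \<sigma> (grid s y) F"
    by (rule sum_split_prod[OF bij_grid_split, where ?h1.0 = "\<lambda>k. qf ?I ?r (?F k) powr \<alpha> * qf ?I ?s (?F k) powr (1 - \<alpha>)"
      and ?h2.0 = "\<lambda>k. qf ?J \<rho> (F k) powr \<alpha> * qf ?J \<sigma> (F k) powr (1 - \<alpha>)"])
  finally show ?case unfolding Suc by (simp add: power_Suc2 del: power_Suc)
qed

text \<open>The frame \<open>F\<close> plays the role of a rank-one POVM. Passing to tensor powers removes the factor lost in
  \<open>sandQ_lower_lossy\<close>.\<close>

lemma sandQ_lower:
  assumes a: "\<alpha> > 1" and Q: "sandQ \<alpha> (grid r x) \<rho> \<sigma> q D" and F: "contraction (grid r x) (grid s y) F"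
  shows "renyi_sum \<alpha> (grid r x) \<rho> \<sigma> (grid s y) F \<le> q"
proof (rule le_if_pow_le_subexp)
  show "0 \<le> renyi_sum \<alpha> (grid r x) \<rho> \<sigma> (grid s y) F"
    by (intro sum_nonneg) auto
  show q: "0 \<le> q" by (rule sandQ_nonneg[OF Q])
  fix n
  have "renyi_sum \<alpha> (grid r x) \<rho> \<sigma> (grid s y) F ^ n
     \<le> real (card (set_pow n D)) powr \<alpha> * q ^ n"
    unfolding renyi_sum_pow[OF sandQ_pos[OF Q], symmetric]
    by (rule sandQ_lower_lossy[OF a sandQ_pow[OF a Q] finite_grid contraction_pow[OF F]])
  also have "\<dots> \<le> real (n + 1) powr (real (card D) * \<alpha>) * q ^ n"
    using card_set_pow_powr[OF sandQ_finite(2)[OF Q]] a q by (intro mult_right_mono) auto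
  finally show "renyi_sum \<alpha> (grid r x) \<rho> \<sigma> (grid s y) F ^ n
     \<le> real (n + 1) powr (real (card D) * \<alpha>) * q ^ n" .
qed

text \<open>On n-th tensor powers pinching bounds \<open>q ^ n\<close>, up to a polynomial factor,
  by a classical sum in an eigenbasis of \<sigma>, and that sum is a lower bound for
  \<open>q' ^ n\<close>. The two values may come from different spectral decompositions.\<close>

lemma sandQ_mono: 
  assumes a: "\<alpha> > 1" and Q: "sandQ \<alpha> (grid r x) \<rho> \<sigma> q D" and Q': "sandQ \<alpha> (grid r x) \<rho> \<sigma> q' D'"
  shows "q \<le> q'"
proof (rule le_if_pow_le_subexp)
  show q: "0 \<le> q" by (rule sandQ_nonneg[OF Q])
  show q': "0 \<le> q'" by (rule sandQ_nonneg[OF Q'])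
  fix n
  let ?I = "grid (r ^ n) (x ^ n)"
  obtain e s where e: "onb ?I e" 
    and ev: "\<And>k i. k \<in> ?I \<Longrightarrow> i \<in> ?I \<Longrightarrow> ap ?I (tens_pow r x r x n \<sigma>) (e k) i = of_real (s k) * e k i"
    and le: "q ^ n \<le> real (card (set_pow n D)) powr \<alpha> * (\<Sum>k\<in>?I. qf ?I (tens_pow r x r x n \<rho>) (e k) powr \<alpha> * s k powr (1 - \<alpha>))"
    by (rule sandQ_pinch[OF a sandQ_pow[OF a Q]]) (rule that)
  note le
  also have "real (card (set_pow n D)) powr \<alpha> * (\<Sum>k\<in>?I. qf ?I (tens_pow r x r x n \<rho>) (e k) powr \<alpha> * s k powr (1 - \<alpha>))
     \<le> real (n + 1) powr (real (card D) * \<alpha>) * q' ^ n"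
    using sandQ_lower_eigenbasis[OF a sandQ_pow[OF a Q'] e ev] card_set_pow_powr[OF sandQ_finite(2)[OF Q]] a
    by (intro mult_mono) (auto intro!: sum_nonneg)
  finally show "q ^ n \<le> real (n + 1) powr (real (card D) * \<alpha>) * q' ^ n" .
qed

lemma sandQ_unique: 
  assumes "\<alpha> > 1" "sandQ \<alpha> (grid r x) \<rho> \<sigma> q D" "sandQ \<alpha> (grid r x) \<rho> \<sigma> q' D'"
  shows "q = q'"
  using sandQ_mono[OF assms] sandQ_mono[OF assms(1,3,2)] by simp

section \<open>Channels\<close>

definition pure :: "('a \<Rightarrow> complex) \<Rightarrow> 'a \<Rightarrow> 'a \<Rightarrow> complex" where
  "pure \<psi> = (\<lambda>i j. \<psi> i * cnj (\<psi> j))"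

text \<open>$(\mathcal I \otimes \mathcal N)(\rho)$ in terms of the Choi operator \<open>J\<close> of $\mathcal N$.\<close>

definition chan :: "nat \<Rightarrow> (nat \<times> nat) op \<Rightarrow> (nat \<times> nat) op \<Rightarrow> (nat \<times> nat) op" where
  "chan x J \<rho> = (\<lambda>i j. \<Sum>c<x. \<Sum>c'<x. \<rho> (fst i, c) (fst j, c') * J (c, snd i) (c', snd j))"

lemma sum_grid: "(\<Sum>i\<in>grid r x. g i) = (\<Sum>a<r. \<Sum>c<x. g (a,c))"
  unfolding grid_def by (simp add: sum.cartesian_product)

text \<open>The form of an output contracts the input with the Choi operator in one sixfold sum;
  this ordering and the next collect it into a form of the input or of the Choi operator.\<close>

lemma sum6_first:
  "(\<Sum>a\<in>A. \<Sum>y\<in>Y. \<Sum>b\<in>B. \<Sum>z\<in>Z. \<Sum>c\<in>C. \<Sum>d\<in>D. T a y b z c d)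
   = (\<Sum>a\<in>A. \<Sum>c\<in>C. \<Sum>b\<in>B. \<Sum>d\<in>D. \<Sum>y\<in>Y. \<Sum>z\<in>Z. T a y b z c d)"
  unfolding sum.cartesian_product
  by (rule sum.reindex_bij_witness[where i = "\<lambda>(a,c,b,d,y,z). (a,y,b,z,c,d)" and j = "\<lambda>(a,y,b,z,c,d). (a,c,b,d,y,z)"]) auto

lemma sum6_second:
  "(\<Sum>a\<in>A. \<Sum>y\<in>Y. \<Sum>b\<in>B. \<Sum>z\<in>Z. \<Sum>c\<in>C. \<Sum>d\<in>D. T a y b z c d)
   = (\<Sum>c\<in>C. \<Sum>y\<in>Y. \<Sum>d\<in>D. \<Sum>z\<in>Z. \<Sum>a\<in>A. \<Sum>b\<in>B. T a y b z c d)"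
  unfolding sum.cartesian_product
  by (rule sum.reindex_bij_witness[where i = "\<lambda>(c,y,d,z,a,b). (a,y,b,z,c,d)" and j = "\<lambda>(a,y,b,z,c,d). (c,y,d,z,a,b)"]) auto

lemma ip_ap_expand: "ip I u (ap I A v) = (\<Sum>i\<in>I. \<Sum>j\<in>I. cnj (u i) * A i j * v j)"
  unfolding ip_def ap_def by (simp add: sum_distrib_left mult.assoc)

lemma chan_expand: "ip (grid r y) u (ap (grid r y) (chan x J \<rho>) v) =
   (\<Sum>a<r. \<Sum>z<y. \<Sum>b<r. \<Sum>z'<y. \<Sum>c<x. \<Sum>c'<x. cnj (u (a,z)) * \<rho> (a,c) (b,c') * J (c,z) (c',z') * v (b,z'))"
  unfolding ip_ap_expand sum_grid chan_def by (simp add: sum_distrib_left sum_distrib_right mult.assoc)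

text \<open>A rank-one Choi operator has a single Kraus operator, with the entries of \<kappa>; the
  new vector is the image of \<open>u\<close> under its adjoint.\<close>

lemma chan_pure_left:
  "ip (grid r y) u (ap (grid r y) (chan x (pure \<kappa>) \<rho>) u) =
   ip (grid r x) (\<lambda>i. \<Sum>z<y. u (fst i, z) * cnj (\<kappa> (snd i, z))) (ap (grid r x) \<rho> (\<lambda>i. \<Sum>z<y. u (fst i, z) * cnj (\<kappa> (snd i, z))))"
  unfolding chan_expand
  by (subst sum6_first, unfold ip_ap_expand sum_grid pure_def, intro sum.cong refl) (simp add: sum_distrib_left sum_distrib_right mult_ac)

text \<open>For a pure input the roles are exchanged: the coefficients of \<psi> act on the
  reference index as an operator from R to X', and the form of the output becomes one of the Choi
  operator.\<close>

lemma chan_pure_right: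
  "ip (grid r y) u (ap (grid r y) (chan x J (pure \<psi>)) u) =
   ip (grid x y) (\<lambda>i. \<Sum>a<r. cnj (\<psi> (a, fst i)) * u (a, snd i)) (ap (grid x y) J (\<lambda>i. \<Sum>a<r. cnj (\<psi> (a, fst i)) * u (a, snd i)))"
  unfolding chan_expand
  by (subst sum6_second, unfold ip_ap_expand sum_grid pure_def, intro sum.cong refl) (simp add: sum_distrib_left sum_distrib_right mult_ac)

lemma qf_chan_pure: "qf (grid r y) (chan x J (pure \<psi>)) u = qf (grid x y) J (\<lambda>i. \<Sum>a<r. cnj (\<psi> (a, fst i)) * u (a, snd i))"
  unfolding qf_def chan_pure_right ..

lemma qf_pure: "qf I (pure \<psi>) v = (cmod (ip I \<psi> v))\<^sup>2"
proof -
  have "ip I v (ap I (pure \<psi>) v) = ip I v \<psi> * ip I \<psi> v"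
    unfolding ip_ap_expand pure_def by (simp add: ip_def sum_product mult_ac)
  then have "ip I v (ap I (pure \<psi>) v) = of_real ((cmod (ip I \<psi> v))\<^sup>2)"
    by (metis cnj_ip complex_norm_square mult.commute)
  then show ?thesis unfolding qf_def by simp
qed

lemma herm_pure: "herm I (pure \<psi>)" unfolding herm_def pure_def by simp

lemma pos_pure: "pos I (pure \<psi>)" unfolding pos_def qf_pure using herm_pure by auto

text \<open>Kraus decomposition: the eigenvectors of the Choi operator, weighted by its eigenvalues,
  are the Kraus operators. Positivity of outputs and monotonicity in the input are read off from
  this.\<close>

lemma qf_chan: assumes J: "spec (grid x y) J V j"
  shows "qf (grid r y) (chan x J \<rho>) u = (\<Sum>m\<in>grid x y. j m * qf (grid r x) \<rho> (\<lambda>i. \<Sum>z<y. u (fst i, z) * cnj (V m (snd i, z))))"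
proof -
  have lin: "chan x J \<rho> i k = (\<Sum>m\<in>grid x y. of_real (j m) * chan x (pure (V m)) \<rho> i k)" if "i \<in> grid r y" "k \<in> grid r y" for i k
  proof -
    have "chan x J \<rho> i k = (\<Sum>c<x. \<Sum>c'<x. \<Sum>m\<in>grid x y. of_real (j m) * (\<rho> (fst i, c) (fst k, c') * (V m (c, snd i) * cnj (V m (c', snd k)))))"
      unfolding chan_def
    proof (intro sum.cong refl)
      fix c c' assume "c \<in> {..<x}" "c' \<in> {..<x}"
      then have "J (c, snd i) (c', snd k) = spc (grid x y) V j (c, snd i) (c', snd k)"
        using J that unfolding spec_def grid_def by auto
      then show "\<rho> (fst i, c) (fst k, c') * J (c, snd i) (c', snd k) = (\<Sum>m\<in>grid x y. of_real (j m) * (\<rho> (fst i, c) (fst k, c') * (V m (c, snd i) * cnj (V m (c', snd k)))))"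
        by (simp add: spc_def sum_distrib_left mult_ac)
    qed
    also have "\<dots> = (\<Sum>c<x. \<Sum>m\<in>grid x y. \<Sum>c'<x. of_real (j m) * (\<rho> (fst i, c) (fst k, c') * (V m (c, snd i) * cnj (V m (c', snd k)))))"
      by (rule sum.cong[OF refl sum.swap])
    also have "\<dots> = (\<Sum>m\<in>grid x y. \<Sum>c<x. \<Sum>c'<x. of_real (j m) * (\<rho> (fst i, c) (fst k, c') * (V m (c, snd i) * cnj (V m (c', snd k)))))"
      by (rule sum.swap)
    finally show ?thesis unfolding chan_def pure_def sum_distrib_left .
  qed
  have "ip (grid r y) u (ap (grid r y) (chan x J \<rho>) u) = (\<Sum>i\<in>grid r y. \<Sum>k\<in>grid r y. \<Sum>m\<in>grid x y. of_real (j m) * (cnj (u i) * chan x (pure (V m)) \<rho> i k * u k))"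
    unfolding ip_ap_expand by (intro sum.cong refl) (simp add: lin sum_distrib_left sum_distrib_right mult_ac)
  also have "\<dots> = (\<Sum>i\<in>grid r y. \<Sum>m\<in>grid x y. \<Sum>k\<in>grid r y. of_real (j m) * (cnj (u i) * chan x (pure (V m)) \<rho> i k * u k))"
    by (rule sum.cong[OF refl sum.swap])
  also have "\<dots> = (\<Sum>m\<in>grid x y. \<Sum>i\<in>grid r y. \<Sum>k\<in>grid r y. of_real (j m) * (cnj (u i) * chan x (pure (V m)) \<rho> i k * u k))"
    by (rule sum.swap)
  also have "\<dots> = (\<Sum>m\<in>grid x y. of_real (j m) * ip (grid r y) u (ap (grid r y) (chan x (pure (V m)) \<rho>) u))"
    unfolding ip_ap_expand sum_distrib_left ..
  finally show ?thesis unfolding qf_def chan_pure_left by simp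
qed

lemma hermD: "herm I A \<Longrightarrow> i \<in> I \<Longrightarrow> j \<in> I \<Longrightarrow> A j i = cnj (A i j)"
  unfolding herm_def by blast

lemma herm_chan: assumes "herm (grid r x) \<rho>" "herm (grid x y) J" shows "herm (grid r y) (chan x J \<rho>)"
  unfolding herm_def
proof (intro ballI)
  fix i j assume ij: "i \<in> grid r y" "j \<in> grid r y"
  have "cnj (chan x J \<rho> i j) = (\<Sum>c<x. \<Sum>c'<x. \<rho> (fst j, c') (fst i, c) * J (c', snd j) (c, snd i))"
    unfolding chan_def cnj_sum
  proof (intro sum.cong refl)
    fix c c' assume c: "c \<in> {..<x}" "c' \<in> {..<x}"
    have "\<rho> (fst j, c') (fst i, c) = cnj (\<rho> (fst i, c) (fst j, c'))" 
      "J (c', snd j) (c, snd i) = cnj (J (c, snd i) (c', snd j))"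
      using c ij by (auto intro!: hermD[OF assms(1)] hermD[OF assms(2)] simp: grid_def)
    then show "cnj (\<rho> (fst i, c) (fst j, c') * J (c, snd i) (c', snd j)) = \<rho> (fst j, c') (fst i, c) * J (c', snd j) (c, snd i)"
      by simp
  qed
  also have "\<dots> = chan x J \<rho> j i" unfolding chan_def by (rule sum.swap)
  finally show "chan x J \<rho> j i = cnj (chan x J \<rho> i j)" by simp
qed

lemma pos_chan: assumes "pos (grid r x) \<rho>" "pos (grid x y) J" shows "pos (grid r y) (chan x J \<rho>)"
proof -
  obtain V j where V: "spec (grid x y) J V j" "\<And>k. k \<in> grid x y \<Longrightarrow> 0 \<le> j k" using pos_spectral[OF finite_grid assms(2)] by blast
  have "0 \<le> qf (grid r y) (chan x J \<rho>) u" for u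
    unfolding qf_chan[OF V(1)] using assms(1) V(2) unfolding pos_def by (auto intro!: sum_nonneg)
  then show ?thesis using herm_chan assms unfolding pos_def by blast
qed

text \<open>The map preserves the domination of \<rho> by a mixture of pure states: each Kraus term
  respects it and the weights \<open>j m\<close> are nonnegative.\<close>

lemma qf_chan_le: assumes J: "pos (grid x y) J" and le: "\<And>v. qf (grid r x) \<rho> v \<le> N * (\<Sum>k\<in>K. t k * (cmod (ip (grid r x) (e k) v))\<^sup>2)"
  shows "qf (grid r y) (chan x J \<rho>) u \<le> N * (\<Sum>k\<in>K. t k * qf (grid r y) (chan x J (pure (e k))) u)"
proof -
  obtain V j where V: "spec (grid x y) J V j" "\<And>k. k \<in> grid x y \<Longrightarrow> 0 \<le> j k" using pos_spectral[OF finite_grid J] by blast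
  let ?w = "\<lambda>m i. \<Sum>z<y. u (fst i, z) * cnj (V m (snd i, z))"
  have "qf (grid r y) (chan x J \<rho>) u \<le> (\<Sum>m\<in>grid x y. j m * (N * (\<Sum>k\<in>K. t k * (cmod (ip (grid r x) (e k) (?w m)))\<^sup>2)))"
    unfolding qf_chan[OF V(1)] using V(2) le by (intro sum_mono mult_left_mono) auto
  also have "\<dots> = N * (\<Sum>m\<in>grid x y. \<Sum>k\<in>K. t k * (j m * (cmod (ip (grid r x) (e k) (?w m)))\<^sup>2))"
    by (simp add: sum_distrib_left mult_ac)
  also have "(\<Sum>m\<in>grid x y. \<Sum>k\<in>K. t k * (j m * (cmod (ip (grid r x) (e k) (?w m)))\<^sup>2)) = (\<Sum>k\<in>K. t k * qf (grid r y) (chan x J (pure (e k))) u)"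
    unfolding qf_chan[OF V(1)] qf_pure sum_distrib_left by (rule sum.swap)
  finally show ?thesis .
qed

lemma qf_chan_spec: assumes J: "pos (grid x y) J" and s: "spec (grid r x) \<sigma> e s"
  shows "qf (grid r y) (chan x J \<sigma>) u = (\<Sum>k\<in>grid r x. s k * qf (grid r y) (chan x J (pure (e k))) u)"
proof -
  obtain V j where V: "spec (grid x y) J V j" using pos_spectral[OF finite_grid J] by blast
  show ?thesis unfolding qf_chan[OF V] qf_pure spec_qf[OF s] sum_distrib_left 
    by (subst sum.swap) (intro sum.cong refl, simp)
qed

text \<open>One constant for all normalized pure inputs and all output bases at a fixed reference
  dimension. The kernel clause carries what the sums cannot show, because 0 powr (1 - \<alpha>) = 0
  hides an infinite divergence.\<close>

definition pure_bound :: "real \<Rightarrow> nat \<Rightarrow> nat \<Rightarrow> nat \<Rightarrow> (nat \<times> nat) op \<Rightarrow> (nat \<times> nat) op \<Rightarrow> real \<Rightarrow> bool" where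
  "pure_bound \<alpha> r x y J K B \<longleftrightarrow> (\<forall>\<psi>. nrm2 (grid r x) \<psi> = 1 \<longrightarrow>
     (\<forall>v. qf (grid r y) (chan x K (pure \<psi>)) v = 0 \<longrightarrow> qf (grid r y) (chan x J (pure \<psi>)) v = 0) \<and>
     (\<forall>e. onb (grid r y) e \<longrightarrow> renyi_sum \<alpha> (grid r y) (chan x J (pure \<psi>)) (chan x K (pure \<psi>)) (grid r y) e \<le> B))"

text \<open>If \<open>v\<close> is null for the output of \<sigma>, each eigenvector of \<sigma>
  either has weight 0, hence weight 0 in \<rho> too, or has outputs for which \<open>v\<close> is
  null under both channels. Pinching dominates \<rho> by these eigenvectors.\<close>

lemma chain_kernel: 
  assumes a: "\<alpha> > 1" and Q: "sandQ \<alpha> (grid r x) \<rho> \<sigma> q D" and J: "pos (grid x y) J" and K: "pos (grid x y) K"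
    and B: "pure_bound \<alpha> r x y J K B" and v: "qf (grid r y) (chan x K \<sigma>) v = 0"
  shows "qf (grid r y) (chan x J \<rho>) v = 0"
proof -
  obtain e s where e: "onb (grid r x) e" and sp: "spec (grid r x) \<sigma> e s" 
    and s0: "\<And>k. k \<in> grid r x \<Longrightarrow> 0 \<le> s k" 
    and le: "\<And>v. qf (grid r x) \<rho> v \<le> real (card D) * (\<Sum>k\<in>grid r x. qf (grid r x) \<rho> (e k) * (cmod (ip (grid r x) (e k) v))\<^sup>2)"
    by (rule sandQ_pinch[OF a Q]) (rule that)
  have nn: "0 \<le> qf (grid r y) (chan x K (pure \<psi>)) u" for \<psi> u
    using pos_chan[OF pos_pure K] unfolding pos_def by blast
  have "\<forall>k\<in>grid r x. s k * qf (grid r y) (chan x K (pure (e k))) v = 0"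
    using v s0 nn unfolding qf_chan_spec[OF K sp] by (subst (asm) sum_nonneg_eq_0_iff) (auto simp: finite_grid)
  then have "qf (grid r x) \<rho> (e k) * qf (grid r y) (chan x J (pure (e k))) v = 0" if "k \<in> grid r x" for k
  proof (cases "s k = 0")
    case True
    then show ?thesis using sandQ_kernel[OF Q, of "e k"] spec_qf_basis[OF sp finite_grid that] by simp
  next
    case False
    then have "qf (grid r y) (chan x K (pure (e k))) v = 0"
      using bspec[OF \<open>\<forall>k\<in>grid r x. s k * qf (grid r y) (chan x K (pure (e k))) v = 0\<close> that] by simp
    then show ?thesis using B onb_nrm2[OF e that] unfolding pure_bound_def by simp
  qed
  then have "qf (grid r y) (chan x J \<rho>) v \<le> 0"
    using qf_chan_le[OF J le, of v] by simp
  moreover have "0 \<le> qf (grid r y) (chan x J \<rho>) v" using pos_chan[OF sandQ_pos(1)[OF Q] J] unfolding pos_def by blast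
  ultimately show ?thesis by simp
qed

text \<open>Two pinchings are paid: the input one replaces \<rho> by a mixture of the
  \<open>e i\<close> (factor from \<open>D\<close>), the output one reduces \<open>q'\<close> to
  weights in the basis \<open>f\<close> (factor from \<open>D'\<close>). \<open>powr_mixture\<close>
  separates the input weights, bounded by \<open>q\<close>, from the images of the pure states,
  bounded by \<open>B\<close>.\<close>

lemma chain_rule_lossy:
  assumes a: "\<alpha> > 1" and Q: "sandQ \<alpha> (grid r x) \<rho> \<sigma> q D" and J: "pos (grid x y) J" and K: "pos (grid x y) K"
    and B: "pure_bound \<alpha> r x y J K B" and B0: "0 \<le> B"
    and Q': "sandQ \<alpha> (grid r y) (chan x J \<rho>) (chan x K \<sigma>) q' D'"
  shows "q' \<le> real (card D') powr \<alpha> * real (card D) powr \<alpha> * (q * B)"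
proof -
  let ?I = "grid r x" and ?O = "grid r y"
  obtain e s where e: "onb ?I e" and sp: "spec ?I \<sigma> e s" 
    and ev: "\<And>k i. k \<in> ?I \<Longrightarrow> i \<in> ?I \<Longrightarrow> ap ?I \<sigma> (e k) i = of_real (s k) * e k i"
    and s0: "\<And>k. k \<in> ?I \<Longrightarrow> 0 \<le> s k" 
    and le: "\<And>v. qf ?I \<rho> v \<le> real (card D) * (\<Sum>k\<in>?I. qf ?I \<rho> (e k) * (cmod (ip ?I (e k) v))\<^sup>2)"
    by (rule sandQ_pinch[OF a Q]) (rule that)
  obtain f s' where f: "onb ?O f" and sp': "spec ?O (chan x K \<sigma>) f s'" 
    and le': "q' \<le> real (card D') powr \<alpha> * (\<Sum>k\<in>?O. qf ?O (chan x J \<rho>) (f k) powr \<alpha> * s' k powr (1 - \<alpha>))"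
    by (rule sandQ_pinch[OF a Q']) (rule that)
  define t where "t k = qf ?I \<rho> (e k)" for k
  define N where "N = real (card D)"
  define A where "A k i = qf ?O (chan x J (pure (e i))) (f k)" for k i
  define C where "C k i = qf ?O (chan x K (pure (e i))) (f k)" for k i
  have t0: "0 \<le> t k" for k using sandQ_pos(1)[OF Q] unfolding pos_def t_def by blast
  have A0: "0 \<le> A k i" for k i unfolding A_def using pos_chan[OF pos_pure J] unfolding pos_def by blast
  have C0: "0 \<le> C k i" for k i unfolding C_def using pos_chan[OF pos_pure K] unfolding pos_def by blast
  have ts: "t i = 0" if "i \<in> ?I" "s i = 0" for i
    using sandQ_kernel[OF Q, of "e i"] spec_qf_basis[OF sp finite_grid that(1)] that unfolding t_def by simp
  have AC: "A k i = 0" if "i \<in> ?I" "C k i = 0" for k i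
    using B onb_nrm2[OF e that(1)] that(2) unfolding pure_bound_def A_def C_def by blast
  have jl: "qf ?O (chan x J \<rho>) (f k) \<le> N * (\<Sum>i\<in>?I. t i * A k i)" for k
    unfolding N_def t_def A_def by (rule qf_chan_le[OF J le])
  have jk: "s' k = (\<Sum>i\<in>?I. s i * C k i)" if "k \<in> ?O" for k
    using spec_qf_basis[OF sp' finite_grid that] unfolding C_def qf_chan_spec[OF K sp] by simp
  have j0: "0 \<le> qf ?O (chan x J \<rho>) (f k)" for k
    using pos_chan[OF sandQ_pos(1)[OF Q] J] unfolding pos_def by blast
  have AB: "(\<Sum>k\<in>?O. A k i powr \<alpha> * C k i powr (1 - \<alpha>)) \<le> B" if "i \<in> ?I" for i
    using B f onb_nrm2[OF e that] unfolding pure_bound_def A_def C_def by blast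
  have "(\<Sum>k\<in>?O. qf ?O (chan x J \<rho>) (f k) powr \<alpha> * s' k powr (1 - \<alpha>)) \<le> N powr \<alpha> * ((\<Sum>i\<in>?I. t i powr \<alpha> * s i powr (1 - \<alpha>)) * B)"
    by (rule powr_mixture[OF a finite_grid _ t0 s0 ts A0 C0 AC j0 jl jk AB]) (simp_all add: N_def)
  also have "\<dots> \<le> N powr \<alpha> * (q * B)"
    using sandQ_lower_eigenbasis[OF a Q e ev] B0 unfolding t_def by (intro mult_left_mono mult_right_mono) auto
  finally have "real (card D') powr \<alpha> * (\<Sum>k\<in>?O. qf ?O (chan x J \<rho>) (f k) powr \<alpha> * s' k powr (1 - \<alpha>)) \<le> real (card D') powr \<alpha> * (N powr \<alpha> * (q * B))"
    by (intro mult_left_mono) auto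
  then show ?thesis using le' unfolding N_def by (simp add: mult_ac)
qed

text \<open>The operator is the Gram matrix of the columns of \<psi>, that is, the marginal of
  \<psi> on X up to transposition.\<close>

lemma qf_gram:
  "qf {..<x} (\<lambda>c c'. \<Sum>a<r. cnj (\<psi> (a,c)) * \<psi> (a,c')) z = (\<Sum>a<r. (cmod (\<Sum>c<x. \<psi> (a,c) * z c))\<^sup>2)"
proof -
  have "ip {..<x} z (ap {..<x} (\<lambda>c c'. \<Sum>a<r. cnj (\<psi> (a,c)) * \<psi> (a,c')) z) = (\<Sum>c<x. \<Sum>c'<x. \<Sum>a<r. cnj (\<psi> (a,c) * z c) * (\<psi> (a,c') * z c'))"
    unfolding ip_ap_expand by (simp add: sum_distrib_left sum_distrib_right mult_ac)
  also have "\<dots> = (\<Sum>c<x. \<Sum>a<r. \<Sum>c'<x. cnj (\<psi> (a,c) * z c) * (\<psi> (a,c') * z c'))"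
    by (rule sum.cong[OF refl sum.swap])
  also have "\<dots> = (\<Sum>a<r. \<Sum>c<x. \<Sum>c'<x. cnj (\<psi> (a,c) * z c) * (\<psi> (a,c') * z c'))" by (rule sum.swap)
  also have "\<dots> = (\<Sum>a<r. of_real ((cmod (\<Sum>c<x. \<psi> (a,c) * z c))\<^sup>2))"
  proof (intro sum.cong refl)
    fix a
    have "(\<Sum>c<x. \<Sum>c'<x. cnj (\<psi> (a,c) * z c) * (\<psi> (a,c') * z c')) = (\<Sum>c<x. \<psi> (a,c) * z c) * cnj (\<Sum>c<x. \<psi> (a,c) * z c)"
      unfolding cnj_sum sum_product[symmetric] by (rule mult.commute)
    then show "(\<Sum>c<x. \<Sum>c'<x. cnj (\<psi> (a,c) * z c) * (\<psi> (a,c') * z c')) = of_real ((cmod (\<Sum>c<x. \<psi> (a,c) * z c))\<^sup>2)"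
      unfolding complex_norm_square .
  qed
  finally show ?thesis unfolding qf_def by simp
qed

text \<open>The vectors \<open>F (e k)\<close> below are $\omega^{-1/2} V^* e_k$, where $\psi = V\Phi$ and $\omega = V^* V$.\<close>

lemma pure_input_bound:
  assumes a: "\<alpha> > 1" and J: "pos (grid x y) J" and K: "pos (grid x y) K"
    and om: "spec {..<x} (\<lambda>c c'. \<Sum>a<r. cnj (\<psi> (a,c)) * \<psi> (a,c')) U d" and d0: "\<And>k. k < x \<Longrightarrow> 0 \<le> d k"
    and L: "\<And>c c'. c < x \<Longrightarrow> c' < x \<Longrightarrow> L c c' = spc {..<x} U (\<lambda>k. sqrt (d k)) c c'"
    and Q: "sandQ \<alpha> (grid x y) (chan x J (pure (\<lambda>i. L (fst i) (snd i)))) (chan x K (pure (\<lambda>i. L (fst i) (snd i)))) q D"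
  shows "qf (grid r y) (chan x K (pure \<psi>)) v = 0 \<Longrightarrow> qf (grid r y) (chan x J (pure \<psi>)) v = 0"
    and "onb (grid r y) e \<Longrightarrow> renyi_sum \<alpha> (grid r y) (chan x J (pure \<psi>)) (chan x K (pure \<psi>)) (grid r y) e \<le> q"
proof -
  let ?X = "{..<x}"
  define \<omega> where "\<omega> c c' = (\<Sum>a<r. cnj (\<psi> (a,c)) * \<psi> (a,c'))" for c c'
  have sp: "spec ?X \<omega> U d" using om unfolding \<omega>_def .
  note onbU = spec_onb[OF sp]
  define g where "g k = (if d k = 0 then 0 else 1 / sqrt (d k))" for k
  define Li where "Li = spc ?X U g"
  define w where "w u z c = (\<Sum>a<r. cnj (\<psi> (a, c)) * u (a, z))" for u :: "nat \<times> nat \<Rightarrow> complex" and z c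
  define F where "F u i = ap ?X Li (w u (snd i)) (fst i)" for u i
  have qfo: "qf ?X \<omega> z = (\<Sum>a<r. (cmod (\<Sum>c<x. \<psi> (a,c) * z c))\<^sup>2)" for z
    using qf_gram[where x = x and r = r and \<psi> = \<psi> and z = z] unfolding \<omega>_def .
  \<comment> \<open>\<open>w u z\<close> is the adjoint of V applied to a slice of \<open>u\<close>.
    A null vector of \<omega> is annihilated by V and hence orthogonal to \<open>w u z\<close>, so
    on this vector the generalized inverse root \<open>Li\<close> is a true inverse.\<close>
  have ipw0: "ip ?X (U k) (w u z) = 0" if k: "k < x" "d k = 0" for k u z
  proof -
    have "qf ?X \<omega> (U k) = 0" using spec_qf_basis[OF sp] k by simp
    then have "\<forall>a<r. (\<Sum>c<x. \<psi> (a,c) * U k c) = 0"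
      unfolding qfo by (subst (asm) sum_nonneg_eq_0_iff) auto
    then have n: "(\<Sum>c<x. cnj (U k c) * cnj (\<psi> (a,c))) = 0" if "a < r" for a
    proof -
      have "(\<Sum>c<x. cnj (U k c) * cnj (\<psi> (a,c))) = cnj (\<Sum>c<x. \<psi> (a,c) * U k c)" by (simp add: mult.commute)
      then show ?thesis using \<open>\<forall>a<r. (\<Sum>c<x. \<psi> (a,c) * U k c) = 0\<close> that by simp
    qed
    have "ip ?X (U k) (w u z) = (\<Sum>c<x. \<Sum>a<r. cnj (U k c) * cnj (\<psi> (a,c)) * u (a,z))"
      unfolding ip_def w_def by (simp add: sum_distrib_left mult_ac)
    also have "\<dots> = (\<Sum>a<r. \<Sum>c<x. cnj (U k c) * cnj (\<psi> (a,c)) * u (a,z))" by (rule sum.swap)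
    also have "\<dots> = (\<Sum>a<r. (\<Sum>c<x. cnj (U k c) * cnj (\<psi> (a,c))) * u (a,z))" by (simp add: sum_distrib_right)
    also have "\<dots> = 0" using n by (intro sum.neutral) auto
    finally show ?thesis .
  qed
  have LLi: "ap ?X L (ap ?X Li (w u z)) c = w u z c" if c: "c < x" for u z c
  proof -
    have "ap ?X L (ap ?X Li (w u z)) c = ap ?X (spc ?X U (\<lambda>k. sqrt (d k))) (ap ?X Li (w u z)) c"
      by (rule ap_cong) (auto simp: L c)
    also have "\<dots> = (\<Sum>k<x. ip ?X (U k) (w u z) * U k c)"
      unfolding Li_def ap_spc_spc[OF onbU finite_lessThan] unfolding ap_spc
    proof (intro sum.cong refl)
      fix k assume "k \<in> {..<x}"
      then show "of_real (sqrt (d k) * g k) * ip ?X (U k) (w u z) * U k c = ip ?X (U k) (w u z) * U k c"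
        using ipw0[of k u z] by (cases "d k = 0") (auto simp: g_def)
    qed
    also have "\<dots> = w u z c" using onb_expand[OF onbU, of c "w u z"] c by simp
    finally show ?thesis .
  qed
  have Lh: "cnj (L a c) = L c a" if "a < x" "c < x" for a c
    unfolding L[OF that] L[OF that(2,1)] by (rule hermD[OF herm_spc, symmetric]) (use that in auto)
  \<comment> \<open>Replacing \<psi> by the vector of \<omega>^(1/2) and \<open>u\<close> by
    \<open>F u\<close> leaves the output form unchanged for every Choi operator \<open>M\<close>, so
    for both channels at once.\<close>
  have qfF: "qf (grid x y) (chan x M (pure (\<lambda>i. L (fst i) (snd i)))) (F u) = qf (grid r y) (chan x M (pure \<psi>)) u" for M u
    unfolding qf_chan_pure
  proof (rule qf_cong)
    fix i assume i: "i \<in> grid x y"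
    have "(\<Sum>a<x. cnj (L (fst (a, fst i)) (snd (a, fst i))) * F u (a, snd i)) = ap ?X L (ap ?X Li (w u (snd i))) (fst i)"
      unfolding ap_def[of _ L] F_def using i by (intro sum.cong) (auto simp: Lh grid_def)
    also have "\<dots> = w u (snd i) (fst i)" using i by (intro LLi) (auto simp: grid_def)
    finally show "(\<Sum>a<x. cnj (L (fst (a, fst i)) (snd (a, fst i))) * F u (a, snd i)) = (\<Sum>a<r. cnj (\<psi> (a, fst i)) * u (a, snd i))"
      unfolding w_def .
  qed simp
  show "qf (grid r y) (chan x K (pure \<psi>)) v = 0 \<Longrightarrow> qf (grid r y) (chan x J (pure \<psi>)) v = 0"
    using sandQ_kernel[OF Q, of "F v"] unfolding qfF .
  assume e: "onb (grid r y) e"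
  \<comment> \<open>The adjoint of \<open>F\<close>; by Parseval the contraction property becomes a
    bound on the norm of \<open>G v\<close>.\<close>
  define G where "G v i = (\<Sum>c<x. \<psi> (fst i, c) * ap ?X Li (\<lambda>c. v (c, snd i)) c)"
    for v :: "nat \<times> nat \<Rightarrow> complex" and i :: "nat \<times> nat"
  have ipF: "ip (grid x y) (F u) v = ip (grid r y) u (G v)" for u v
  proof -
    have "ip (grid x y) (F u) v = (\<Sum>z<y. ip ?X (ap ?X Li (w u z)) (\<lambda>c. v (c, z)))"
      unfolding ip_def sum_grid F_def fst_conv snd_conv by (rule sum.swap)
    also have "\<dots> = (\<Sum>z<y. ip ?X (w u z) (ap ?X Li (\<lambda>c. v (c, z))))"
      unfolding Li_def by (subst herm_ip[OF herm_spc]) (rule refl)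
    also have "\<dots> = (\<Sum>z<y. \<Sum>c<x. \<Sum>a<r. cnj (u (a,z)) * (\<psi> (a,c) * ap ?X Li (\<lambda>c. v (c, z)) c))"
      unfolding ip_def w_def by (simp add: sum_distrib_left sum_distrib_right mult_ac)
    also have "\<dots> = (\<Sum>z<y. \<Sum>a<r. \<Sum>c<x. cnj (u (a,z)) * (\<psi> (a,c) * ap ?X Li (\<lambda>c. v (c, z)) c))"
      by (rule sum.cong[OF refl sum.swap])
    also have "\<dots> = (\<Sum>a<r. \<Sum>z<y. \<Sum>c<x. cnj (u (a,z)) * (\<psi> (a,c) * ap ?X Li (\<lambda>c. v (c, z)) c))" by (rule sum.swap)
    finally show ?thesis unfolding ip_def sum_grid G_def by (simp add: sum_distrib_left)
  qed
  have "contraction (grid x y) (grid r y) (\<lambda>k. F (e k))"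
    unfolding contraction_def
  proof
    fix v :: "nat \<times> nat \<Rightarrow> complex"
    have "(\<Sum>k\<in>grid r y. (cmod (ip (grid x y) (F (e k)) v))\<^sup>2) = nrm2 (grid r y) (G v)"
      unfolding ipF by (rule parseval[OF e finite_grid])
    also have "\<dots> = (\<Sum>z<y. qf ?X \<omega> (ap ?X Li (\<lambda>c. v (c, z))))"
      unfolding qfo nrm2_def sum_grid G_def fst_conv snd_conv by (rule sum.swap)
    also have "\<dots> \<le> (\<Sum>z<y. nrm2 ?X (\<lambda>c. v (c, z)))"
    proof (rule sum_mono)
      fix z
      have "qf ?X \<omega> (ap ?X Li (\<lambda>c. v (c, z))) = (\<Sum>k<x. d k * (cmod (of_real (g k) * ip ?X (U k) (\<lambda>c. v (c, z))))\<^sup>2)"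
        unfolding spec_qf[OF sp] Li_def by (intro sum.cong refl) (simp add: ip_spc[OF onbU])
      also have "\<dots> \<le> (\<Sum>k<x. (cmod (ip ?X (U k) (\<lambda>c. v (c, z))))\<^sup>2)"
      proof (rule sum_mono)
        fix k assume "k \<in> {..<x}"
        then have "d k * (g k)\<^sup>2 \<le> 1" using d0[of k] by (auto simp: g_def power_divide)
        then have "d k * (g k)\<^sup>2 * (cmod (ip ?X (U k) (\<lambda>c. v (c, z))))\<^sup>2 \<le> 1 * (cmod (ip ?X (U k) (\<lambda>c. v (c, z))))\<^sup>2"
          by (intro mult_right_mono) auto
        then show "d k * (cmod (of_real (g k) * ip ?X (U k) (\<lambda>c. v (c, z))))\<^sup>2 \<le> (cmod (ip ?X (U k) (\<lambda>c. v (c, z))))\<^sup>2"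
          by (simp add: norm_mult power_mult_distrib mult.assoc)
      qed
      also have "\<dots> = nrm2 ?X (\<lambda>c. v (c, z))" by (rule parseval[OF onbU finite_lessThan])
      finally show "qf ?X \<omega> (ap ?X Li (\<lambda>c. v (c, z))) \<le> nrm2 ?X (\<lambda>c. v (c, z))" .
    qed
    also have "\<dots> = nrm2 (grid x y) v" unfolding nrm2_def sum_grid by (rule sum.swap)
    finally show "(\<Sum>k\<in>grid r y. (cmod (ip (grid x y) (F (e k)) v))\<^sup>2) \<le> nrm2 (grid x y) v" .
  qed
  from sandQ_lower[OF a Q this] show "renyi_sum \<alpha> (grid r y) (chan x J (pure \<psi>)) (chan x K (pure \<psi>)) (grid r y) e \<le> q"
    unfolding qfF .
qed

section \<open>Tensor powers of channels\<close>

lemma bij_divmod: "bij_betw (\<lambda>c. (c div x, c mod x)) {..<n * x} ({..<n} \<times> {..<x::nat})"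
proof (rule bij_betw_byWitness[where f' = "\<lambda>(a,b). a * x + b"])
  show "(\<lambda>c. (c div x, c mod x)) ` {..<n * x} \<subseteq> {..<n} \<times> {..<x}" using div_mod_less by auto
qed (auto simp: mult_add_less)

lemma sum_divmod: "(\<Sum>c<n * x. g (c div x) (c mod x)) = (\<Sum>a<n. \<Sum>b<x. g a b)" for x :: nat
  using sum_split[OF bij_divmod, where h = g] by simp

lemma sum2_divmod: fixes u :: "nat \<Rightarrow> nat \<Rightarrow> 'a::comm_semiring_0"
  shows "(\<Sum>c<n * x. \<Sum>c'<n * x. u (c div x) (c' div x) * v (c mod x) (c' mod x))
   = (\<Sum>c<n. \<Sum>c'<n. u c c') * (\<Sum>c<x. \<Sum>c'<x. v c c')"
proof -
  have "(\<Sum>c'<n * x. u a (c' div x) * v b (c' mod x)) = (\<Sum>c'<n. u a c') * (\<Sum>c'<x. v b c')" for a b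
    unfolding sum_divmod[of "\<lambda>c c'. u a c * v b c'"] by (simp add: sum_product)
  then show ?thesis 
    using sum_divmod[of "\<lambda>a b. (\<Sum>c'<n. u a c') * (\<Sum>c'<x. v b c')" x n] by (simp add: sum_product)
qed

lemma chan_tens: "chan (x' * x) (tens (grid_split x y) (grid_split x y) J' J) (tens (grid_split r x) (grid_split r x) \<rho>' \<rho>) = 
   tens (grid_split r y) (grid_split r y) (chan x' J' \<rho>') (chan x J \<rho>)"
proof (intro ext)
  fix i j
  let ?u = "\<lambda>c c'. \<rho>' (fst i div r, c) (fst j div r, c') * J' (c, snd i div y) (c', snd j div y)"
  let ?v = "\<lambda>c c'. \<rho> (fst i mod r, c) (fst j mod r, c') * J (c, snd i mod y) (c', snd j mod y)"
  have "chan (x' * x) (tens (grid_split x y) (grid_split x y) J' J) (tens (grid_split r x) (grid_split r x) \<rho>' \<rho>) i j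
    = (\<Sum>c<x' * x. \<Sum>c'<x' * x. ?u (c div x) (c' div x) * ?v (c mod x) (c' mod x))"
    unfolding chan_def tens_def grid_split_def by (simp add: mult_ac)
  also have "\<dots> = tens (grid_split r y) (grid_split r y) (chan x' J' \<rho>') (chan x J \<rho>) i j"
    unfolding sum2_divmod[of ?u x ?v x'] unfolding chan_def tens_def grid_split_def by simp
  finally show "chan (x' * x) (tens (grid_split x y) (grid_split x y) J' J) (tens (grid_split r x) (grid_split r x) \<rho>' \<rho>) i j
     = tens (grid_split r y) (grid_split r y) (chan x' J' \<rho>') (chan x J \<rho>) i j" .
qed

lemma chan_pow: "chan (x ^ n) (tens_pow x y x y n J) (tens_pow r x r x n \<rho>) = tens_pow r y r y n (chan x J \<rho>)"
proof (induction n)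
  case 0 show ?case by (simp add: chan_def)
next
  case (Suc n)
  show ?case unfolding power_Suc2 tens_pow.simps chan_tens Suc ..
qed

text \<open>The lossy rule for n-th powers, on which the product channel acts factorwise. The
  exponent of n + 1 depends only on \<open>D\<close>, \<open>D'\<close> and \<alpha>, so it
  disappears after division by n.\<close>

lemma chain_rule_pow:
  assumes a: "\<alpha> > 1" and Q: "sandQ \<alpha> (grid r x) \<rho> \<sigma> q D" and J: "pos (grid x y) J" and K: "pos (grid x y) K"
    and Q': "sandQ \<alpha> (grid r y) (chan x J \<rho>) (chan x K \<sigma>) q' D'"
    and B: "pure_bound \<alpha> (r ^ n) (x ^ n) (y ^ n) (tens_pow x y x y n J) (tens_pow x y x y n K) B" and B0: "0 \<le> B"
  shows "q' ^ n \<le> real (n + 1) powr (real (card D') * \<alpha> + real (card D) * \<alpha>) * (q ^ n * B)"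
proof -
  have "q' ^ n \<le> real (card (set_pow n D')) powr \<alpha> * real (card (set_pow n D)) powr \<alpha> * (q ^ n * B)"
    by (rule chain_rule_lossy[OF a sandQ_pow[OF a Q] pos_pow[OF J] pos_pow[OF K] B B0])
      (use sandQ_pow[OF a Q'] in \<open>simp add: chan_pow\<close>)
  also have "\<dots> \<le> (real (n + 1) powr (real (card D') * \<alpha>) * real (n + 1) powr (real (card D) * \<alpha>)) * (q ^ n * B)"
    using card_set_pow_powr[OF sandQ_finite(2)[OF Q]] card_set_pow_powr[OF sandQ_finite(2)[OF Q']] a B0 sandQ_nonneg[OF Q]
    by (intro mult_right_mono mult_mono) auto
  finally show ?thesis by (simp add: powr_add)
qed

lemma qf_pow: assumes "pos (grid r x) A"
  shows "qf (grid (r ^ n) (x ^ n)) (tens_pow r x r x n A) (tens_pow s y r x n (\<lambda>_. v) k) = qf (grid r x) A v ^ n"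
proof (induction n arbitrary: k)
  case 0 show ?case by (simp add: grid_one qf_def ip_def ap_def)
next
  case (Suc n)
  have h: "herm (grid r x) A" "herm (grid (r ^ n) (x ^ n)) (tens_pow r x r x n A)"
    using assms pos_pow[OF assms] unfolding pos_def by auto
  show ?case unfolding power_Suc2 tens_pow.simps qf_tens[OF bij_grid_split h(2,1)] Suc ..
qed

text \<open>Test on the n-fold product vector: its forms are n-th powers of the forms at
  \<open>v\<close>. For n = 0 they would be 1 instead of 0, hence n > 0.\<close>

lemma kernel_pow:
  assumes a: "\<alpha> > 1" and Q: "sandQ \<alpha> (grid r x) \<rho> \<sigma> q D" and J: "pos (grid x y) J" and K: "pos (grid x y) K"
    and B: "pure_bound \<alpha> (r ^ n) (x ^ n) (y ^ n) (tens_pow x y x y n J) (tens_pow x y x y n K) B" and n: "n > 0"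
    and v: "qf (grid r y) (chan x K \<sigma>) v = 0"
  shows "qf (grid r y) (chan x J \<rho>) v = 0"
proof -
  \<comment> \<open>A product vector is a \<open>tens_pow\<close> family with the single label
    (0,0).\<close>
  let ?v = "tens_pow 1 1 r y n (\<lambda>_. v) (0,0)"
  have "qf (grid (r ^ n) (y ^ n)) (chan (x ^ n) (tens_pow x y x y n K) (tens_pow r x r x n \<sigma>)) ?v = 0"
    unfolding chan_pow qf_pow[OF pos_chan[OF sandQ_pos(2)[OF Q] K]] v using n by simp
  from chain_kernel[OF a sandQ_pow[OF a Q] pos_pow[OF J] pos_pow[OF K] B this]
  show ?thesis unfolding chan_pow qf_pow[OF pos_chan[OF sandQ_pos(1)[OF Q] J]] using n by simp
qed

lemma mm_cong: "(\<And>k. k \<in> I \<Longrightarrow> A i k = A' i k) \<Longrightarrow> (\<And>k. k \<in> I \<Longrightarrow> B k j = B' k j) \<Longrightarrow> mm I A B i j = mm I A' B' i j"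
  unfolding mm_def by simp

lemma spec_cong: "(\<And>i j. i \<in> I \<Longrightarrow> j \<in> I \<Longrightarrow> A i j = A' i j) \<Longrightarrow> spec I A U d = spec I A' U d"
  unfolding spec_def by auto

lemma sandQ_cong: assumes "\<And>i j. i \<in> I \<Longrightarrow> j \<in> I \<Longrightarrow> \<rho> i j = \<rho>' i j" "\<And>i j. i \<in> I \<Longrightarrow> j \<in> I \<Longrightarrow> \<sigma> i j = \<sigma>' i j"
  shows "sandQ \<alpha> I \<rho> \<sigma> q D = sandQ \<alpha> I \<rho>' \<sigma>' q D"
proof -
  have 1: "spec I \<sigma> U d = spec I \<sigma>' U d" for U d by (rule spec_cong[OF assms(2)])
  have 2: "spec I (mm I H (mm I \<rho> H)) W z = spec I (mm I H (mm I \<rho>' H)) W z" for H W z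
    by (intro spec_cong mm_cong assms(1)) auto
  have 3: "qf I \<rho> v = qf I \<rho>' v" for v by (rule qf_cong[OF assms(1)]) auto
  have 4: "pos I \<rho> = pos I \<rho>'" by (rule pos_cong[OF assms(1)])
  show ?thesis unfolding sandQ_def 1 2 3 4 ..
qed

lemma spec_trace: assumes s: "spec I A U d" and fin: "finite I" shows "(\<Sum>i\<in>I. A i i) = of_real (\<Sum>k\<in>I. d k)"
proof -
  have "(\<Sum>i\<in>I. A i i) = (\<Sum>i\<in>I. \<Sum>k\<in>I. of_real (d k) * U k i * cnj (U k i))"
    using s by (intro sum.cong) (auto simp: spec_def spc_def)
  also have "\<dots> = (\<Sum>k\<in>I. \<Sum>i\<in>I. of_real (d k) * U k i * cnj (U k i))" by (rule sum.swap)
  also have "\<dots> = (\<Sum>k\<in>I. of_real (d k) * ip I (U k) (U k))"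
    unfolding ip_def by (simp add: sum_distrib_left mult_ac)
  finally show ?thesis by (simp add: onb_ipD[OF spec_onb[OF s]])
qed

text \<open>All operators share the eigenbasis of \<sigma> and d^\<alpha> d^(1 - \<alpha>) = d, also
  for d = 0, so Q is the trace.\<close>

lemma sandQ_refl: assumes a: "\<alpha> > 1" and fin: "finite I" and p: "pos I \<sigma>"
  shows "\<exists>D. sandQ \<alpha> I \<sigma> \<sigma> (Re (\<Sum>i\<in>I. \<sigma> i i)) D"
proof -
  obtain U d where U: "spec I \<sigma> U d" and d: "\<And>k. k \<in> I \<Longrightarrow> 0 \<le> d k" using pos_spectral[OF fin p] by blast
  define h where "h k = d k powr ((1 - \<alpha>) / (2 * \<alpha>))" for k
  note e = spc_eigen[OF spec_onb[OF U] fin, of _ h]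
  have "spec I (mm I (spc I U h) (mm I \<sigma> (spc I U h))) U (\<lambda>k. d k * (h k)\<^sup>2)"
  proof (rule eigenbasis_spec[OF spec_onb[OF U] fin])
    fix k i assume k: "k \<in> I" and i: "i \<in> I"
    have "ap I \<sigma> (ap I (spc I U h) (U k)) i = of_real (h k) * of_real (d k) * U k i" if "i \<in> I" for i
    proof -
      have "ap I \<sigma> (ap I (spc I U h) (U k)) i = ap I \<sigma> (\<lambda>i. of_real (h k) * U k i) i"
        by (rule ap_cong) (auto simp: e[OF k])
      then show ?thesis by (simp add: ap_scale spec_eigen[OF U fin k that])
    qed
    then have "ap I (spc I U h) (ap I \<sigma> (ap I (spc I U h) (U k))) i = ap I (spc I U h) (\<lambda>i. of_real (h k) * of_real (d k) * U k i) i"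
      by (intro ap_cong) auto
    then show "ap I (mm I (spc I U h) (mm I \<sigma> (spc I U h))) (U k) i = of_real (d k * (h k)\<^sup>2) * U k i"
      unfolding ap_mm by (simp add: ap_scale e[OF k] power2_eq_square)
  qed
  moreover have "Re (\<Sum>i\<in>I. \<sigma> i i) = (\<Sum>k\<in>I. (d k * (h k)\<^sup>2) powr \<alpha>)"
  proof -
    have "(d k * (h k)\<^sup>2) powr \<alpha> = d k" if "k \<in> I" for k
      unfolding h_def sandwich_powr[OF a d[OF that] d[OF that]] powr_add[symmetric] using d[OF that] by simp
    then show ?thesis unfolding spec_trace[OF U fin] by simp
  qed
  moreover have "qf I \<sigma> (U k) = 0" if "k \<in> I" "d k = 0" for k using spec_qf_basis[OF U fin] that by simp
  moreover have "h = (\<lambda>k. d k powr ((1 - \<alpha>) / (2 * \<alpha>)))" by (auto simp: h_def)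
  ultimately have "sandQ \<alpha> I \<sigma> \<sigma> (Re (\<Sum>i\<in>I. \<sigma> i i)) (d ` I)"
    unfolding sandQ_def using fin p U d by blast
  then show ?thesis by blast
qed

section \<open>Homogeneity, and amortized bounds for product channels\<close>

lemma sandQ_I: 
  assumes "finite I" "finite D" "pos I \<rho>" "spec I \<sigma> U d" "\<And>k. k \<in> I \<Longrightarrow> 0 \<le> d k \<and> d k \<in> D \<and> (d k = 0 \<longrightarrow> qf I \<rho> (U k) = 0)"
    "spec I (mm I (spc I U (\<lambda>k. d k powr ((1 - \<alpha>) / (2 * \<alpha>)))) (mm I \<rho> (spc I U (\<lambda>k. d k powr ((1 - \<alpha>) / (2 * \<alpha>)))))) W z"
  shows "sandQ \<alpha> I \<rho> \<sigma> (\<Sum>k\<in>I. z k powr \<alpha>) D"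
  unfolding sandQ_def using assms by blast

lemma sandQ_scalar: assumes a: "\<alpha> > 1" and s: "s > 0" and t: "t > 0"
  shows "sandQ \<alpha> {p} (\<lambda>_ _. of_real s) (\<lambda>_ _. of_real t) (s powr \<alpha> * t powr (1 - \<alpha>)) {t}"
proof -
  have sp: "spec {p} (\<lambda>_ _. of_real c) (\<lambda>_ _. 1) (\<lambda>_. c)" for c
    by (simp add: spec_def spc_def onb_def ip_def)
  let ?h = "t powr ((1 - \<alpha>) / (2 * \<alpha>))"
  have Z: "spec {p} (mm {p} (spc {p} (\<lambda>_ _. 1) (\<lambda>k. ?h)) (mm {p} (\<lambda>_ _. of_real s) (spc {p} (\<lambda>_ _. 1) (\<lambda>k. ?h)))) (\<lambda>_ _. 1) (\<lambda>_. s * ?h\<^sup>2)"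
    by (simp add: spec_def spc_def onb_def ip_def mm_def power2_eq_square)
  have P: "pos {p} (\<lambda>_ _. of_real s)" by (rule spec_pos[OF sp]) (use s in simp)
  have "sandQ \<alpha> {p} (\<lambda>_ _. of_real s) (\<lambda>_ _. of_real t) (\<Sum>k\<in>{p}. (s * ?h\<^sup>2) powr \<alpha>) {t}"
    by (rule sandQ_I[OF _ _ P sp _ Z]) (use t in auto)
  then show ?thesis using sandwich_powr[OF a, of s t] s t by simp
qed

text \<open>Scaling is the tensor product with a one-dimensional system carrying the scalars s and
  t, so the factor is the value of Q for these scalars.\<close>

lemma sandQ_scale: assumes a: "\<alpha> > 1" and s: "s > 0" and t: "t > 0" and Q: "sandQ \<alpha> I \<rho> \<sigma> q D"
  shows "sandQ \<alpha> I (\<lambda>i j. of_real s * \<rho> i j) (\<lambda>i j. of_real t * \<sigma> i j) (s powr \<alpha> * t powr (1 - \<alpha>) * q) ((\<lambda>(a,b). a * b) ` (D \<times> {t}))"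
proof -
  have "bij_betw (\<lambda>j. (j, ())) I (I \<times> {()})" unfolding bij_betw_def inj_on_def by auto
  from sandQ_tens[OF this a Q sandQ_scalar[OF a s t]] show ?thesis
    unfolding tens_def by (simp add: mult_ac)
qed

definition ker_le :: "'a set \<Rightarrow> 'a op \<Rightarrow> 'a op \<Rightarrow> bool" where
  "ker_le I \<rho> \<sigma> \<longleftrightarrow> (\<forall>v. qf I \<sigma> v = 0 \<longrightarrow> qf I \<rho> v = 0)"

text \<open>Multiplicative form of the amortized inequality, over all reference dimensions and
  without normalization, so that the output of one channel use is an admissible input of the next.
  The kernel clause guarantees that Q of the outputs exists.\<close>

definition amort_bound :: "real \<Rightarrow> nat \<Rightarrow> nat \<Rightarrow> (nat \<times> nat) op \<Rightarrow> (nat \<times> nat) op \<Rightarrow> real \<Rightarrow> bool" where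
  "amort_bound \<alpha> x y J K c \<longleftrightarrow> (\<forall>r \<rho> \<sigma>. pos (grid r x) \<rho> \<longrightarrow> pos (grid r x) \<sigma> \<longrightarrow> ker_le (grid r x) \<rho> \<sigma> \<longrightarrow>
     ker_le (grid r y) (chan x J \<rho>) (chan x K \<sigma>) \<and>
     (\<forall>q D q' D'. sandQ \<alpha> (grid r x) \<rho> \<sigma> q D \<longrightarrow> sandQ \<alpha> (grid r y) (chan x J \<rho>) (chan x K \<sigma>) q' D' \<longrightarrow> q' \<le> c * q))"

lemma ker_le_reindex: assumes g: "bij_betw g J I" and k: "ker_le I \<rho> \<sigma>"
  shows "ker_le J (\<lambda>i j. \<rho> (g i) (g j)) (\<lambda>i j. \<sigma> (g i) (g j))"
  using k unfolding ker_le_def qf_reindex'[OF g] by blast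

lemma ker_le_cong: assumes "\<And>i j. i \<in> I \<Longrightarrow> j \<in> I \<Longrightarrow> \<rho> i j = \<rho>' i j" "\<And>i j. i \<in> I \<Longrightarrow> j \<in> I \<Longrightarrow> \<sigma> i j = \<sigma>' i j"
  shows "ker_le I \<rho> \<sigma> = ker_le I \<rho>' \<sigma>'"
proof -
  have "qf I \<rho> v = qf I \<rho>' v" "qf I \<sigma> v = qf I \<sigma>' v" for v using assms by (auto intro: qf_cong)
  then show ?thesis unfolding ker_le_def by simp
qed

text \<open>The next three bijections move the factors $R \otimes (X_1 X_2) \to (R X_1) \otimes X_2$,
  $(R X_1) \otimes Y_2 \to (R Y_2) \otimes X_1$ and $(R Y_2) \otimes Y_1 \to R \otimes (Y_1 Y_2)$, so that each
  channel of a product acts on the last factor.\<close>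

lemma bij_regroup: "bij_betw (\<lambda>i. (fst i div x1, (fst i mod x1) * x2 + snd i)) (grid (r * x1) x2) (grid r (x1 * x2))"
proof (rule bij_betw_byWitness[where f' = "\<lambda>i. (fst i * x1 + snd i div x2, snd i mod x2)"])
  show "\<forall>i\<in>grid (r * x1) x2. (fst (fst i div x1, (fst i mod x1) * x2 + snd i) * x1 + snd (fst i div x1, (fst i mod x1) * x2 + snd i) div x2, 
      snd (fst i div x1, (fst i mod x1) * x2 + snd i) mod x2) = i"
    unfolding grid_def by auto
  show "\<forall>i\<in>grid r (x1 * x2). (fst (fst i * x1 + snd i div x2, snd i mod x2) div x1, (fst (fst i * x1 + snd i div x2, snd i mod x2) mod x1) * x2 + snd (fst i * x1 + snd i div x2, snd i mod x2)) = i"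
  proof
    fix i assume "i \<in> grid r (x1 * x2)"
    then have "snd i div x2 < x1" using div_mod_less[of "snd i" x1 x2] by (simp add: grid_def mem_Times_iff)
    then show "(fst (fst i * x1 + snd i div x2, snd i mod x2) div x1, (fst (fst i * x1 + snd i div x2, snd i mod x2) mod x1) * x2 + snd (fst i * x1 + snd i div x2, snd i mod x2)) = i"
      by simp
  qed
  show "(\<lambda>i. (fst i div x1, (fst i mod x1) * x2 + snd i)) ` grid (r * x1) x2 \<subseteq> grid r (x1 * x2)"
    unfolding grid_def using div_mod_less by (auto intro!: mult_add_less)
  show "(\<lambda>i. (fst i * x1 + snd i div x2, snd i mod x2)) ` grid r (x1 * x2) \<subseteq> grid (r * x1) x2"
    unfolding grid_def using div_mod_less by (auto intro!: mult_add_less)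
qed

lemma bij_exchange: "bij_betw (\<lambda>i. ((fst i div y) * x + snd i, fst i mod y)) (grid (r * y) x) (grid (r * x) y)"
proof (rule bij_betw_byWitness[where f' = "\<lambda>i. ((fst i div x) * y + snd i, fst i mod x)"])
  show "(\<lambda>i. ((fst i div y) * x + snd i, fst i mod y)) ` grid (r * y) x \<subseteq> grid (r * x) y"
    unfolding grid_def using div_mod_less by (auto intro!: mult_add_less)
  show "(\<lambda>i. ((fst i div x) * y + snd i, fst i mod x)) ` grid (r * x) y \<subseteq> grid (r * y) x"
    unfolding grid_def using div_mod_less by (auto intro!: mult_add_less)
qed (auto simp: grid_def)

lemma bij_ungroup: "bij_betw (\<lambda>i. (fst i * y2 + snd i mod y2, snd i div y2)) (grid r (y1 * y2)) (grid (r * y2) y1)"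
proof (rule bij_betw_byWitness[where f' = "\<lambda>i. (fst i div y2, snd i * y2 + fst i mod y2)"])
  show "\<forall>i\<in>grid r (y1 * y2). (fst (fst i * y2 + snd i mod y2, snd i div y2) div y2, snd (fst i * y2 + snd i mod y2, snd i div y2) * y2 + fst (fst i * y2 + snd i mod y2, snd i div y2) mod y2) = i"
  proof
    fix i assume "i \<in> grid r (y1 * y2)"
    then have "snd i mod y2 < y2" using div_mod_less[of "snd i" y1 y2] by (simp add: grid_def mem_Times_iff)
    then show "(fst (fst i * y2 + snd i mod y2, snd i div y2) div y2, snd (fst i * y2 + snd i mod y2, snd i div y2) * y2 + fst (fst i * y2 + snd i mod y2, snd i div y2) mod y2) = i"
      by simp
  qed
  show "\<forall>i\<in>grid (r * y2) y1. (fst (fst i div y2, snd i * y2 + fst i mod y2) * y2 + snd (fst i div y2, snd i * y2 + fst i mod y2) mod y2, snd (fst i div y2, snd i * y2 + fst i mod y2) div y2) = i"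
  proof
    fix i assume "i \<in> grid (r * y2) y1"
    then have "fst i mod y2 < y2" using div_mod_less[of "fst i" r y2] by (simp add: grid_def mem_Times_iff)
    then show "(fst (fst i div y2, snd i * y2 + fst i mod y2) * y2 + snd (fst i div y2, snd i * y2 + fst i mod y2) mod y2, snd (fst i div y2, snd i * y2 + fst i mod y2) div y2) = i" by simp
  qed
  show "(\<lambda>i. (fst i * y2 + snd i mod y2, snd i div y2)) ` grid r (y1 * y2) \<subseteq> grid (r * y2) y1"
    unfolding grid_def using div_mod_less by (auto intro!: mult_add_less)
  show "(\<lambda>i. (fst i div y2, snd i * y2 + fst i mod y2)) ` grid (r * y2) y1 \<subseteq> grid r (y1 * y2)"
    unfolding grid_def using div_mod_less by (auto intro!: mult_add_less)
qed

lemma chan_tens_sequential: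
  fixes \<rho> :: "(nat \<times> nat) op" and r x1 x2 y1 y2 :: nat
  defines "g1 \<equiv> \<lambda>i. (fst i div x1, (fst i mod x1) * x2 + snd i)"
    and "g2 \<equiv> \<lambda>i. ((fst i div y2) * x1 + snd i, fst i mod y2)"
    and "g3 \<equiv> \<lambda>i. (fst i * y2 + snd i mod y2, snd i div y2)"
  assumes ij: "i \<in> grid r (y1 * y2)" "j \<in> grid r (y1 * y2)"
  shows "chan x1 J1 (\<lambda>i j. chan x2 J2 (\<lambda>i j. \<rho> (g1 i) (g1 j)) (g2 i) (g2 j)) (g3 i) (g3 j) 
     = chan (x1 * x2) (tens (grid_split x2 y2) (grid_split x2 y2) J1 J2) \<rho> i j"
proof -
  \<comment> \<open>A point of the grid forces \<open>y2 > 0\<close>, which the cancellation of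
    quotient and remainder after \<open>g3\<close> requires.\<close>
  have y2: "y2 > 0" using ij unfolding grid_def by (cases y2) auto
  have "chan x1 J1 (\<lambda>i j. chan x2 J2 (\<lambda>i j. \<rho> (g1 i) (g1 j)) (g2 i) (g2 j)) (g3 i) (g3 j) 
    = (\<Sum>c<x1. \<Sum>c'<x1. \<Sum>b<x2. \<Sum>b'<x2. \<rho> (fst i, c * x2 + b) (fst j, c' * x2 + b') * 
        (J1 (c, snd i div y2) (c', snd j div y2) * J2 (b, snd i mod y2) (b', snd j mod y2)))"
    unfolding chan_def g1_def g2_def g3_def using y2 by (intro sum.cong refl) (simp add: sum_distrib_left sum_distrib_right mult_ac)
  also have "\<dots> = (\<Sum>c<x1. \<Sum>b<x2. \<Sum>c'<x1. \<Sum>b'<x2. \<rho> (fst i, c * x2 + b) (fst j, c' * x2 + b') * 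
        (J1 (c, snd i div y2) (c', snd j div y2) * J2 (b, snd i mod y2) (b', snd j mod y2)))"
    by (rule sum.cong[OF refl sum.swap])
  also have "\<dots> = (\<Sum>c<x1. \<Sum>b<x2. \<Sum>d<x1 * x2. \<rho> (fst i, c * x2 + b) (fst j, d) * 
        (J1 (c, snd i div y2) (d div x2, snd j div y2) * J2 (b, snd i mod y2) (d mod x2, snd j mod y2)))"
  proof (rule sum.cong[OF refl], rule sum.cong[OF refl])
    fix c b
    show "(\<Sum>c'<x1. \<Sum>b'<x2. \<rho> (fst i, c * x2 + b) (fst j, c' * x2 + b') * (J1 (c, snd i div y2) (c', snd j div y2) * J2 (b, snd i mod y2) (b', snd j mod y2)))
      = (\<Sum>d<x1 * x2. \<rho> (fst i, c * x2 + b) (fst j, d) * (J1 (c, snd i div y2) (d div x2, snd j div y2) * J2 (b, snd i mod y2) (d mod x2, snd j mod y2)))"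
      by (subst sum_divmod[where g = "\<lambda>c' b'. \<rho> (fst i, c * x2 + b) (fst j, c' * x2 + b') * (J1 (c, snd i div y2) (c', snd j div y2) * J2 (b, snd i mod y2) (b', snd j mod y2))", symmetric]) simp
  qed
  also have "\<dots> = (\<Sum>a<x1 * x2. \<Sum>d<x1 * x2. \<rho> (fst i, a) (fst j, d) * 
        (J1 (a div x2, snd i div y2) (d div x2, snd j div y2) * J2 (a mod x2, snd i mod y2) (d mod x2, snd j mod y2)))"
    by (subst sum_divmod[where g = "\<lambda>c b. \<Sum>d<x1 * x2. \<rho> (fst i, c * x2 + b) (fst j, d) * (J1 (c, snd i div y2) (d div x2, snd j div y2) * J2 (b, snd i mod y2) (d mod x2, snd j mod y2))", symmetric]) simp
  also have "\<dots> = chan (x1 * x2) (tens (grid_split x2 y2) (grid_split x2 y2) J1 J2) \<rho> i j"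
    unfolding chan_def tens_def grid_split_def by simp
  finally show ?thesis .
qed

text \<open>While one channel acts, the idle factor belongs to the reference: R X1 for the second
  channel, then R Y2 for the first. A bound uniform in the reference dimension therefore
  composes.\<close>

lemma amort_bound_tens:
  assumes a: "\<alpha> > 1" and J1: "pos (grid x1 y1) J1" and K1: "pos (grid x1 y1) K1" 
    and J2: "pos (grid x2 y2) J2" and K2: "pos (grid x2 y2) K2"
    and b1: "amort_bound \<alpha> x1 y1 J1 K1 c1" and b2: "amort_bound \<alpha> x2 y2 J2 K2 c2" and c1: "0 \<le> c1"
  shows "amort_bound \<alpha> (x1 * x2) (y1 * y2) (tens (grid_split x2 y2) (grid_split x2 y2) J1 J2) (tens (grid_split x2 y2) (grid_split x2 y2) K1 K2) (c1 * c2)"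
  unfolding amort_bound_def
proof (intro allI impI)
  fix r \<rho> \<sigma>
  assume p: "pos (grid r (x1 * x2)) \<rho>" "pos (grid r (x1 * x2)) \<sigma>" and k: "ker_le (grid r (x1 * x2)) \<rho> \<sigma>"
  let ?J = "tens (grid_split x2 y2) (grid_split x2 y2) J1 J2" and ?K = "tens (grid_split x2 y2) (grid_split x2 y2) K1 K2"
  define g1 where "g1 = (\<lambda>i. (fst i div x1, (fst i mod x1) * x2 + snd i))"
  define g2 where "g2 = (\<lambda>i. ((fst i div y2) * x1 + snd i, fst i mod y2))"
  define g3 where "g3 = (\<lambda>i. (fst i * y2 + snd i mod y2, snd i div y2))"
  have g1: "bij_betw g1 (grid (r * x1) x2) (grid r (x1 * x2))" unfolding g1_def by (rule bij_regroup)
  have g2: "bij_betw g2 (grid (r * y2) x1) (grid (r * x1) y2)" unfolding g2_def by (rule bij_exchange)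
  have g3: "bij_betw g3 (grid r (y1 * y2)) (grid (r * y2) y1)" unfolding g3_def by (rule bij_ungroup)
  define \<rho>A where "\<rho>A = (\<lambda>i j. \<rho> (g1 i) (g1 j))"
  define \<sigma>A where "\<sigma>A = (\<lambda>i j. \<sigma> (g1 i) (g1 j))"
  define \<rho>C where "\<rho>C = (\<lambda>i j. chan x2 J2 \<rho>A (g2 i) (g2 j))"
  define \<sigma>C where "\<sigma>C = (\<lambda>i j. chan x2 K2 \<sigma>A (g2 i) (g2 j))"
  have fJ: "chan x1 J1 \<rho>C (g3 i) (g3 j) = chan (x1 * x2) ?J \<rho> i j" 
    and fK: "chan x1 K1 \<sigma>C (g3 i) (g3 j) = chan (x1 * x2) ?K \<sigma> i j" if "i \<in> grid r (y1 * y2)" "j \<in> grid r (y1 * y2)" for i j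
    unfolding \<rho>C_def \<rho>A_def \<sigma>C_def \<sigma>A_def g1_def g2_def g3_def by (rule chan_tens_sequential[OF that])+
  have pA: "pos (grid (r * x1) x2) \<rho>A" "pos (grid (r * x1) x2) \<sigma>A" "ker_le (grid (r * x1) x2) \<rho>A \<sigma>A"
    unfolding \<rho>A_def \<sigma>A_def using pos_reindex[OF g1] ker_le_reindex[OF g1] p k by auto
  have pB: "pos (grid (r * x1) y2) (chan x2 J2 \<rho>A)" "pos (grid (r * x1) y2) (chan x2 K2 \<sigma>A)" 
      "ker_le (grid (r * x1) y2) (chan x2 J2 \<rho>A) (chan x2 K2 \<sigma>A)"
    using pos_chan pA J2 K2 b2 unfolding amort_bound_def by auto
  have pC: "pos (grid (r * y2) x1) \<rho>C" "pos (grid (r * y2) x1) \<sigma>C" "ker_le (grid (r * y2) x1) \<rho>C \<sigma>C"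
    unfolding \<rho>C_def \<sigma>C_def using pos_reindex[OF g2] ker_le_reindex[OF g2] pB by auto
  have pD: "pos (grid (r * y2) y1) (chan x1 J1 \<rho>C)" "pos (grid (r * y2) y1) (chan x1 K1 \<sigma>C)" 
      "ker_le (grid (r * y2) y1) (chan x1 J1 \<rho>C) (chan x1 K1 \<sigma>C)"
    using pos_chan pC J1 K1 b1 unfolding amort_bound_def by auto
  have kf: "ker_le (grid r (y1 * y2)) (chan (x1 * x2) ?J \<rho>) (chan (x1 * x2) ?K \<sigma>)"
  proof -
    have "ker_le (grid r (y1 * y2)) (\<lambda>i j. chan x1 J1 \<rho>C (g3 i) (g3 j)) (\<lambda>i j. chan x1 K1 \<sigma>C (g3 i) (g3 j)) = 
      ker_le (grid r (y1 * y2)) (chan (x1 * x2) ?J \<rho>) (chan (x1 * x2) ?K \<sigma>)"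
      by (rule ker_le_cong) (rule fJ fK; assumption)+
    then show ?thesis using ker_le_reindex[OF g3 pD(3)] by simp
  qed
  have "q' \<le> c1 * c2 * q" if Q: "sandQ \<alpha> (grid r (x1 * x2)) \<rho> \<sigma> q D" 
    and Q': "sandQ \<alpha> (grid r (y1 * y2)) (chan (x1 * x2) ?J \<rho>) (chan (x1 * x2) ?K \<sigma>) q' D'" for q D q' D'
  proof -
    have QA: "sandQ \<alpha> (grid (r * x1) x2) \<rho>A \<sigma>A q D" unfolding \<rho>A_def \<sigma>A_def by (rule sandQ_reindex[OF a g1 Q])
    obtain q2 D2 where QB: "sandQ \<alpha> (grid (r * x1) y2) (chan x2 J2 \<rho>A) (chan x2 K2 \<sigma>A) q2 D2"
      using sandQ_exists[OF finite_grid pB(1,2)] pB(3) unfolding ker_le_def by blast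
    have 1: "q2 \<le> c2 * q" using b2 pA QA QB unfolding amort_bound_def by blast
    have QC: "sandQ \<alpha> (grid (r * y2) x1) \<rho>C \<sigma>C q2 D2" unfolding \<rho>C_def \<sigma>C_def by (rule sandQ_reindex[OF a g2 QB])
    obtain q3 D3 where QD: "sandQ \<alpha> (grid (r * y2) y1) (chan x1 J1 \<rho>C) (chan x1 K1 \<sigma>C) q3 D3"
      using sandQ_exists[OF finite_grid pD(1,2)] pD(3) unfolding ker_le_def by blast
    have 2: "q3 \<le> c1 * q2" using b1 pC QC QD unfolding amort_bound_def by blast
    have "sandQ \<alpha> (grid r (y1 * y2)) (\<lambda>i j. chan x1 J1 \<rho>C (g3 i) (g3 j)) (\<lambda>i j. chan x1 K1 \<sigma>C (g3 i) (g3 j)) q3 D3"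
      by (rule sandQ_reindex[OF a g3 QD])
    moreover have "sandQ \<alpha> (grid r (y1 * y2)) (\<lambda>i j. chan x1 J1 \<rho>C (g3 i) (g3 j)) (\<lambda>i j. chan x1 K1 \<sigma>C (g3 i) (g3 j)) q3 D3
      = sandQ \<alpha> (grid r (y1 * y2)) (chan (x1 * x2) ?J \<rho>) (chan (x1 * x2) ?K \<sigma>) q3 D3"
      by (rule sandQ_cong) (rule fJ fK; assumption)+
    ultimately have "sandQ \<alpha> (grid r (y1 * y2)) (chan (x1 * x2) ?J \<rho>) (chan (x1 * x2) ?K \<sigma>) q3 D3" by simp
    \<comment> \<open>Uniqueness of Q identifies the given \<open>q'\<close> with the value reached
      through the two intermediate steps.\<close>
    then have "q' = q3" using sandQ_unique[OF a Q'] by blast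
    then show ?thesis using 2 mult_left_mono[OF 1 c1] by (simp add: mult.assoc)
  qed
  then show "ker_le (grid r (y1 * y2)) (chan (x1 * x2) ?J \<rho>) (chan (x1 * x2) ?K \<sigma>) \<and>
     (\<forall>q D q' D'. sandQ \<alpha> (grid r (x1 * x2)) \<rho> \<sigma> q D \<longrightarrow> sandQ \<alpha> (grid r (y1 * y2)) (chan (x1 * x2) ?J \<rho>) (chan (x1 * x2) ?K \<sigma>) q' D' \<longrightarrow> q' \<le> c1 * c2 * q)"
    using kf by blast
qed

lemma amort_bound_pow:
  assumes a: "\<alpha> > 1" and J: "pos (grid x y) J" and K: "pos (grid x y) K"
    and b: "amort_bound \<alpha> x y J K c" and c: "0 \<le> c"
  shows "amort_bound \<alpha> (x ^ n) (y ^ n) (tens_pow x y x y n J) (tens_pow x y x y n K) (c ^ n)"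
proof (induction n)
  case 0
  have e: "chan 1 (\<lambda>_ _. 1) \<rho> i j = \<rho> i j" if "i \<in> grid r 1" "j \<in> grid r 1" for \<rho> i j r
    using that unfolding chan_def grid_def by auto
  have k: "ker_le (grid r 1) (chan 1 (\<lambda>_ _. 1) \<rho>) (chan 1 (\<lambda>_ _. 1) \<sigma>) = ker_le (grid r 1) \<rho> \<sigma>" for r \<rho> \<sigma>
    by (rule ker_le_cong) (rule e; assumption)+
  have s: "sandQ \<alpha> (grid r 1) (chan 1 (\<lambda>_ _. 1) \<rho>) (chan 1 (\<lambda>_ _. 1) \<sigma>) q D = sandQ \<alpha> (grid r 1) \<rho> \<sigma> q D" for r \<rho> \<sigma> q D
    by (rule sandQ_cong) (rule e; assumption)+
  show ?case unfolding amort_bound_def power_0 tens_pow.simps k s using sandQ_mono[OF a] by auto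
next
  case (Suc n)
  show ?case unfolding power_Suc2 tens_pow.simps
    by (rule amort_bound_tens[OF a pos_pow[OF J] pos_pow[OF K] J K Suc b]) (use c in simp)
qed

section \<open>Transfer to matrices\<close>

definition mat_op :: "complex mat \<Rightarrow> nat \<Rightarrow> nat \<Rightarrow> complex" where "mat_op A = (\<lambda>i j. A $$ (i,j))"

text \<open>The row-major numbering built into \<open>id_tensor\<close>, \<open>kron\<close> and
  \<open>Phi\<close>, where the block index is the quotient.\<close>

definition grid_code :: "nat \<Rightarrow> nat \<times> nat \<Rightarrow> nat" where "grid_code x i = fst i * x + snd i"

definition grid_op :: "nat \<Rightarrow> complex mat \<Rightarrow> (nat \<times> nat) op" where
  "grid_op x A = (\<lambda>i j. mat_op A (grid_code x i) (grid_code x j))"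

lemma bij_grid_code: "bij_betw (grid_code x) (grid r x) {..<r * x}"
proof (rule bij_betw_byWitness[where f' = "\<lambda>a. (a div x, a mod x)"])
  show "(\<lambda>a. (a div x, a mod x)) ` {..<r * x} \<subseteq> grid r x" unfolding grid_def using div_mod_less by auto
  show "grid_code x ` grid r x \<subseteq> {..<r * x}" unfolding grid_def grid_code_def by (auto intro!: mult_add_less)
qed (auto simp: grid_def grid_code_def)

text \<open>Polarization: reality of the form at e_i + e_j and at e_i + \<i> e_j relates the
  imaginary and the real parts of A i j and A j i.\<close>

lemma herm_if_real: assumes fin: "finite I" and im: "\<And>v. Im (ip I v (ap I A v)) = 0" shows "herm I A"
  unfolding herm_def
proof (intro ballI)
  fix i j assume ij: "i \<in> I" "j \<in> I"
  let ?e = "\<lambda>i j. if j = i then 1 else (0::complex)"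
  have apc: "ap I A (\<lambda>l. ?e i l + c * ?e j l) k = A k i + c * A k j" for c k
  proof -
    have "ap I A (\<lambda>l. u l + c * w l) k = ap I A u k + c * ap I A w k" for u w
      by (simp add: ap_def algebra_simps sum.distrib sum_distrib_left)
    moreover have "ap I A (?e i) k = A k i" if "i \<in> I" for i
      using that fin unfolding ap_def by (simp add: if_distrib cong: if_cong)
    ultimately show ?thesis using ij by simp
  qed
  have q: "ip I (\<lambda>l. ?e i l + c * ?e j l) (ap I A (\<lambda>l. ?e i l + c * ?e j l)) = 
     (A i i + c * A i j) + cnj c * (A j i + c * A j j)" for c
  proof -
    have "ip I (\<lambda>l. ?e i l + c * ?e j l) w = w i + cnj c * w j" for w
      by (subst cnj_ip[symmetric]) (simp add: ip_add_right ip_scale_right ip_unit_right[OF fin ij(1)] ip_unit_right[OF fin ij(2)])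
    then show ?thesis by (simp add: apc)
  qed
  have d: "Im (A k k) = 0" if "k \<in> I" for k
  proof -
    have "ap I A (?e k) k = A k k" using that fin unfolding ap_def by (simp add: if_distrib cong: if_cong)
    then show ?thesis using im[of "?e k"] by (simp add: ip_unit_left[OF fin that])
  qed
  have "Im (A i j) + Im (A j i) = 0" using im[of "\<lambda>l. ?e i l + 1 * ?e j l"] d ij unfolding q by simp
  moreover have "Re (A i j) - Re (A j i) = 0" using im[of "\<lambda>l. ?e i l + \<i> * ?e j l"] d ij unfolding q by simp
  ultimately show "A j i = cnj (A i j)" by (simp add: complex_eq_iff)
qed

lemma psd_quadratic: assumes "A \<in> carrier_mat n n" "v \<in> carrier_vec n"
  shows "(\<Sum>i<n. cnj (v $ i) * (A *\<^sub>v v) $ i) = ip {..<n} (\<lambda>i. v $ i) (ap {..<n} (mat_op A) (\<lambda>i. v $ i))"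
  unfolding ip_def ap_def mat_op_def using assms
  by (intro sum.cong refl) (auto simp: scalar_prod_def atLeast0LessThan)

lemma psd_iff: "psd n A \<longleftrightarrow> A \<in> carrier_mat n n \<and> pos {..<n} (mat_op A)"
proof
  assume p: "psd n A"
  then have A: "A \<in> carrier_mat n n" unfolding psd_def by simp
  have q: "Im (ip {..<n} v (ap {..<n} (mat_op A) v)) = 0 \<and> Re (ip {..<n} v (ap {..<n} (mat_op A) v)) \<ge> 0" for v
  proof -
    have "ip {..<n} (\<lambda>i. vec n v $ i) (ap {..<n} (mat_op A) (\<lambda>i. vec n v $ i)) = ip {..<n} v (ap {..<n} (mat_op A) v)"
      by (intro ip_cong ap_cong) auto
    then show ?thesis using p psd_quadratic[OF A, of "vec n v"] unfolding psd_def Let_def by (metis vec_carrier)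
  qed
  show "A \<in> carrier_mat n n \<and> pos {..<n} (mat_op A)"
    using A herm_if_real[of "{..<n}" "mat_op A"] q unfolding pos_def qf_def by auto
next
  assume p: "A \<in> carrier_mat n n \<and> pos {..<n} (mat_op A)"
  have "Im (ip {..<n} v (ap {..<n} (mat_op A) v)) = 0 \<and> Re (ip {..<n} v (ap {..<n} (mat_op A) v)) \<ge> 0" for v
    using p herm_qf_ip[of "{..<n}" "mat_op A" v] unfolding pos_def by (metis Im_complex_of_real Re_complex_of_real)
  then show "psd n A" using p psd_quadratic[of A n] unfolding psd_def Let_def by metis
qed

lemma psd_grid: "psd (r * x) A \<longleftrightarrow> A \<in> carrier_mat (r * x) (r * x) \<and> pos (grid r x) (grid_op x A)"
proof -
  have "pos {..<r * x} (mat_op A) \<longleftrightarrow> pos (grid r x) (grid_op x A)"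
  proof
    assume "pos {..<r * x} (mat_op A)"
    then show "pos (grid r x) (grid_op x A)" unfolding grid_op_def by (rule pos_reindex[OF bij_grid_code])
  next
    assume p: "pos (grid r x) (grid_op x A)"
    have b: "bij_betw (inv_into (grid r x) (grid_code x)) {..<r * x} (grid r x)" by (rule bij_betw_inv_into[OF bij_grid_code])
    have "pos {..<r * x} (\<lambda>i j. grid_op x A (inv_into (grid r x) (grid_code x) i) (inv_into (grid r x) (grid_code x) j))"
      by (rule pos_reindex[OF b p])
    moreover have "grid_op x A (inv_into (grid r x) (grid_code x) i) (inv_into (grid r x) (grid_code x) j) = mat_op A i j" 
      if "i \<in> {..<r * x}" "j \<in> {..<r * x}" for i j
      using that bij_betw_inv_into_right[OF bij_grid_code] unfolding grid_op_def by metis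
    ultimately show "pos {..<r * x} (mat_op A)" using pos_cong by (metis (no_types, lifting))
  qed
  then show ?thesis unfolding psd_iff by simp
qed

lemma adj_carrier[simp]: "U \<in> carrier_mat n m \<Longrightarrow> adj U \<in> carrier_mat m n"
  unfolding adj_def by auto

lemma udu_entry: assumes "U \<in> carrier_mat n n" "i < n" "j < n"
  shows "(U * mat_diag n f * adj U) $$ (i,j) = (\<Sum>k<n. U $$ (i,k) * f k * cnj (U $$ (j,k)))"
proof -
  have "U * mat_diag n f = mat n n (\<lambda>(i,j). U $$ (i,j) * f j)" by (rule mat_diag_mult_right[OF assms(1)])
  then show ?thesis using assms by (simp add: scalar_prod_def atLeast0LessThan adj_def)
qed

text \<open>\<open>unitary_m\<close> gives orthonormal columns; completeness is the other one-sided
  inverse, automatic for square matrices. The vectors are columns, hence the order of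
  indices.\<close>

lemma unitary_onb: assumes "unitary_m n U" shows "onb {..<n} (\<lambda>k i. U $$ (i,k))"
proof -
  have U: "U \<in> carrier_mat n n" and 1: "adj U * U = 1\<^sub>m n" using assms unfolding unitary_m_def by auto
  have 2: "U * adj U = 1\<^sub>m n" using mat_mult_left_right_inverse[OF adj_carrier[OF U] U 1] .
  have "(adj U * U) $$ (k,l) = (\<Sum>i<n. cnj (U $$ (i,k)) * U $$ (i,l))" if "k < n" "l < n" for k l
    using U that by (simp add: scalar_prod_def atLeast0LessThan adj_def)
  moreover have "(U * adj U) $$ (i,j) = (\<Sum>k<n. U $$ (i,k) * cnj (U $$ (j,k)))" if "i < n" "j < n" for i j
    using U that by (simp add: scalar_prod_def atLeast0LessThan adj_def)
  ultimately show ?thesis unfolding onb_def ip_def 1 2 by (auto simp flip: lessThan_iff)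
qed

lemma unitary_spec: assumes "unitary_m n U" "A = U * mat_diag n (\<lambda>i. complex_of_real (d i)) * adj U"
  shows "spec {..<n} (mat_op A) (\<lambda>k i. U $$ (i,k)) d"
proof -
  have U: "U \<in> carrier_mat n n" using assms unfolding unitary_m_def by auto
  have "mat_op A i j = spc {..<n} (\<lambda>k i. U $$ (i,k)) d i j" if "i \<in> {..<n}" "j \<in> {..<n}" for i j
    using that udu_entry[OF U] unfolding mat_op_def assms(2) spc_def by (simp add: mult_ac)
  then show ?thesis using unitary_onb[OF assms(1)] unfolding spec_def by blast
qed

lemma spec_unitary: assumes A: "A \<in> carrier_mat n n" and s: "spec {..<n} (mat_op A) U d"
  shows "unitary_m n (mat n n (\<lambda>(i,k). U k i))"
    "A = mat n n (\<lambda>(i,k). U k i) * mat_diag n (\<lambda>i. complex_of_real (d i)) * adj (mat n n (\<lambda>(i,k). U k i))"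
proof -
  let ?U = "mat n n (\<lambda>(i,k). U k i)"
  have "adj ?U * ?U = 1\<^sub>m n"
  proof (rule eq_matI)
    fix k l assume "k < dim_row (1\<^sub>m n :: complex mat)" "l < dim_col (1\<^sub>m n :: complex mat)"
    then have kl: "k < n" "l < n" by auto
    then have "(adj ?U * ?U) $$ (k,l) = ip {..<n} (U k) (U l)"
      by (simp add: scalar_prod_def atLeast0LessThan adj_def ip_def)
    then show "(adj ?U * ?U) $$ (k,l) = (1\<^sub>m n :: complex mat) $$ (k,l)" using kl spec_onb[OF s] by (simp add: onb_ipD)
  qed (auto simp: adj_def)
  then show "unitary_m n ?U" unfolding unitary_m_def by auto
  show "A = ?U * mat_diag n (\<lambda>i. complex_of_real (d i)) * adj ?U"
  proof (rule eq_matI)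
    fix i j assume "i < dim_row (?U * mat_diag n (\<lambda>i. complex_of_real (d i)) * adj ?U)" "j < dim_col (?U * mat_diag n (\<lambda>i. complex_of_real (d i)) * adj ?U)"
    then have ij: "i < n" "j < n" by (auto simp: adj_def)
    have "A $$ (i,j) = spc {..<n} U d i j" using s ij unfolding spec_def mat_op_def by auto
    also have "\<dots> = (\<Sum>k<n. ?U $$ (i,k) * of_real (d k) * cnj (?U $$ (j,k)))"
      unfolding spc_def using ij by (intro sum.cong) (auto simp: mult_ac)
    also have "\<dots> = (?U * mat_diag n (\<lambda>i. complex_of_real (d i)) * adj ?U) $$ (i,j)"
      by (rule udu_entry[symmetric]) (use ij in auto)
    finally show "A $$ (i,j) = (?U * mat_diag n (\<lambda>i. complex_of_real (d i)) * adj ?U) $$ (i,j)" .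
  qed (use A in \<open>auto simp: adj_def\<close>)
qed

text \<open>The choice operator in \<open>mpow\<close> conceals its decomposition. Some pair U, d
  serves the matrix and its power simultaneously, which suffices because \<open>sandQ\<close>
  accepts any decomposition.\<close>

lemma mpow_spec: assumes "psd n A"
  obtains U d where "spec {..<n} (mat_op A) U d" "\<And>k. 0 \<le> d k" "mpow A p \<in> carrier_mat n n" 
    "spec {..<n} (mat_op (mpow A p)) U (\<lambda>k. d k powr p)"
proof -
  have A: "A \<in> carrier_mat n n" and pA: "pos {..<n} (mat_op A)" using assms unfolding psd_iff by auto
  then have n: "dim_row A = n" by auto
  obtain V c where V: "spec {..<n} (mat_op A) V c" "\<And>k. k \<in> {..<n} \<Longrightarrow> 0 \<le> c k" using pos_spectral[OF finite_lessThan pA] by blast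
  \<comment> \<open>The definition of \<open>mpow\<close> demands nonnegative numbers at all
    indices, also beyond n.\<close>
  define c' where "c' k = (if k < n then c k else 0)" for k
  have V': "spec {..<n} (mat_op A) V c'" using V(1) unfolding spec_def spc_def c'_def by simp
  have c': "0 \<le> c' k" for k using V(2) unfolding c'_def by auto
  define P where "P B \<longleftrightarrow> (\<exists>U d. unitary_m n U \<and> (\<forall>i. d i \<ge> 0) \<and>
      A = U * mat_diag n (\<lambda>i. complex_of_real (d i)) * adj U \<and>
      B = U * mat_diag n (\<lambda>i. if d i > 0 then complex_of_real (d i powr p) else 0) * adj U)" for B
  have "\<exists>B. P B" unfolding P_def using spec_unitary[OF A V'] c' by blast
  moreover have "mpow A p = (SOME B. P B)" unfolding mpow_def n P_def ..
  ultimately have "P (mpow A p)" by (metis someI_ex)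
  then obtain U d where U: "unitary_m n U" "\<And>i. d i \<ge> 0" "A = U * mat_diag n (\<lambda>i. complex_of_real (d i)) * adj U"
    "mpow A p = U * mat_diag n (\<lambda>i. if d i > 0 then complex_of_real (d i powr p) else 0) * adj U"
    unfolding P_def by blast
  \<comment> \<open>0 powr p = 0 reproduces the generalized-inverse convention, so the case
    distinction disappears.\<close>
  have "(\<lambda>i. if d i > 0 then complex_of_real (d i powr p) else 0) = (\<lambda>i. complex_of_real (d i powr p))"
    using U(2) by (auto simp: fun_eq_iff order.order_iff_strict)
  with U(4) have m: "mpow A p = U * mat_diag n (\<lambda>i. complex_of_real (d i powr p)) * adj U" by simp
  moreover have "mpow A p \<in> carrier_mat n n" unfolding m using U(1) unfolding unitary_m_def by (intro mult_carrier_mat[where n = n] adj_carrier mat_diag_dim) auto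
  ultimately show thesis using that[OF unitary_spec[OF U(1,3)] U(2) _ unitary_spec[OF U(1) m]] by blast
qed

definition log_div :: "real \<Rightarrow> real \<Rightarrow> ereal" where
  "log_div \<alpha> q = ereal (1 / (\<alpha> - 1)) * (if q = 0 then - \<infinity> else ereal (log 2 q))"

lemma ap_mat_op: assumes "A \<in> carrier_mat n n" "v \<in> carrier_vec n" "i < n"
  shows "(A *\<^sub>v v) $ i = ap {..<n} (mat_op A) (\<lambda>i. v $ i) i"
  using assms by (simp add: ap_def mat_op_def scalar_prod_def atLeast0LessThan)

text \<open>Range and kernel of a Hermitian operator are orthogonal complements. If \<sigma> v = 0
  and \<rho> v = \<sigma> w, then <v, \<rho> v> = <\<sigma> v, w> = 0; conversely \<rho> v has no
  component on the null eigenvectors of \<sigma>.\<close>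

lemma supp_le_iff: assumes r: "psd n \<rho>" and s: "psd n \<sigma>"
  shows "supp_le n \<rho> \<sigma> \<longleftrightarrow> ker_le {..<n} (mat_op \<rho>) (mat_op \<sigma>)"
proof
  let ?I = "{..<n}"
  have R: "\<rho> \<in> carrier_mat n n" "pos ?I (mat_op \<rho>)" and S: "\<sigma> \<in> carrier_mat n n" "pos ?I (mat_op \<sigma>)" using r s unfolding psd_iff by auto
  {
    assume l: "supp_le n \<rho> \<sigma>"
    show "ker_le ?I (mat_op \<rho>) (mat_op \<sigma>)" unfolding ker_le_def
    proof (intro allI impI)
      fix v assume v: "qf ?I (mat_op \<sigma>) v = 0"
      obtain w where w: "w \<in> carrier_vec n" "\<rho> *\<^sub>v vec n v = \<sigma> *\<^sub>v w" using l unfolding supp_le_def by (metis vec_carrier)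
      have "ap ?I (mat_op \<rho>) v i = ap ?I (mat_op \<sigma>) (\<lambda>i. w $ i) i" if "i \<in> ?I" for i
      proof -
        have "ap ?I (mat_op \<rho>) v i = ap ?I (mat_op \<rho>) (\<lambda>i. vec n v $ i) i" by (rule ap_cong) auto
        also have "\<dots> = (\<rho> *\<^sub>v vec n v) $ i" using that by (intro ap_mat_op[OF R(1), symmetric]) auto
        also have "\<dots> = ap ?I (mat_op \<sigma>) (\<lambda>i. w $ i) i" unfolding w(2) using that w by (intro ap_mat_op[OF S(1)]) auto
        finally show ?thesis .
      qed
      then have "ip ?I v (ap ?I (mat_op \<rho>) v) = ip ?I v (ap ?I (mat_op \<sigma>) (\<lambda>i. w $ i))" by (intro ip_cong) auto
      also have "\<dots> = ip ?I (ap ?I (mat_op \<sigma>) v) (\<lambda>i. w $ i)" using S(2) unfolding pos_def by (intro herm_ip) auto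
      also have "\<dots> = ip ?I (\<lambda>_. 0) (\<lambda>i. w $ i)" using pos_kernel[OF finite_lessThan S(2) v] by (intro ip_cong) auto
      finally show "qf ?I (mat_op \<rho>) v = 0" unfolding qf_def by (simp add: ip_def)
    qed
  }
  {
    assume k: "ker_le ?I (mat_op \<rho>) (mat_op \<sigma>)"
    obtain U d where U: "spec ?I (mat_op \<sigma>) U d" using pos_spectral[OF finite_lessThan S(2)] by blast
    show "supp_le n \<rho> \<sigma>" unfolding supp_le_def
    proof
      fix v :: "complex vec" assume v: "v \<in> carrier_vec n"
      define u where "u = ap ?I (mat_op \<rho>) (\<lambda>i. v $ i)"
      have z: "ip ?I (U k) u = 0" if "k \<in> ?I" "d k = 0" for k
      proof -
        have "qf ?I (mat_op \<rho>) (U k) = 0" using k spec_qf_basis[OF U finite_lessThan that(1)] that(2) unfolding ker_le_def by simp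
        then have "ap ?I (mat_op \<rho>) (U k) i = 0" if "i \<in> ?I" for i using pos_kernel[OF finite_lessThan R(2) _ that] by blast
        then have "ip ?I (ap ?I (mat_op \<rho>) (U k)) (\<lambda>i. v $ i) = 0" unfolding ip_def by (intro sum.neutral) auto
        then show ?thesis unfolding u_def using R(2) herm_ip[of ?I "mat_op \<rho>" "U k"] unfolding pos_def by simp
      qed
      \<comment> \<open>1 / 0 = 0 makes this the generalized inverse of \<sigma> applied to \<rho>
        v.\<close>
      define w where "w = ap ?I (spc ?I U (\<lambda>k. 1 / d k)) u"
      have "\<rho> *\<^sub>v v = \<sigma> *\<^sub>v vec n w"
      proof (rule eq_vecI)
        fix i assume "i < dim_vec (\<sigma> *\<^sub>v vec n w)"
        then have i: "i < n" using S(1) by auto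
        have "(\<sigma> *\<^sub>v vec n w) $ i = ap ?I (mat_op \<sigma>) (\<lambda>i. vec n w $ i) i" by (rule ap_mat_op[OF S(1) _ i]) auto
        also have "\<dots> = ap ?I (mat_op \<sigma>) w i" by (rule ap_cong) auto
        also have "\<dots> = ap ?I (spc ?I U d) w i" using spec_ap[OF U] i by auto
        also have "\<dots> = (\<Sum>k<n. ip ?I (U k) u * U k i)"
          unfolding w_def ap_spc_spc[OF spec_onb[OF U] finite_lessThan] unfolding ap_spc
        proof (intro sum.cong refl)
          fix k assume "k \<in> ?I"
          then show "of_real (d k * (1 / d k)) * ip ?I (U k) u * U k i = ip ?I (U k) u * U k i"
            using z[of k] by (cases "d k = 0") auto
        qed
        also have "\<dots> = u i" using onb_expand[OF spec_onb[OF U], of i u] i by simp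
        also have "\<dots> = (\<rho> *\<^sub>v v) $ i" unfolding u_def by (rule ap_mat_op[OF R(1) v i, symmetric])
        finally show "(\<rho> *\<^sub>v v) $ i = (\<sigma> *\<^sub>v vec n w) $ i" by simp
      qed (use R S in auto)
      then show "\<exists>w\<in>carrier_vec n. \<rho> *\<^sub>v v = \<sigma> *\<^sub>v w" by (metis vec_carrier)
    qed
  }
qed

lemma mat_op_mult: assumes "A \<in> carrier_mat n n" "B \<in> carrier_mat n n" "i < n" "j < n"
  shows "mat_op (A * B) i j = mm {..<n} (mat_op A) (mat_op B) i j"
  using assms by (simp add: mat_op_def mm_def scalar_prod_def atLeast0LessThan)

text \<open>The decompositions hidden in the inner and the outer \<open>mpow\<close> are themselves
  witnesses for \<open>sandQ\<close>; the trace of the outer power is the sum of the powers of the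
  eigenvalues.\<close>

lemma sandwiched_sandQ_base: assumes a: "\<alpha> > 1" and r: "psd n \<rho>" and s: "psd n \<sigma>" and k: "ker_le {..<n} (mat_op \<rho>) (mat_op \<sigma>)"
  shows "\<exists>q D. sandQ \<alpha> {..<n} (mat_op \<rho>) (mat_op \<sigma>) q D \<and> sandwiched \<alpha> n \<rho> \<sigma> = log_div \<alpha> q"
proof -
  let ?I = "{..<n}"
  define t where "t = (1 - \<alpha>) / (2 * \<alpha>)"
  have R: "\<rho> \<in> carrier_mat n n" "pos ?I (mat_op \<rho>)" and S: "\<sigma> \<in> carrier_mat n n" "pos ?I (mat_op \<sigma>)" using r s unfolding psd_iff by auto
  obtain U d where U: "spec ?I (mat_op \<sigma>) U d" "\<And>k. 0 \<le> d k" "mpow \<sigma> t \<in> carrier_mat n n" 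
    "spec ?I (mat_op (mpow \<sigma> t)) U (\<lambda>k. d k powr t)" by (rule mpow_spec[OF s, where p = t]) (rule that)
  let ?H = "spc ?I U (\<lambda>k. d k powr t)"
  define M where "M = mpow \<sigma> t * \<rho> * mpow \<sigma> t"
  have M: "M \<in> carrier_mat n n" unfolding M_def using U R by auto
  have nM: "mat_op M i j = mm ?I ?H (mm ?I (mat_op \<rho>) ?H) i j" if ij: "i \<in> ?I" "j \<in> ?I" for i j
  proof -
    have "M = mpow \<sigma> t * (\<rho> * mpow \<sigma> t)" unfolding M_def by (rule assoc_mult_mat[OF U(3) R(1) U(3)])
    then have "mat_op M i j = mm ?I (mat_op (mpow \<sigma> t)) (mat_op (\<rho> * mpow \<sigma> t)) i j"
      using mat_op_mult[OF U(3) mult_carrier_mat[OF R(1) U(3)]] ij by simp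
    also have "\<dots> = mm ?I ?H (mm ?I (mat_op \<rho>) ?H) i j"
    proof (rule mm_cong)
      fix k assume "k \<in> ?I"
      then show "mat_op (mpow \<sigma> t) i k = ?H i k" using U(4) ij unfolding spec_def by blast
      have "mat_op (\<rho> * mpow \<sigma> t) k j = mm ?I (mat_op \<rho>) (mat_op (mpow \<sigma> t)) k j"
        using mat_op_mult[OF R(1) U(3)] ij \<open>k \<in> ?I\<close> by simp
      also have "\<dots> = mm ?I (mat_op \<rho>) ?H k j" using U(4) ij unfolding spec_def by (intro mm_cong) auto
      finally show "mat_op (\<rho> * mpow \<sigma> t) k j = mm ?I (mat_op \<rho>) ?H k j" .
    qed
    finally show ?thesis .
  qed
  have pM: "psd n M" unfolding psd_iff
    using M pos_conj[OF finite_lessThan herm_spc R(2)] pos_cong[of ?I "mat_op M" "mm ?I ?H (mm ?I (mat_op \<rho>) ?H)", OF nM] by blast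
  obtain W z where W: "spec ?I (mat_op M) W z" "mpow M \<alpha> \<in> carrier_mat n n" "spec ?I (mat_op (mpow M \<alpha>)) W (\<lambda>k. z k powr \<alpha>)"
    by (rule mpow_spec[OF pM, where p = \<alpha>]) (rule that)
  have "mtrace (mpow M \<alpha>) = (\<Sum>i<n. mat_op (mpow M \<alpha>) i i)" using W(2) unfolding mtrace_def mat_op_def by auto
  also have "\<dots> = of_real (\<Sum>k<n. z k powr \<alpha>)" by (rule spec_trace[OF W(3) finite_lessThan])
  finally have tr: "Re (mtrace (mpow M \<alpha>)) = (\<Sum>k<n. z k powr \<alpha>)" by simp
  have "sandQ \<alpha> ?I (mat_op \<rho>) (mat_op \<sigma>) (\<Sum>k\<in>?I. z k powr \<alpha>) (d ` ?I)"
  proof (rule sandQ_I[OF _ _ R(2) U(1)])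
    fix k assume kI: "k \<in> ?I"
    show "0 \<le> d k \<and> d k \<in> d ` ?I \<and> (d k = 0 \<longrightarrow> qf ?I (mat_op \<rho>) (U k) = 0)"
      using U(2) kI k spec_qf_basis[OF U(1) finite_lessThan kI] unfolding ker_le_def by auto
  next
    show "spec ?I (mm ?I (spc ?I U (\<lambda>k. d k powr ((1 - \<alpha>) / (2 * \<alpha>)))) (mm ?I (mat_op \<rho>) (spc ?I U (\<lambda>k. d k powr ((1 - \<alpha>) / (2 * \<alpha>)))))) W z"
      using W(1) spec_cong[of ?I "mat_op M" "mm ?I ?H (mm ?I (mat_op \<rho>) ?H)", OF nM] unfolding t_def by blast
  qed auto
  moreover have "sandwiched \<alpha> n \<rho> \<sigma> = log_div \<alpha> (\<Sum>k\<in>?I. z k powr \<alpha>)"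
    using k unfolding sandwiched_def Let_def t_def[symmetric] M_def[symmetric] tr log_div_def supp_le_iff[OF r s] by simp
  ultimately show ?thesis by blast
qed

lemma ker_le_grid: "ker_le {..<r * x} (mat_op \<rho>) (mat_op \<sigma>) \<longleftrightarrow> ker_le (grid r x) (grid_op x \<rho>) (grid_op x \<sigma>)"
proof
  assume "ker_le {..<r * x} (mat_op \<rho>) (mat_op \<sigma>)"
  then show "ker_le (grid r x) (grid_op x \<rho>) (grid_op x \<sigma>)" unfolding grid_op_def by (rule ker_le_reindex[OF bij_grid_code])
next
  assume k: "ker_le (grid r x) (grid_op x \<rho>) (grid_op x \<sigma>)"
  show "ker_le {..<r * x} (mat_op \<rho>) (mat_op \<sigma>)" unfolding ker_le_def
  proof (intro allI impI)
    fix v assume "qf {..<r * x} (mat_op \<sigma>) v = 0"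
    then have "qf (grid r x) (grid_op x \<sigma>) (\<lambda>i. v (grid_code x i)) = 0" unfolding grid_op_def qf_reindex[OF bij_grid_code] .
    then have "qf (grid r x) (grid_op x \<rho>) (\<lambda>i. v (grid_code x i)) = 0" using k unfolding ker_le_def by blast
    then show "qf {..<r * x} (mat_op \<rho>) v = 0" unfolding grid_op_def qf_reindex[OF bij_grid_code] .
  qed
qed

text \<open>The matrices supply one value of Q, and by uniqueness every other decomposition gives
  the same.\<close>

lemma sandwiched_sandQ: assumes a: "\<alpha> > 1" and r: "psd (r * x) \<rho>" and s: "psd (r * x) \<sigma>"
    and Q: "sandQ \<alpha> (grid r x) (grid_op x \<rho>) (grid_op x \<sigma>) q D"
  shows "sandwiched \<alpha> (r * x) \<rho> \<sigma> = log_div \<alpha> q"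
proof -
  have "ker_le (grid r x) (grid_op x \<rho>) (grid_op x \<sigma>)" unfolding ker_le_def using sandQ_kernel[OF Q] by blast
  then have "ker_le {..<r * x} (mat_op \<rho>) (mat_op \<sigma>)" unfolding ker_le_grid .
  then obtain q' D' where Q': "sandQ \<alpha> {..<r * x} (mat_op \<rho>) (mat_op \<sigma>) q' D'" and e: "sandwiched \<alpha> (r * x) \<rho> \<sigma> = log_div \<alpha> q'"
    using sandwiched_sandQ_base[OF a r s] by blast
  have "sandQ \<alpha> (grid r x) (grid_op x \<rho>) (grid_op x \<sigma>) q' D'" unfolding grid_op_def by (rule sandQ_reindex[OF a bij_grid_code Q'])
  then have "q' = q" using sandQ_unique[OF a _ Q] by blast
  then show ?thesis using e by simp
qed

lemma sandwiched_infinite: assumes "psd (r * x) \<rho>" "psd (r * x) \<sigma>" "\<not> ker_le (grid r x) (grid_op x \<rho>) (grid_op x \<sigma>)"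
  shows "sandwiched \<alpha> (r * x) \<rho> \<sigma> = \<infinity>"
  using assms supp_le_iff[OF assms(1,2)] unfolding ker_le_grid sandwiched_def by simp

section \<open>Choi operators of matrix maps\<close>

definition choi_op :: "nat \<Rightarrow> (complex mat \<Rightarrow> complex mat) \<Rightarrow> (nat \<times> nat) op" where
  "choi_op x N = (\<lambda>i j. N (E x (fst i) (fst j)) $$ (snd i, snd j))"

lemma lin_map_expand: assumes N: "lin_map dx dy N" and A: "A \<in> carrier_mat dx dx" and y: "y < dy" "y' < dy"
  shows "N A $$ (y,y') = (\<Sum>c<dx. \<Sum>c'<dx. A $$ (c,c') * N (E dx c c') $$ (y,y'))"
proof -
  \<comment> \<open>\<open>R S\<close> keeps the entries of \<open>A\<close> at positions in
    \<open>S\<close>, which allows an induction over positions.\<close>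
  define R where "R S = mat dx dx (\<lambda>p. if p \<in> S then A $$ p else 0)" for S :: "(nat \<times> nat) set"
  have RC: "R S \<in> carrier_mat dx dx" and EC: "E dx c c' \<in> carrier_mat dx dx" for S c c' unfolding R_def E_def by auto
  have NC: "B \<in> carrier_mat dx dx \<Longrightarrow> N B \<in> carrier_mat dy dy" for B using N unfolding lin_map_def by blast
  have "S \<subseteq> {..<dx} \<times> {..<dx} \<Longrightarrow> N (R S) $$ (y,y') = (\<Sum>p\<in>S. A $$ p * N (E dx (fst p) (snd p)) $$ (y,y'))" if "finite S" for S
    using that
  proof (induction S rule: finite_induct)
    case empty
    have "R {} = 0 \<cdot>\<^sub>m R {}" unfolding R_def by (rule eq_matI) auto
    then have "N (R {}) = 0 \<cdot>\<^sub>m N (R {})" using N RC[of "{}"] unfolding lin_map_def by metis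
    then have "N (R {}) $$ (y,y') = (0 \<cdot>\<^sub>m N (R {})) $$ (y,y')" by (rule arg_cong)
    also have "\<dots> = 0" using NC[OF RC[of "{}"]] y by simp
    finally show ?case by simp
  next
    case (insert p S)
    have p: "fst p < dx" "snd p < dx" using insert by auto
    have "R (insert p S) = R S + A $$ p \<cdot>\<^sub>m E dx (fst p) (snd p)"
      unfolding R_def E_def using insert(2) p by (intro eq_matI) auto
    then have "N (R (insert p S)) = N (R S) + A $$ p \<cdot>\<^sub>m N (E dx (fst p) (snd p))"
      using N RC[of S] EC unfolding lin_map_def by (metis smult_carrier_mat)
    then have "N (R (insert p S)) $$ (y,y') = N (R S) $$ (y,y') + A $$ p * N (E dx (fst p) (snd p)) $$ (y,y')"
      using y by (simp add: carrier_matD[OF NC[OF RC[of S]]] carrier_matD[OF NC[OF EC[of "fst p" "snd p"]]])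
    then show ?case using insert by simp
  qed
  from this[of "{..<dx} \<times> {..<dx}"] have "N (R ({..<dx} \<times> {..<dx})) $$ (y,y') = (\<Sum>c<dx. \<Sum>c'<dx. A $$ (c,c') * N (E dx c c') $$ (y,y'))"
    by (simp add: sum.cartesian_product split_def)
  moreover have "R ({..<dx} \<times> {..<dx}) = A" unfolding R_def using A by (intro eq_matI) auto
  ultimately show ?thesis by simp
qed

lemma grid_op_id_tensor: assumes N: "lin_map dx dy N" and ij: "i \<in> grid r dy" "j \<in> grid r dy"
  shows "grid_op dy (id_tensor r dx dy N \<rho>) i j = chan dx (choi_op dx N) (grid_op dx \<rho>) i j"
proof -
  have i: "fst i < r" "snd i < dy" "fst j < r" "snd j < dy" using ij unfolding grid_def by auto
  have p: "grid_code dy i < r * dy" "grid_code dy j < r * dy" unfolding grid_code_def using i by (auto intro: mult_add_less)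
  let ?B = "mat dx dx (\<lambda>(k,l). \<rho> $$ (fst i * dx + k, fst j * dx + l))"
  have "grid_op dy (id_tensor r dx dy N \<rho>) i j = N ?B $$ (snd i, snd j)"
    unfolding grid_op_def mat_op_def id_tensor_def using p i by (simp add: grid_code_def)
  also have "\<dots> = (\<Sum>c<dx. \<Sum>c'<dx. ?B $$ (c,c') * N (E dx c c') $$ (snd i, snd j))"
    by (rule lin_map_expand[OF N]) (use i in auto)
  also have "\<dots> = chan dx (choi_op dx N) (grid_op dx \<rho>) i j"
    unfolding chan_def choi_op_def grid_op_def mat_op_def grid_code_def by (intro sum.cong refl) auto
  finally show ?thesis .
qed

lemma grid_op_choi: assumes ij: "i \<in> grid x y" "j \<in> grid x y"
  shows "grid_op y (choi x y T) i j = choi_op x T i j"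
proof -
  have i: "fst i < x" "snd i < y" "fst j < x" "snd j < y" using ij unfolding grid_def by auto
  have p: "grid_code y i < x * y" "grid_code y j < x * y" unfolding grid_code_def using i by (auto intro: mult_add_less)
  have "mat x x (\<lambda>(k,l). Phi x $$ (fst i * x + k, fst j * x + l)) = E x (fst i) (fst j)"
    unfolding Phi_def E_def using i by (intro eq_matI) (auto simp: mult_add_less)
  then show ?thesis
    unfolding choi_def grid_op_def mat_op_def id_tensor_def choi_op_def using p i by (simp add: grid_code_def)
qed

lemma choi_carrier: "choi x y T \<in> carrier_mat (x * y) (x * y)"
  unfolding choi_def id_tensor_def by simp

text \<open>\<open>Phi\<close> is the rank-one operator of the vector of the identity, so complete
  positivity applies with reference dimension \<open>dx\<close>.\<close>

lemma pos_choi_op: assumes "cp_map dx dy N" shows "pos (grid dx dy) (choi_op dx N)"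
proof -
  have "psd (dx * dx) (Phi dx)"
  proof -
    have "pos (grid dx dx) (pure (\<lambda>i. if fst i = snd i then 1 else 0))" by (rule pos_pure)
    moreover have "grid_op dx (Phi dx) i j = pure (\<lambda>i. if fst i = snd i then 1 else 0) i j" if "i \<in> grid dx dx" "j \<in> grid dx dx" for i j
      using that unfolding grid_op_def mat_op_def Phi_def grid_code_def grid_def pure_def by (auto simp: mult_add_less)
    ultimately have "pos (grid dx dx) (grid_op dx (Phi dx))" using pos_cong by (metis (no_types, lifting))
    then show ?thesis unfolding psd_grid by (simp add: Phi_def)
  qed
  then have "psd (dx * dy) (choi dx dy N)" using assms unfolding cp_map_def choi_def by blast
  then have "pos (grid dx dy) (grid_op dy (choi dx dy N))" unfolding psd_grid by simp
  then show ?thesis using grid_op_choi pos_cong by (metis (no_types, lifting))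
qed

lemma sum4_delta:
  fixes f :: "nat \<Rightarrow> nat \<Rightarrow> nat \<Rightarrow> nat \<Rightarrow> 'a::comm_monoid_add"
  assumes "A < m" "B < m" "C < n" "D < n"
  shows "(\<Sum>a<m. \<Sum>b<m. \<Sum>c<n. \<Sum>d<n. if d = D then if c = C then if b = B then if a = A then f a b c d else 0 else 0 else 0 else 0) = f A B C D"
  using assms by (simp add: sum.delta)

text \<open>A matrix unit of a product space is the product of the matrix units at quotient and
  remainder indices, so one term of the fourfold sum in \<open>tensor_map\<close> survives.
  Agreement is claimed on the grid only, and later lemmas ask for no more.\<close>

lemma choi_op_tpow: "i \<in> grid (dx ^ n) (dy ^ n) \<Longrightarrow> j \<in> grid (dx ^ n) (dy ^ n) \<Longrightarrow>
   choi_op (dx ^ n) (tpow dx dy n N) i j = tens_pow dx dy dx dy n (choi_op dx N) i j"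
proof (induction n arbitrary: i j)
  case 0
  then show ?case unfolding grid_def choi_op_def E_def by auto
next
  case (Suc n)
  let ?X = "dx ^ n" and ?Y = "dy ^ n"
  have ij: "fst i < ?X * dx" "snd i < ?Y * dy" "fst j < ?X * dx" "snd j < ?Y * dy" 
    using Suc.prems unfolding grid_def by (auto simp: mult.commute)
  let ?f = "\<lambda>a b c d. tpow dx dy n N (E ?X a b) $$ (snd i div dy, snd j div dy) * N (E dx c d) $$ (snd i mod dy, snd j mod dy)"
  have "choi_op (dx ^ Suc n) (tpow dx dy (Suc n) N) i j = 
     (\<Sum>a<?X. \<Sum>b<?X. \<Sum>c<dx. \<Sum>d<dx. E (?X * dx) (fst i) (fst j) $$ (a * dx + c, b * dx + d) * 
        tpow dx dy n N (E ?X a b) $$ (snd i div dy, snd j div dy) * N (E dx c d) $$ (snd i mod dy, snd j mod dy))"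
    unfolding choi_op_def power_Suc2 tpow.simps tensor_map_def using ij by simp
  also have "\<dots> = (\<Sum>a<?X. \<Sum>b<?X. \<Sum>c<dx. \<Sum>d<dx. if d = fst j mod dx then if c = fst i mod dx then if b = fst j div dx then if a = fst i div dx then ?f a b c d else 0 else 0 else 0 else 0)"
  proof (intro sum.cong refl)
    fix a b c d assume "a \<in> {..<?X}" "b \<in> {..<?X}" "c \<in> {..<dx}" "d \<in> {..<dx}"
    then have b: "a < ?X" "b < ?X" "c < dx" "d < dx" by auto
    have e: "a * dx + c = k \<longleftrightarrow> a = k div dx \<and> c = k mod dx" if "c < dx" for a c k
      using that by auto
    have "E (?X * dx) (fst i) (fst j) $$ (a * dx + c, b * dx + d) = (if a * dx + c = fst i \<and> b * dx + d = fst j then 1 else 0)"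
      unfolding E_def using mult_add_less[OF b(1,3)] mult_add_less[OF b(2,4)] by simp
    then show "E (?X * dx) (fst i) (fst j) $$ (a * dx + c, b * dx + d) * tpow dx dy n N (E ?X a b) $$ (snd i div dy, snd j div dy) * N (E dx c d) $$ (snd i mod dy, snd j mod dy)
      = (if d = fst j mod dx then if c = fst i mod dx then if b = fst j div dx then if a = fst i div dx then ?f a b c d else 0 else 0 else 0 else 0)"
      unfolding e[OF b(3)] e[OF b(4)] by simp
  qed
  also have "\<dots> = ?f (fst i div dx) (fst j div dx) (fst i mod dx) (fst j mod dx)"
    by (rule sum4_delta) (use div_mod_less ij in auto)
  also have "\<dots> = choi_op ?X (tpow dx dy n N) (fst (grid_split dx dy i)) (fst (grid_split dx dy j)) * choi_op dx N (snd (grid_split dx dy i)) (snd (grid_split dx dy j))"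
    unfolding choi_op_def grid_split_def by simp
  also have "\<dots> = tens_pow dx dy dx dy n (choi_op dx N) (fst (grid_split dx dy i)) (fst (grid_split dx dy j)) * choi_op dx N (snd (grid_split dx dy i)) (snd (grid_split dx dy j))"
    by (subst Suc.IH) (use div_mod_less ij in \<open>auto simp: grid_split_def grid_def\<close>)
  finally show ?case unfolding tens_pow.simps tens_def .
qed

lemma kron_one_left: assumes L: "L \<in> carrier_mat x x" and p: "p < x * y"
  shows "(\<Sum>m<x * y. kron L (1\<^sub>m y) $$ (p,m) * g m) = (\<Sum>c<x. L $$ (p div y, c) * g (c * y + p mod y))"
proof -
  have y: "p mod y < y" using p by (cases y) auto
  have "(\<Sum>m<x * y. kron L (1\<^sub>m y) $$ (p,m) * g m) = (\<Sum>m<x * y. L $$ (p div y, m div y) * (if m mod y = p mod y then g m else 0))"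
    using p L y by (intro sum.cong refl) (auto simp: kron_def)
  also have "\<dots> = (\<Sum>m<x * y. L $$ (p div y, m div y) * (if m mod y = p mod y then g (m div y * y + m mod y) else 0))"
    by (simp only: div_mult_mod_eq)
  also have "\<dots> = (\<Sum>c<x. \<Sum>b<y. L $$ (p div y, c) * (if b = p mod y then g (c * y + b) else 0))"
    by (rule sum_divmod[where g = "\<lambda>c b. L $$ (p div y, c) * (if b = p mod y then g (c * y + b) else 0)"])
  also have "\<dots> = (\<Sum>c<x. L $$ (p div y, c) * g (c * y + p mod y))"
    using y by (simp add: sum_distrib_left[symmetric])
  finally show ?thesis .
qed

lemma kron_one_right: assumes L: "L \<in> carrier_mat x x" and q: "q < x * y"
  shows "(\<Sum>m<x * y. g m * kron L (1\<^sub>m y) $$ (m,q)) = (\<Sum>c<x. g (c * y + q mod y) * L $$ (c, q div y))"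
proof -
  have y: "q mod y < y" using q by (cases y) auto
  have "(\<Sum>m<x * y. g m * kron L (1\<^sub>m y) $$ (m,q)) = (\<Sum>m<x * y. (if m mod y = q mod y then g m else 0) * L $$ (m div y, q div y))"
    using q L y by (intro sum.cong refl) (auto simp: kron_def)
  also have "\<dots> = (\<Sum>m<x * y. (if m mod y = q mod y then g (m div y * y + m mod y) else 0) * L $$ (m div y, q div y))"
    by (simp only: div_mult_mod_eq)
  also have "\<dots> = (\<Sum>c<x. \<Sum>b<y. (if b = q mod y then g (c * y + b) else 0) * L $$ (c, q div y))"
    by (rule sum_divmod[where g = "\<lambda>c b. (if b = q mod y then g (c * y + b) else 0) * L $$ (c, q div y)"])
  also have "\<dots> = (\<Sum>c<x. g (c * y + q mod y) * L $$ (c, q div y))"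
    using y by (simp add: sum_distrib_right[symmetric])
  finally show ?thesis .
qed

lemma kron_carrier: "A \<in> carrier_mat a b \<Longrightarrow> B \<in> carrier_mat c d \<Longrightarrow> kron A B \<in> carrier_mat (a * c) (b * d)"
  unfolding kron_def by auto

text \<open>Conjugating a Choi operator by L \<otimes> I is feeding the channel with the pure state
  of coefficient matrix L; Hermiticity turns the right-hand copy of L into the conjugate required by
  \<open>pure\<close>.\<close>

lemma grid_op_kron_conj: assumes L: "L \<in> carrier_mat x x" and C: "C \<in> carrier_mat (x * y) (x * y)" and h: "herm {..<x} (mat_op L)"
    and ij: "i \<in> grid x y" "j \<in> grid x y"
  shows "grid_op y (kron L (1\<^sub>m y) * C * kron L (1\<^sub>m y)) i j = chan x (grid_op y C) (pure (\<lambda>i. mat_op L (fst i) (snd i))) i j"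
proof -
  let ?W = "kron L (1\<^sub>m y)"
  have i: "fst i < x" "snd i < y" "fst j < x" "snd j < y" using ij unfolding grid_def by auto
  have p: "grid_code y i < x * y" "grid_code y j < x * y" unfolding grid_code_def using i by (auto intro: mult_add_less)
  have W: "?W \<in> carrier_mat (x * y) (x * y)" by (rule kron_carrier[OF L]) simp
  have "grid_op y (?W * C * ?W) i j = (\<Sum>m<x * y. (?W * C) $$ (grid_code y i, m) * ?W $$ (m, grid_code y j))"
    using mat_op_mult[OF mult_carrier_mat[OF W C] W p] unfolding grid_op_def mm_def mat_op_def .
  also have "\<dots> = (\<Sum>c'<x. (?W * C) $$ (grid_code y i, c' * y + snd j) * L $$ (c', fst j))"
    unfolding kron_one_right[OF L p(2)] using i by (simp add: grid_code_def)
  also have "\<dots> = (\<Sum>c'<x. (\<Sum>c<x. L $$ (fst i, c) * C $$ (c * y + snd i, c' * y + snd j)) * L $$ (c', fst j))"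
  proof (intro sum.cong refl)
    fix c' assume c': "c' \<in> {..<x}"
    then have q: "c' * y + snd j < x * y" using i by (auto intro: mult_add_less)
    have "(?W * C) $$ (grid_code y i, c' * y + snd j) = (\<Sum>m<x * y. ?W $$ (grid_code y i, m) * C $$ (m, c' * y + snd j))"
      using mat_op_mult[OF W C p(1) q] unfolding mm_def mat_op_def .
    also have "\<dots> = (\<Sum>c<x. L $$ (fst i, c) * C $$ (c * y + snd i, c' * y + snd j))"
      unfolding kron_one_left[OF L p(1)] using i by (simp add: grid_code_def)
    finally show "(?W * C) $$ (grid_code y i, c' * y + snd j) * L $$ (c', fst j) = (\<Sum>c<x. L $$ (fst i, c) * C $$ (c * y + snd i, c' * y + snd j)) * L $$ (c', fst j)" by simp
  qed
  also have "\<dots> = (\<Sum>c'<x. \<Sum>c<x. L $$ (fst i, c) * cnj (L $$ (fst j, c')) * C $$ (c * y + snd i, c' * y + snd j))"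
  proof (intro sum.cong refl)
    fix c' assume "c' \<in> {..<x}"
    then have "L $$ (c', fst j) = cnj (L $$ (fst j, c'))" using hermD[OF h, of "fst j" c'] i unfolding mat_op_def by simp
    then show "(\<Sum>c<x. L $$ (fst i, c) * C $$ (c * y + snd i, c' * y + snd j)) * L $$ (c', fst j) = (\<Sum>c<x. L $$ (fst i, c) * cnj (L $$ (fst j, c')) * C $$ (c * y + snd i, c' * y + snd j))"
      by (simp add: sum_distrib_left sum_distrib_right mult_ac)
  qed
  also have "\<dots> = (\<Sum>c<x. \<Sum>c'<x. L $$ (fst i, c) * cnj (L $$ (fst j, c')) * C $$ (c * y + snd i, c' * y + snd j))" by (rule sum.swap)
  finally show ?thesis unfolding chan_def pure_def grid_op_def mat_op_def grid_code_def by simp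
qed

section \<open>Terms of the channel divergence\<close>

lemma chan_cong: assumes "\<And>i j. i \<in> grid x y \<Longrightarrow> j \<in> grid x y \<Longrightarrow> J i j = J' i j" 
    "\<And>i j. i \<in> grid r x \<Longrightarrow> j \<in> grid r x \<Longrightarrow> \<rho> i j = \<rho>' i j" "i \<in> grid r y" "j \<in> grid r y"
  shows "chan x J \<rho> i j = chan x J' \<rho>' i j"
  unfolding chan_def using assms by (intro sum.cong refl arg_cong2[where f = "(*)"]) (auto simp: grid_def)

text \<open>The vector with coefficient matrix \<omega>^(1/2): the canonical purification of the
  state with eigenbasis \<open>U\<close> and eigenvalues \<open>d\<close>.\<close>

definition sqrt_vec :: "nat \<Rightarrow> (nat \<Rightarrow> nat \<Rightarrow> complex) \<Rightarrow> (nat \<Rightarrow> real) \<Rightarrow> nat \<times> nat \<Rightarrow> complex" where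
  "sqrt_vec x U d = (\<lambda>i. spc {..<x} U (\<lambda>k. sqrt (d k)) (fst i) (snd i))"

definition chan_term :: "real \<Rightarrow> nat \<Rightarrow> nat \<Rightarrow> (complex mat \<Rightarrow> complex mat) \<Rightarrow> (complex mat \<Rightarrow> complex mat) \<Rightarrow> complex mat \<Rightarrow> ereal" where
  "chan_term \<alpha> x y T S \<omega> = (let W = kron (mpow \<omega> (1/2)) (1\<^sub>m y)
         in sandwiched \<alpha> (x * y) (W * choi x y T * W) (W * choi x y S * W))"

text \<open>Rewrites one term of the supremum in \<open>chan_div\<close> as a comparison of outputs
  on the canonical purification of \<omega>, formed with whatever basis \<open>mpow\<close> has
  chosen.\<close>

lemma chan_term_cases:
  assumes a: "\<alpha> > 1" and \<omega>: "density x \<omega>" and J: "pos (grid x y) J" and K: "pos (grid x y) K"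
    and TJ: "\<And>i j. i \<in> grid x y \<Longrightarrow> j \<in> grid x y \<Longrightarrow> choi_op x T i j = J i j"
    and SK: "\<And>i j. i \<in> grid x y \<Longrightarrow> j \<in> grid x y \<Longrightarrow> choi_op x S i j = K i j"
  obtains U d where "spec {..<x} (mat_op \<omega>) U d" "\<And>k. 0 \<le> d k"
    "\<not> ker_le (grid x y) (chan x J (pure (sqrt_vec x U d))) (chan x K (pure (sqrt_vec x U d))) \<Longrightarrow> chan_term \<alpha> x y T S \<omega> = \<infinity>"
    "\<And>q D. sandQ \<alpha> (grid x y) (chan x J (pure (sqrt_vec x U d))) (chan x K (pure (sqrt_vec x U d))) q D \<Longrightarrow> chan_term \<alpha> x y T S \<omega> = log_div \<alpha> q"
proof -
  have p\<omega>: "psd x \<omega>" using \<omega> unfolding density_def by simp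
  define L where "L = mpow \<omega> (1/2)"
  obtain U d where U: "spec {..<x} (mat_op \<omega>) U d" "\<And>k. 0 \<le> d k" "L \<in> carrier_mat x x" 
    "spec {..<x} (mat_op L) U (\<lambda>k. d k powr (1/2))" by (rule mpow_spec[OF p\<omega>, where p = "1/2", folded L_def]) (rule that)
  have L: "spec {..<x} (mat_op L) U (\<lambda>k. sqrt (d k))" using U(4) U(2) by (simp add: powr_half_sqrt)
  let ?W = "kron L (1\<^sub>m y)"
  have W: "?W \<in> carrier_mat (x * y) (x * y)" by (rule kron_carrier[OF U(3)]) simp
  have C: "?W * choi x y F * ?W \<in> carrier_mat (x * y) (x * y)" for F using W choi_carrier by auto
  have pe: "pure (\<lambda>i. mat_op L (fst i) (snd i)) i j = pure (sqrt_vec x U d) i j" if "i \<in> grid x x" "j \<in> grid x x" for i j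
    using that L unfolding pure_def sqrt_vec_def spec_def grid_def by auto
  have e1: "grid_op y (?W * choi x y T * ?W) i j = chan x J (pure (sqrt_vec x U d)) i j" if "i \<in> grid x y" "j \<in> grid x y" for i j
    unfolding grid_op_kron_conj[OF U(3) choi_carrier spec_herm[OF L] that]
    by (rule chan_cong[OF _ pe that]) (simp add: grid_op_choi TJ)
  have e2: "grid_op y (?W * choi x y S * ?W) i j = chan x K (pure (sqrt_vec x U d)) i j" if "i \<in> grid x y" "j \<in> grid x y" for i j
    unfolding grid_op_kron_conj[OF U(3) choi_carrier spec_herm[OF L] that]
    by (rule chan_cong[OF _ pe that]) (simp add: grid_op_choi SK)
  have p1: "psd (x * y) (?W * choi x y T * ?W)" 
  proof -
    have "pos (grid x y) (grid_op y (?W * choi x y T * ?W)) = pos (grid x y) (chan x J (pure (sqrt_vec x U d)))"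
      by (rule pos_cong) (rule e1; assumption)
    then show ?thesis unfolding psd_grid using C pos_chan[OF pos_pure J] by simp
  qed
  have p2: "psd (x * y) (?W * choi x y S * ?W)" 
  proof -
    have "pos (grid x y) (grid_op y (?W * choi x y S * ?W)) = pos (grid x y) (chan x K (pure (sqrt_vec x U d)))"
      by (rule pos_cong) (rule e2; assumption)
    then show ?thesis unfolding psd_grid using C pos_chan[OF pos_pure K] by simp
  qed
  have ke: "ker_le (grid x y) (grid_op y (?W * choi x y T * ?W)) (grid_op y (?W * choi x y S * ?W)) = 
      ker_le (grid x y) (chan x J (pure (sqrt_vec x U d))) (chan x K (pure (sqrt_vec x U d)))"
    by (rule ker_le_cong) (rule e1 e2; assumption)+
  have se: "sandQ \<alpha> (grid x y) (grid_op y (?W * choi x y T * ?W)) (grid_op y (?W * choi x y S * ?W)) q D = 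
      sandQ \<alpha> (grid x y) (chan x J (pure (sqrt_vec x U d))) (chan x K (pure (sqrt_vec x U d))) q D" for q D
    by (rule sandQ_cong) (rule e1 e2; assumption)+
  have ct: "chan_term \<alpha> x y T S \<omega> = sandwiched \<alpha> (x * y) (?W * choi x y T * ?W) (?W * choi x y S * ?W)"
    unfolding chan_term_def L_def Let_def ..
  show thesis
  proof (rule that[OF U(1,2)])
    show "\<not> ker_le (grid x y) (chan x J (pure (sqrt_vec x U d))) (chan x K (pure (sqrt_vec x U d))) \<Longrightarrow> chan_term \<alpha> x y T S \<omega> = \<infinity>"
      unfolding ct ke[symmetric] by (rule sandwiched_infinite[OF p1 p2])
    show "sandQ \<alpha> (grid x y) (chan x J (pure (sqrt_vec x U d))) (chan x K (pure (sqrt_vec x U d))) q D \<Longrightarrow> chan_term \<alpha> x y T S \<omega> = log_div \<alpha> q" for q D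
      unfolding ct se[symmetric] by (rule sandwiched_sandQ[OF a p1 p2])
  qed
qed

text \<open>Inverse to \<open>log_div\<close>, with \<open>- \<infinity>\<close> corresponding to $Q = 0$.\<close>

definition exp_div :: "real \<Rightarrow> ereal \<Rightarrow> real" where
  "exp_div \<alpha> c = (if c = - \<infinity> then 0 else 2 powr ((\<alpha> - 1) * real_of_ereal c))"

lemma exp_div_nonneg: "0 \<le> exp_div \<alpha> c" unfolding exp_div_def by simp

lemma log_div_zero: "\<alpha> > 1 \<Longrightarrow> log_div \<alpha> 0 = - \<infinity>" unfolding log_div_def by simp

lemma log_div_nonzero: "q \<noteq> 0 \<Longrightarrow> log_div \<alpha> q = ereal (log 2 q / (\<alpha> - 1))" unfolding log_div_def by simp

text \<open>\<open>exp_div\<close> takes the artificial value 2 powr 0 = 1 at \<infinity>, hence the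
  condition on \<open>c\<close>; at -\<infinity> both sides say q = 0.\<close>

lemma log_div_le: assumes a: "\<alpha> > 1" and q: "0 \<le> q" and c: "c \<noteq> \<infinity>" shows "log_div \<alpha> q \<le> c \<longleftrightarrow> q \<le> exp_div \<alpha> c"
proof (cases "q = 0")
  case True then show ?thesis using log_div_zero[OF a] exp_div_nonneg by simp
next
  case False
  then have q: "q > 0" using q by simp
  show ?thesis
  proof (cases c)
    case (real b)
    have "log_div \<alpha> q \<le> c \<longleftrightarrow> log 2 q \<le> (\<alpha> - 1) * b" using a False real by (simp add: log_div_nonzero divide_le_eq mult.commute)
    also have "\<dots> \<longleftrightarrow> q \<le> 2 powr ((\<alpha> - 1) * b)" using q by (simp add: log_le_iff)
    finally show ?thesis using real by (simp add: exp_div_def)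
  next
    case MInf
    then show ?thesis using q False by (simp add: exp_div_def log_div_nonzero)
  qed (use c in simp)
qed

lemma exp_div_add: assumes a: "\<alpha> > 1" and q: "0 < q" and c: "c \<noteq> \<infinity>" shows "exp_div \<alpha> (c + log_div \<alpha> q) = exp_div \<alpha> c * q"
proof (cases c)
  case (real b)
  have "2 powr ((\<alpha> - 1) * (b + log 2 q / (\<alpha> - 1))) = 2 powr ((\<alpha> - 1) * b + log 2 q)" using a by (simp add: distrib_left)
  also have "\<dots> = 2 powr ((\<alpha> - 1) * b) * q" using q by (simp add: powr_add)
  finally show ?thesis using real q by (simp add: exp_div_def log_div_nonzero)
next
  case MInf
  then show ?thesis using q by (simp add: exp_div_def log_div_nonzero)
qed (use c in simp)

text \<open>The Gram matrix \<omega> of \<psi> is a density, so its term is at most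
  \<open>c\<close>, and \<open>c \<noteq> \<infinity>\<close> forces the kernel inclusion.
  \<open>pure_input_bound\<close> then carries the estimate from \<omega>^(1/2) to \<psi>, for any
  reference dimension.\<close>

lemma chan_pure_bound:
  assumes a: "\<alpha> > 1" and J: "pos (grid x y) J" and K: "pos (grid x y) K"
    and TJ: "\<And>i j. i \<in> grid x y \<Longrightarrow> j \<in> grid x y \<Longrightarrow> choi_op x T i j = J i j"
    and SK: "\<And>i j. i \<in> grid x y \<Longrightarrow> j \<in> grid x y \<Longrightarrow> choi_op x S i j = K i j"
    and c: "chan_div \<alpha> x y T S = c" "c \<noteq> \<infinity>"
  shows "pure_bound \<alpha> r x y J K (exp_div \<alpha> c)"
  unfolding pure_bound_def
proof (intro allI impI)
  fix \<psi> assume n: "nrm2 (grid r x) \<psi> = 1"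
  define G where "G = (\<lambda>c c'. \<Sum>a<r. cnj (\<psi> (a,c)) * \<psi> (a,c'))"
  define \<omega> where "\<omega> = mat x x (\<lambda>(c,c'). G c c')"
  have nG: "mat_op \<omega> i j = G i j" if "i \<in> {..<x}" "j \<in> {..<x}" for i j using that unfolding mat_op_def \<omega>_def by simp
  have "herm {..<x} G" unfolding herm_def G_def by (simp add: mult.commute)
  moreover have "0 \<le> qf {..<x} G v" for v unfolding G_def qf_gram by (intro sum_nonneg) simp
  ultimately have "pos {..<x} G" unfolding pos_def by simp
  moreover have "pos {..<x} (mat_op \<omega>) = pos {..<x} G" by (rule pos_cong) (rule nG; assumption)
  ultimately have "pos {..<x} (mat_op \<omega>)" by simp
  then have "psd x \<omega>" unfolding psd_iff by (simp add: \<omega>_def)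
  moreover have "mtrace \<omega> = 1"
  proof -
    have "mtrace \<omega> = (\<Sum>c<x. \<Sum>a<r. of_real ((cmod (\<psi> (a,c)))\<^sup>2))"
      unfolding mtrace_def \<omega>_def G_def complex_norm_square by (simp add: mult.commute)
    also have "\<dots> = (\<Sum>a<r. \<Sum>c<x. of_real ((cmod (\<psi> (a,c)))\<^sup>2))" by (rule sum.swap)
    also have "\<dots> = of_real (nrm2 (grid r x) \<psi>)" unfolding nrm2_def sum_grid by simp
    finally show ?thesis using n by simp
  qed
  ultimately have d\<omega>: "density x \<omega>" unfolding density_def by simp
  obtain U d where U: "spec {..<x} (mat_op \<omega>) U d" and d: "\<And>k. 0 \<le> d k"
    and inf: "\<not> ker_le (grid x y) (chan x J (pure (sqrt_vec x U d))) (chan x K (pure (sqrt_vec x U d))) \<Longrightarrow> chan_term \<alpha> x y T S \<omega> = \<infinity>"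
    and val: "\<And>q D. sandQ \<alpha> (grid x y) (chan x J (pure (sqrt_vec x U d))) (chan x K (pure (sqrt_vec x U d))) q D \<Longrightarrow> chan_term \<alpha> x y T S \<omega> = log_div \<alpha> q"
    by (rule chan_term_cases[OF a d\<omega> J K TJ SK]) (assumption+, rule that)
  have UG: "spec {..<x} G U d" 
  proof -
    have "spec {..<x} (mat_op \<omega>) U d = spec {..<x} G U d" by (rule spec_cong) (rule nG; assumption)
    then show ?thesis using U by simp
  qed
  have le: "chan_term \<alpha> x y T S \<omega> \<le> c"
    unfolding c(1)[symmetric] chan_div_def chan_term_def using d\<omega> by (intro SUP_upper) simp
  then have kl: "ker_le (grid x y) (chan x J (pure (sqrt_vec x U d))) (chan x K (pure (sqrt_vec x U d)))"
    using inf c(2) by (cases "ker_le (grid x y) (chan x J (pure (sqrt_vec x U d))) (chan x K (pure (sqrt_vec x U d)))") auto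
  obtain q D where Q: "sandQ \<alpha> (grid x y) (chan x J (pure (sqrt_vec x U d))) (chan x K (pure (sqrt_vec x U d))) q D"
    using sandQ_exists[OF finite_grid pos_chan[OF pos_pure J] pos_chan[OF pos_pure K]] kl unfolding ker_le_def by blast
  have q: "q \<le> exp_div \<alpha> c" using le val[OF Q] log_div_le[OF a sandQ_nonneg[OF Q] c(2)] by simp
  note P = pure_input_bound[OF a J K UG[unfolded G_def] d, of "spc {..<x} U (\<lambda>k. sqrt (d k))", folded sqrt_vec_def, OF refl Q]
  show "(\<forall>v. qf (grid r y) (chan x K (pure \<psi>)) v = 0 \<longrightarrow> qf (grid r y) (chan x J (pure \<psi>)) v = 0) \<and>
    (\<forall>e. onb (grid r y) e \<longrightarrow> renyi_sum \<alpha> (grid r y) (chan x J (pure \<psi>)) (chan x K (pure \<psi>)) (grid r y) e \<le> exp_div \<alpha> c)"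
    using P(1) order_trans[OF P(2) q] by blast
qed

text \<open>The squared Hilbert-Schmidt norm of \<omega>^(1/2) is the trace of \<omega>; Parseval is
  applied to each column.\<close>

lemma nrm2_sqrt_vec: assumes U: "onb {..<x} U" and d: "\<And>k. 0 \<le> d k" shows "nrm2 (grid x x) (sqrt_vec x U d) = (\<Sum>k<x. d k)"
proof -
  have "(\<Sum>c'<x. (cmod (sqrt_vec x U d (c,c')))\<^sup>2) = (\<Sum>k<x. d k * (cmod (U k c))\<^sup>2)" if c: "c < x" for c
  proof -
    define v where "v = ap {..<x} (spc {..<x} U (\<lambda>k. sqrt (d k))) (\<lambda>j. if j = c then 1 else 0)"
    have vc: "v c' = spc {..<x} U (\<lambda>k. sqrt (d k)) c' c" for c'
      unfolding v_def ap_def using c by (simp add: if_distrib cong: if_cong)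
    have "(\<Sum>c'<x. (cmod (sqrt_vec x U d (c,c')))\<^sup>2) = nrm2 {..<x} v"
      unfolding nrm2_def
    proof (intro sum.cong refl)
      fix c' assume "c' \<in> {..<x}"
      then have "sqrt_vec x U d (c,c') = cnj (v c')"
        unfolding vc sqrt_vec_def using hermD[OF herm_spc, of c' "{..<x}" c U "\<lambda>k. sqrt (d k)"] c by simp
      then show "(cmod (sqrt_vec x U d (c,c')))\<^sup>2 = (cmod (v c'))\<^sup>2" by simp
    qed
    also have "\<dots> = (\<Sum>k<x. (cmod (ip {..<x} (U k) v))\<^sup>2)" by (rule parseval[OF U finite_lessThan, symmetric])
    also have "\<dots> = (\<Sum>k<x. d k * (cmod (U k c))\<^sup>2)"
      unfolding v_def using d c
      by (intro sum.cong refl) (simp add: ip_spc[OF U] ip_unit_right norm_mult power_mult_distrib)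
    finally show ?thesis .
  qed
  then have "nrm2 (grid x x) (sqrt_vec x U d) = (\<Sum>c<x. \<Sum>k<x. d k * (cmod (U k c))\<^sup>2)"
    unfolding nrm2_def sum_grid by (rule sum.cong[OF refl]) simp
  also have "\<dots> = (\<Sum>k<x. \<Sum>c<x. d k * (cmod (U k c))\<^sup>2)" by (rule sum.swap)
  also have "\<dots> = (\<Sum>k<x. d k * nrm2 {..<x} (U k))" unfolding nrm2_def sum_distrib_left ..
  also have "\<dots> = (\<Sum>k<x. d k)" using onb_nrm2[OF U] by simp
  finally show ?thesis .
qed

text \<open>Each state in the supremum is tested by the equal pair made of its purification, for
  which Q = 1 and kernel inclusion is trivial; the amortized bound then reads q \<le> b.\<close>

lemma chan_div_le:
  assumes a: "\<alpha> > 1" and J: "pos (grid x y) J" and K: "pos (grid x y) K"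
    and TJ: "\<And>i j. i \<in> grid x y \<Longrightarrow> j \<in> grid x y \<Longrightarrow> choi_op x T i j = J i j"
    and SK: "\<And>i j. i \<in> grid x y \<Longrightarrow> j \<in> grid x y \<Longrightarrow> choi_op x S i j = K i j"
    and b: "amort_bound \<alpha> x y J K b" and c: "c \<noteq> \<infinity>" "b \<le> exp_div \<alpha> c"
  shows "chan_div \<alpha> x y T S \<le> c"
  unfolding chan_div_def chan_term_def[symmetric]
proof (rule SUP_least)
  fix \<omega> assume "\<omega> \<in> {\<omega>. density x \<omega>}"
  then have d\<omega>: "density x \<omega>" by simp
  obtain U d where U: "spec {..<x} (mat_op \<omega>) U d" and d: "\<And>k. 0 \<le> d k"
    and val: "\<And>q D. sandQ \<alpha> (grid x y) (chan x J (pure (sqrt_vec x U d))) (chan x K (pure (sqrt_vec x U d))) q D \<Longrightarrow> chan_term \<alpha> x y T S \<omega> = log_div \<alpha> q"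
    by (rule chan_term_cases[OF a d\<omega> J K TJ SK]) (assumption+, rule that)
  have \<omega>C: "\<omega> \<in> carrier_mat x x" using d\<omega> unfolding density_def psd_def by simp
  have "(\<Sum>i<x. mat_op \<omega> i i) = mtrace \<omega>" using \<omega>C unfolding mtrace_def mat_op_def by auto
  then have "complex_of_real (\<Sum>k<x. d k) = 1" using spec_trace[OF U finite_lessThan] d\<omega> unfolding density_def by simp
  then have "nrm2 (grid x x) (sqrt_vec x U d) = 1" unfolding nrm2_sqrt_vec[OF spec_onb[OF U] d] by (simp only: of_real_eq_1_iff)
  then have "Re (\<Sum>i\<in>grid x x. pure (sqrt_vec x U d) i i) = 1"
    unfolding pure_def nrm2_def by (simp add: complex_norm_square[symmetric] del: of_real_power)
  then obtain D where Q: "sandQ \<alpha> (grid x x) (pure (sqrt_vec x U d)) (pure (sqrt_vec x U d)) 1 D"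
    using sandQ_refl[OF a finite_grid pos_pure] by metis
  have kl: "ker_le (grid x y) (chan x J (pure (sqrt_vec x U d))) (chan x K (pure (sqrt_vec x U d)))"
    using b pos_pure unfolding amort_bound_def ker_le_def by blast
  obtain q D' where Q': "sandQ \<alpha> (grid x y) (chan x J (pure (sqrt_vec x U d))) (chan x K (pure (sqrt_vec x U d))) q D'"
    using sandQ_exists[OF finite_grid pos_chan[OF pos_pure J] pos_chan[OF pos_pure K]] kl unfolding ker_le_def by blast
  have "ker_le (grid x x) (pure (sqrt_vec x U d)) (pure (sqrt_vec x U d))" unfolding ker_le_def by simp
  then have "q \<le> b * 1" using b pos_pure Q Q' unfolding amort_bound_def by blast
  then have "q \<le> exp_div \<alpha> c" using c by simp
  then show "chan_term \<alpha> x y T S \<omega> \<le> c" unfolding val[OF Q'] log_div_le[OF a sandQ_nonneg[OF Q'] c(1)] .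
qed

section \<open>Amortized and regularized divergence\<close>

text \<open>All classical terms vanish; a diagonal entry of \<rho> is then 0 directly if
  \<open>s k\<close> is nonzero and by the kernel condition otherwise. Pinching extends this to all
  vectors, so a nonzero \<rho> never has divergence -\<infinity>.\<close>

lemma sandQ_eq_0D: assumes a: "\<alpha> > 1" and Q: "sandQ \<alpha> I \<rho> \<sigma> 0 D" shows "qf I \<rho> v = 0"
proof -
  note fin = sandQ_finite(1)[OF Q]
  obtain e s where e: "onb I e" and sp: "spec I \<sigma> e s" 
    and ev: "\<And>k i. k \<in> I \<Longrightarrow> i \<in> I \<Longrightarrow> ap I \<sigma> (e k) i = of_real (s k) * e k i"
    and s0: "\<And>k. k \<in> I \<Longrightarrow> 0 \<le> s k" 
    and le: "\<And>v. qf I \<rho> v \<le> real (card D) * (\<Sum>k\<in>I. qf I \<rho> (e k) * (cmod (ip I (e k) v))\<^sup>2)"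
    by (rule sandQ_pinch[OF a Q]) (rule that)
  have "(\<Sum>k\<in>I. qf I \<rho> (e k) powr \<alpha> * s k powr (1 - \<alpha>)) = 0"
    using sandQ_lower_eigenbasis[OF a Q e ev] by (intro antisym sum_nonneg) auto
  then have z: "\<forall>k\<in>I. qf I \<rho> (e k) powr \<alpha> * s k powr (1 - \<alpha>) = 0"
    using fin by (subst (asm) sum_nonneg_eq_0_iff) auto
  have "qf I \<rho> (e k) = 0" if "k \<in> I" for k
    using z that sandQ_kernel[OF Q, of "e k"] spec_qf_basis[OF sp fin that] by (cases "s k = 0") auto
  then have "qf I \<rho> v \<le> 0" using le[of v] by simp
  then show ?thesis using sandQ_pos(1)[OF Q] unfolding pos_def by (simp add: antisym)
qed

lemma qf_scale: "qf I (\<lambda>i j. of_real s * A i j) v = s * qf I A v"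
  unfolding qf_def ip_def ap_def by (simp add: sum_distrib_left mult_ac)

lemma pos_scale: assumes "0 \<le> s" "pos I A" shows "pos I (\<lambda>i j. of_real s * A i j)"
proof -
  have "herm I (\<lambda>i j. of_real s * A i j)" unfolding herm_def
  proof (intro ballI)
    fix i j assume ij: "i \<in> I" "j \<in> I"
    have "herm I A" using assms(2) unfolding pos_def by simp
    from hermD[OF this ij] have "A j i = cnj (A i j)" .
    then show "of_real s * A j i = cnj (of_real s * A i j)" by simp
  qed
  then show ?thesis using assms unfolding pos_def qf_scale by simp
qed

lemma ker_le_scale: "s \<noteq> 0 \<Longrightarrow> t \<noteq> 0 \<Longrightarrow> ker_le I (\<lambda>i j. of_real s * \<rho> i j) (\<lambda>i j. of_real t * \<sigma> i j) = ker_le I \<rho> \<sigma>"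
  unfolding ker_le_def qf_scale by simp

lemma chan_scale: "chan x J (\<lambda>i j. c * \<rho> i j) = (\<lambda>i j. c * chan x J \<rho> i j)"
  unfolding chan_def by (simp add: sum_distrib_left mult.assoc)

lemma pos_trace: assumes "finite I" "pos I A" 
  shows "(\<Sum>i\<in>I. A i i) = of_real (Re (\<Sum>i\<in>I. A i i))" "0 \<le> Re (\<Sum>i\<in>I. A i i)"
    "Re (\<Sum>i\<in>I. A i i) = 0 \<longleftrightarrow> (\<forall>v. qf I A v = 0)"
proof -
  obtain U d where U: "spec I A U d" "\<And>k. k \<in> I \<Longrightarrow> 0 \<le> d k" using pos_spectral[OF assms] by blast
  note t = spec_trace[OF U(1) assms(1)]
  show "(\<Sum>i\<in>I. A i i) = of_real (Re (\<Sum>i\<in>I. A i i))" unfolding t by simp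
  show "0 \<le> Re (\<Sum>i\<in>I. A i i)" unfolding t using U(2) by (simp add: sum_nonneg)
  have "(\<Sum>k\<in>I. d k) = 0 \<longleftrightarrow> (\<forall>k\<in>I. d k = 0)" using U(2) assms(1) by (subst sum_nonneg_eq_0_iff) auto
  also have "\<dots> \<longleftrightarrow> (\<forall>v. qf I A v = 0)" using spec_qf[OF U(1)] spec_qf_basis[OF U(1) assms(1)] by auto
  finally show "Re (\<Sum>i\<in>I. A i i) = 0 \<longleftrightarrow> (\<forall>v. qf I A v = 0)" unfolding t by simp
qed

lemma mtrace_grid: assumes "A \<in> carrier_mat (r * x) (r * x)" shows "mtrace A = (\<Sum>i\<in>grid r x. grid_op x A i i)"
proof -
  have "mtrace A = (\<Sum>i<r * x. mat_op A i i)" using assms unfolding mtrace_def mat_op_def by auto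
  also have "\<dots> = (\<Sum>i\<in>grid r x. grid_op x A i i)"
    unfolding grid_op_def by (rule sum.reindex_bij_betw[OF bij_grid_code, symmetric])
  finally show ?thesis .
qed

definition grid_mat :: "nat \<Rightarrow> nat \<Rightarrow> (nat \<times> nat) op \<Rightarrow> complex mat" where
  "grid_mat r x f = mat (r * x) (r * x) (\<lambda>(a,b). f (a div x, a mod x) (b div x, b mod x))"

lemma grid_mat_carrier: "grid_mat r x f \<in> carrier_mat (r * x) (r * x)" unfolding grid_mat_def by simp

lemma grid_op_grid_mat: "i \<in> grid r x \<Longrightarrow> j \<in> grid r x \<Longrightarrow> grid_op x (grid_mat r x f) i j = f i j"
  unfolding grid_op_def mat_op_def grid_mat_def grid_code_def grid_def by (auto simp: mult_add_less)

lemma psd_grid_mat: assumes "pos (grid r x) f" shows "psd (r * x) (grid_mat r x f)"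
proof -
  have "pos (grid r x) (grid_op x (grid_mat r x f)) = pos (grid r x) f" by (rule pos_cong) (rule grid_op_grid_mat; assumption)
  then show ?thesis unfolding psd_grid using assms grid_mat_carrier by simp
qed

lemma density_normalized: assumes p: "pos (grid r x) f" and t: "Re (\<Sum>i\<in>grid r x. f i i) \<noteq> 0"
  shows "density (r * x) (grid_mat r x (\<lambda>i j. of_real (1 / Re (\<Sum>i\<in>grid r x. f i i)) * f i j))"
proof -
  define t where "t = Re (\<Sum>i\<in>grid r x. f i i)"
  have tr: "(\<Sum>i\<in>grid r x. f i i) = of_real t" and t0: "0 \<le> t" "t \<noteq> 0"
    using pos_trace[OF finite_grid p] t unfolding t_def by auto
  have "pos (grid r x) (\<lambda>i j. of_real (1 / t) * f i j)" using t0 by (intro pos_scale p) simp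
  moreover have "mtrace (grid_mat r x (\<lambda>i j. of_real (1 / t) * f i j)) = 1"
  proof -
    have "mtrace (grid_mat r x (\<lambda>i j. of_real (1 / t) * f i j)) = (\<Sum>i\<in>grid r x. of_real (1 / t) * f i i)"
      unfolding mtrace_grid[OF grid_mat_carrier] by (rule sum.cong[OF refl]) (rule grid_op_grid_mat)
    also have "\<dots> = of_real (1 / t) * of_real t" unfolding sum_distrib_left[symmetric] tr ..
    finally show ?thesis using t0 by simp
  qed
  ultimately show ?thesis unfolding density_def t_def[symmetric] using psd_grid_mat by blast
qed

lemma output_cases: assumes a: "\<alpha> > 1" and N: "cp_map dx dy N" and M: "cp_map dx dy M"
    and P: "psd (r * dx) P" and S: "psd (r * dx) S"
  shows "\<not> ker_le (grid r dy) (chan dx (choi_op dx N) (grid_op dx P)) (chan dx (choi_op dx M) (grid_op dx S)) \<Longrightarrow> 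
      sandwiched \<alpha> (r * dy) (id_tensor r dx dy N P) (id_tensor r dx dy M S) = \<infinity>"
    "sandQ \<alpha> (grid r dy) (chan dx (choi_op dx N) (grid_op dx P)) (chan dx (choi_op dx M) (grid_op dx S)) q D \<Longrightarrow> 
      sandwiched \<alpha> (r * dy) (id_tensor r dx dy N P) (id_tensor r dx dy M S) = log_div \<alpha> q"
proof -
  have l: "lin_map dx dy N" "lin_map dx dy M" using N M unfolding cp_map_def by auto
  have p: "psd (r * dy) (id_tensor r dx dy N P)" "psd (r * dy) (id_tensor r dx dy M S)"
    using N M P S unfolding cp_map_def by auto
  have k: "ker_le (grid r dy) (grid_op dy (id_tensor r dx dy N P)) (grid_op dy (id_tensor r dx dy M S)) =
     ker_le (grid r dy) (chan dx (choi_op dx N) (grid_op dx P)) (chan dx (choi_op dx M) (grid_op dx S))"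
    by (rule ker_le_cong) (rule grid_op_id_tensor[OF l(1)] grid_op_id_tensor[OF l(2)]; assumption)+
  have s: "sandQ \<alpha> (grid r dy) (grid_op dy (id_tensor r dx dy N P)) (grid_op dy (id_tensor r dx dy M S)) q D =
     sandQ \<alpha> (grid r dy) (chan dx (choi_op dx N) (grid_op dx P)) (chan dx (choi_op dx M) (grid_op dx S)) q D"
    by (rule sandQ_cong) (rule grid_op_id_tensor[OF l(1)] grid_op_id_tensor[OF l(2)]; assumption)+
  show "\<not> ker_le (grid r dy) (chan dx (choi_op dx N) (grid_op dx P)) (chan dx (choi_op dx M) (grid_op dx S)) \<Longrightarrow> 
      sandwiched \<alpha> (r * dy) (id_tensor r dx dy N P) (id_tensor r dx dy M S) = \<infinity>"
    unfolding k[symmetric] by (rule sandwiched_infinite[OF p])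
  show "sandQ \<alpha> (grid r dy) (chan dx (choi_op dx N) (grid_op dx P)) (chan dx (choi_op dx M) (grid_op dx S)) q D \<Longrightarrow> 
      sandwiched \<alpha> (r * dy) (id_tensor r dx dy N P) (id_tensor r dx dy M S) = log_div \<alpha> q"
    unfolding s[symmetric] by (rule sandwiched_sandQ[OF a p])
qed

lemma chan_zero: assumes J: "pos (grid x y) J" and z: "\<And>v. qf (grid r x) \<rho> v = 0"
  shows "qf (grid r y) (chan x J \<rho>) u = 0"
proof -
  obtain V j where "spec (grid x y) J V j" using pos_spectral[OF finite_grid J] by blast
  from qf_chan[OF this] show ?thesis using z by simp
qed

lemma sandQ_zero_left: assumes a: "\<alpha> > 1" and Q: "sandQ \<alpha> I \<rho> \<sigma> q D" and z: "\<And>v. qf I \<rho> v = 0" shows "q = 0"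
proof -
  obtain e s where "q \<le> real (card D) powr \<alpha> * (\<Sum>k\<in>I. qf I \<rho> (e k) powr \<alpha> * s k powr (1 - \<alpha>))"
    by (rule sandQ_pinch[OF a Q]) (rule that)
  then show ?thesis using sandQ_nonneg[OF Q] z by simp
qed

text \<open>Normalizing \<rho> and \<sigma> multiplies Q of the inputs and of the outputs by the
  same w = s^\<alpha> t^(1 - \<alpha>), which cancels. The zero operator cannot be normalized and is
  treated apart; for nonzero \<rho> kernel inclusion makes \<sigma> nonzero.\<close>

lemma amort_bound_amort_div:
  assumes a: "\<alpha> > 1" and N: "cp_map dx dy N" and M: "cp_map dx dy M"
    and A: "amort_div \<alpha> dx dy N M \<noteq> \<infinity>"
  shows "amort_bound \<alpha> dx dy (choi_op dx N) (choi_op dx M) (exp_div \<alpha> (amort_div \<alpha> dx dy N M))"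
  unfolding amort_bound_def
proof (intro allI impI)
  fix r \<rho> \<sigma>
  assume \<rho>: "pos (grid r dx) \<rho>" and \<sigma>: "pos (grid r dx) \<sigma>" and k: "ker_le (grid r dx) \<rho> \<sigma>"
  let ?I = "grid r dx" and ?O = "grid r dy" and ?J = "choi_op dx N" and ?K = "choi_op dx M"
  let ?A = "amort_div \<alpha> dx dy N M"
  note J = pos_choi_op[OF N] and K = pos_choi_op[OF M]
  let ?s = "Re (\<Sum>i\<in>?I. \<rho> i i)" and ?t = "Re (\<Sum>i\<in>?I. \<sigma> i i)"
  show "ker_le ?O (chan dx ?J \<rho>) (chan dx ?K \<sigma>) \<and>
     (\<forall>q D q' D'. sandQ \<alpha> ?I \<rho> \<sigma> q D \<longrightarrow> sandQ \<alpha> ?O (chan dx ?J \<rho>) (chan dx ?K \<sigma>) q' D' \<longrightarrow> q' \<le> exp_div \<alpha> ?A * q)"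
  proof (cases "?s = 0")
    case True
    then have z: "qf ?O (chan dx ?J \<rho>) u = 0" for u using pos_trace(3)[OF finite_grid \<rho>] chan_zero[OF J] by blast
    show ?thesis
    proof (intro conjI allI impI)
      show "ker_le ?O (chan dx ?J \<rho>) (chan dx ?K \<sigma>)" unfolding ker_le_def using z by blast
      fix q D q' D' assume Q: "sandQ \<alpha> ?I \<rho> \<sigma> q D" and Q': "sandQ \<alpha> ?O (chan dx ?J \<rho>) (chan dx ?K \<sigma>) q' D'"
      have "q' = 0" by (rule sandQ_zero_left[OF a Q' z])
      then show "q' \<le> exp_div \<alpha> ?A * q" using sandQ_nonneg[OF Q] exp_div_nonneg by simp
    qed
  next
    case False
    have tn: "?t \<noteq> 0"
    proof
      assume "?t = 0"
      then have "\<forall>v. qf ?I \<rho> v = 0" using pos_trace(3)[OF finite_grid \<sigma>] k unfolding ker_le_def by blast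
      then show False using False pos_trace(3)[OF finite_grid \<rho>] by blast
    qed
    define s where "s = 1 / ?s"
    define t where "t = 1 / ?t"
    have st: "s > 0" "t > 0" unfolding s_def t_def using False tn pos_trace(2)[OF finite_grid \<rho>] pos_trace(2)[OF finite_grid \<sigma>] by auto
    define P where "P = grid_mat r dx (\<lambda>i j. of_real s * \<rho> i j)"
    define S where "S = grid_mat r dx (\<lambda>i j. of_real t * \<sigma> i j)"
    have dP: "density (r * dx) P" unfolding P_def s_def by (rule density_normalized[OF \<rho> False])
    have dS: "density (r * dx) S" unfolding S_def t_def by (rule density_normalized[OF \<sigma> tn])
    have pP: "psd (r * dx) P" and pS: "psd (r * dx) S" using dP dS unfolding density_def by auto
    define w where "w = s powr \<alpha> * t powr (1 - \<alpha>)"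
    have w: "w > 0" unfolding w_def using st by simp
    have mP: "grid_op dx P i j = of_real s * \<rho> i j" if "i \<in> ?I" "j \<in> ?I" for i j unfolding P_def by (rule grid_op_grid_mat[OF that])
    have mS: "grid_op dx S i j = of_real t * \<sigma> i j" if "i \<in> ?I" "j \<in> ?I" for i j unfolding S_def by (rule grid_op_grid_mat[OF that])
    have cP: "chan dx ?J (grid_op dx P) i j = of_real s * chan dx ?J \<rho> i j" if "i \<in> ?O" "j \<in> ?O" for i j
      unfolding chan_scale[symmetric, THEN fun_cong, THEN fun_cong] by (rule chan_cong[OF refl mP that])
    have cS: "chan dx ?K (grid_op dx S) i j = of_real t * chan dx ?K \<sigma> i j" if "i \<in> ?O" "j \<in> ?O" for i j
      unfolding chan_scale[symmetric, THEN fun_cong, THEN fun_cong] by (rule chan_cong[OF refl mS that])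
    have sI: "sandQ \<alpha> ?I (grid_op dx P) (grid_op dx S) q D = sandQ \<alpha> ?I (\<lambda>i j. of_real s * \<rho> i j) (\<lambda>i j. of_real t * \<sigma> i j) q D" for q D
      by (rule sandQ_cong) (rule mP mS; assumption)+
    have sO: "sandQ \<alpha> ?O (chan dx ?J (grid_op dx P)) (chan dx ?K (grid_op dx S)) q D = sandQ \<alpha> ?O (\<lambda>i j. of_real s * chan dx ?J \<rho> i j) (\<lambda>i j. of_real t * chan dx ?K \<sigma> i j) q D" for q D
      by (rule sandQ_cong) (rule cP cS; assumption)+
    have kO: "ker_le ?O (chan dx ?J (grid_op dx P)) (chan dx ?K (grid_op dx S)) = ker_le ?O (chan dx ?J \<rho>) (chan dx ?K \<sigma>)"
    proof -
      have "ker_le ?O (chan dx ?J (grid_op dx P)) (chan dx ?K (grid_op dx S)) = ker_le ?O (\<lambda>i j. of_real s * chan dx ?J \<rho> i j) (\<lambda>i j. of_real t * chan dx ?K \<sigma> i j)"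
        by (rule ker_le_cong) (rule cP cS; assumption)+
      then show ?thesis using ker_le_scale[of s t] st by simp
    qed
    let ?in = "sandwiched \<alpha> (r * dx) P S" and ?out = "sandwiched \<alpha> (r * dy) (id_tensor r dx dy N P) (id_tensor r dx dy M S)"
    have inq: "?in = log_div \<alpha> (w * q) \<and> w * q > 0" if Q: "sandQ \<alpha> ?I \<rho> \<sigma> q D" for q D
    proof
      have "sandQ \<alpha> ?I (grid_op dx P) (grid_op dx S) (w * q) ((\<lambda>(a,b). a * b) ` (D \<times> {t}))"
        unfolding sI w_def by (rule sandQ_scale[OF a st Q])
      then show "?in = log_div \<alpha> (w * q)" by (rule sandwiched_sandQ[OF a pP pS])
      have "q \<noteq> 0" using sandQ_eq_0D[OF a] Q False pos_trace(3)[OF finite_grid \<rho>] by blast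
      then show "w * q > 0" using w sandQ_nonneg[OF Q] by simp
    qed
    obtain q0 D0 where Q0: "sandQ \<alpha> ?I \<rho> \<sigma> q0 D0" using sandQ_exists[OF finite_grid \<rho> \<sigma>] k unfolding ker_le_def by blast
    \<comment> \<open>The input divergence is a real number, so the difference in
      \<open>amort_div\<close> can be solved for the output divergence.\<close>
    obtain l where l: "?in = ereal l" using inq[OF Q0] log_div_nonzero by (metis less_irrefl)
    have diff: "?out - ?in \<le> ?A"
      unfolding amort_div_def by (rule SUP_upper2[of "(r, P, S)"]) (use dP dS l in auto)
    then have out: "?out \<noteq> \<infinity>" using A l by auto
    then have kf: "ker_le ?O (chan dx ?J \<rho>) (chan dx ?K \<sigma>)"
      using output_cases(1)[OF a N M pP pS] unfolding kO by blast
    have "q' \<le> exp_div \<alpha> ?A * q" if Q: "sandQ \<alpha> ?I \<rho> \<sigma> q D" and Q': "sandQ \<alpha> ?O (chan dx ?J \<rho>) (chan dx ?K \<sigma>) q' D'" for q D q' D'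
    proof -
      have "sandQ \<alpha> ?O (chan dx ?J (grid_op dx P)) (chan dx ?K (grid_op dx S)) (w * q') ((\<lambda>(a,b). a * b) ` (D' \<times> {t}))"
        unfolding sO w_def by (rule sandQ_scale[OF a st Q'])
      then have o: "?out = log_div \<alpha> (w * q')" by (rule output_cases(2)[OF a N M pP pS])
      have "log_div \<alpha> (w * q') \<le> ?A + log_div \<alpha> (w * q)"
      proof -
        have e: "log_div \<alpha> (w * q) = ereal l" using l inq[OF Q] by simp
        show ?thesis using diff unfolding o l e by (simp add: ereal_minus_le)
      qed
      moreover have "?A + log_div \<alpha> (w * q) \<noteq> \<infinity>" using A l inq[OF Q] by auto
      ultimately have "w * q' \<le> exp_div \<alpha> (?A + log_div \<alpha> (w * q))"
        using log_div_le[OF a, of "w * q'"] sandQ_nonneg[OF Q'] w by simp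
      also have "\<dots> = exp_div \<alpha> ?A * (w * q)" using exp_div_add[OF a _ A] inq[OF Q] by simp
      finally have "w * q' \<le> w * (exp_div \<alpha> ?A * q)" by (simp add: mult_ac)
      then show ?thesis using w by simp
    qed
    then show ?thesis using kf by blast
  qed
qed

lemma exp_div_power: assumes "c \<noteq> \<infinity>" "n > 0" shows "exp_div \<alpha> c ^ n = exp_div \<alpha> (ereal (real n) * c)"
proof (cases c)
  case (real b)
  have "(2 powr ((\<alpha> - 1) * b)) ^ n = 2 powr ((\<alpha> - 1) * b * real n)"
    by (simp add: powr_realpow[symmetric] powr_powr)
  then show ?thesis using real by (simp add: exp_div_def mult_ac)
next
  case MInf
  then show ?thesis using assms by (simp add: exp_div_def)
qed (use assms in simp)

text \<open>The n channel uses raise the multiplicative constant to its n-th power, which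
  \<open>exp_div\<close> turns back into n times the amortized divergence; the bound holds at each
  single n.\<close>

lemma regularized_le_amortized:
  assumes a: "\<alpha> > 1" and N: "cp_map dx dy N" and M: "cp_map dx dy M"
    and A: "amort_div \<alpha> dx dy N M \<noteq> \<infinity>" and n: "n > 0"
  shows "chan_div \<alpha> (dx ^ n) (dy ^ n) (tpow dx dy n N) (tpow dx dy n M) / ereal (real n) \<le> amort_div \<alpha> dx dy N M"
proof -
  let ?A = "amort_div \<alpha> dx dy N M"
  note J = pos_choi_op[OF N] and K = pos_choi_op[OF M]
  have "amort_bound \<alpha> (dx ^ n) (dy ^ n) (tens_pow dx dy dx dy n (choi_op dx N)) (tens_pow dx dy dx dy n (choi_op dx M)) (exp_div \<alpha> ?A ^ n)"
    by (rule amort_bound_pow[OF a J K amort_bound_amort_div[OF a N M A] exp_div_nonneg])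
  from chan_div_le[OF a pos_pow[OF J] pos_pow[OF K] choi_op_tpow choi_op_tpow this, of "ereal (real n) * ?A"]
  have "chan_div \<alpha> (dx ^ n) (dy ^ n) (tpow dx dy n N) (tpow dx dy n M) \<le> ereal (real n) * ?A"
    using A exp_div_power[OF A n] by (cases ?A) auto
  then show ?thesis using n by (subst ereal_divide_le_pos) auto
qed

text \<open>A fixed pair of inputs is compared with all n. If its outputs violate kernel inclusion,
  every channel divergence with n > 0 is infinite; otherwise the chain rule yields the difference
  \<delta> up to an error of order ln (n + 1)/n.\<close>

lemma amortized_term_le:
  assumes a: "\<alpha> > 1" and N: "cp_map dx dy N" and M: "cp_map dx dy M"
    and P: "density (r * dx) P" and S: "density (r * dx) S" and fin: "sandwiched \<alpha> (r * dx) P S < \<infinity>"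
    and y: "y < sandwiched \<alpha> (r * dy) (id_tensor r dx dy N P) (id_tensor r dx dy M S) - sandwiched \<alpha> (r * dx) P S"
  shows "eventually (\<lambda>n. y < chan_div \<alpha> (dx ^ n) (dy ^ n) (tpow dx dy n N) (tpow dx dy n M) / ereal (real n)) sequentially"
proof -
  let ?I = "grid r dx" and ?O = "grid r dy" and ?J = "choi_op dx N" and ?K = "choi_op dx M"
  let ?in = "sandwiched \<alpha> (r * dx) P S" and ?out = "sandwiched \<alpha> (r * dy) (id_tensor r dx dy N P) (id_tensor r dx dy M S)"
  define c where "c n = chan_div \<alpha> (dx ^ n) (dy ^ n) (tpow dx dy n N) (tpow dx dy n M)" for n
  note J = pos_choi_op[OF N] and K = pos_choi_op[OF M]
  have pP: "psd (r * dx) P" and pS: "psd (r * dx) S" using P S unfolding density_def by auto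
  have posP: "pos ?I (grid_op dx P)" "pos ?I (grid_op dx S)" and PC: "P \<in> carrier_mat (r * dx) (r * dx)" using pP pS unfolding psd_grid by auto
  have k: "ker_le ?I (grid_op dx P) (grid_op dx S)" using sandwiched_infinite[OF pP pS] fin by (metis less_irrefl)
  obtain q D where Q: "sandQ \<alpha> ?I (grid_op dx P) (grid_op dx S) q D" using sandQ_exists[OF finite_grid posP] k unfolding ker_le_def by blast
  have inq: "?in = log_div \<alpha> q" by (rule sandwiched_sandQ[OF a pP pS Q])
  have "q \<noteq> 0"
  proof
    assume "q = 0"
    then have "Re (mtrace P) = 0" using sandQ_eq_0D[OF a] Q pos_trace(3)[OF finite_grid posP(1)] unfolding mtrace_grid[OF PC] by blast
    then show False using P unfolding density_def by simp
  qed
  then have q: "q > 0" using sandQ_nonneg[OF Q] by simp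
  have pb: "pure_bound \<alpha> (r ^ n) (dx ^ n) (dy ^ n) (tens_pow dx dy dx dy n ?J) (tens_pow dx dy dx dy n ?K) (exp_div \<alpha> (c n))" if "c n \<noteq> \<infinity>" for n
    by (rule chan_pure_bound[OF a pos_pow[OF J] pos_pow[OF K] choi_op_tpow choi_op_tpow]) (use that in \<open>auto simp: c_def\<close>)
  show ?thesis
  proof (cases "ker_le ?O (chan dx ?J (grid_op dx P)) (chan dx ?K (grid_op dx S))")
    case False
    have "c n = \<infinity>" if "n > 0" for n
    proof (rule ccontr)
      assume "c n \<noteq> \<infinity>"
      from kernel_pow[OF a Q J K pb[OF this] that] show False using False unfolding ker_le_def by blast
    qed
    moreover have "y < \<infinity>" using y by (metis ereal_infty_less(1) less_trans order.strict_implies_not_eq)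
    ultimately have "y < c n / ereal (real n)" if "n > 0" for n using that by simp
    then show ?thesis unfolding c_def by (intro eventually_mono[OF eventually_gt_at_top[of "0::nat"]])
  next
    case True
    have posO: "pos ?O (chan dx ?J (grid_op dx P))" "pos ?O (chan dx ?K (grid_op dx S))" using pos_chan posP J K by blast+
    obtain q' D' where Q': "sandQ \<alpha> ?O (chan dx ?J (grid_op dx P)) (chan dx ?K (grid_op dx S)) q' D'"
      using sandQ_exists[OF finite_grid posO] True unfolding ker_le_def by blast
    have outq: "?out = log_div \<alpha> q'" by (rule output_cases(2)[OF a N M pP pS Q'])
    have "q' \<noteq> 0" using y unfolding outq inq using q log_div_zero[OF a] by (auto simp: log_div_nonzero)
    then have q': "q' > 0" using sandQ_nonneg[OF Q'] by simp
    define \<delta> where "\<delta> = (log 2 q' - log 2 q) / (\<alpha> - 1)"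
    have y\<delta>: "y < ereal \<delta>" using y q q' unfolding outq inq by (simp add: log_div_nonzero \<delta>_def diff_divide_distrib)
    define e where "e = real (card D') * \<alpha> + real (card D) * \<alpha>"
    \<comment> \<open>The exponent \<open>e\<close> of n + 1 from the chain rule, converted by the
      prefactor 1/(\<alpha> - 1) and the change to base 2.\<close>
    define C where "C = e / ((\<alpha> - 1) * ln 2)"
    have le: "ereal (\<delta> - C * (ln (real (n + 1)) / real n)) \<le> c n / ereal (real n)" if n: "n > 0" for n
    proof (cases "c n = \<infinity>")
      case True
      then show ?thesis using n by simp
    next
      case False
      have "q' ^ n \<le> real (n + 1) powr e * (q ^ n * exp_div \<alpha> (c n))"
        unfolding e_def by (rule chain_rule_pow[OF a Q J K Q' pb[OF False] exp_div_nonneg])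
      moreover have "0 < q' ^ n" using q' by simp
      ultimately have pos: "0 < real (n + 1) powr e * (q ^ n * exp_div \<alpha> (c n))" 
        and le: "q' ^ n \<le> real (n + 1) powr e * (q ^ n * exp_div \<alpha> (c n))" by linarith+
      \<comment> \<open>A positive \<open>q'\<close> excludes the value -\<infinity> of the channel
        divergence, which leaves a real \<open>b\<close>.\<close>
      then have "exp_div \<alpha> (c n) \<noteq> 0" by auto
      then obtain b where b: "c n = ereal b" using False by (cases "c n") (auto simp: exp_div_def)
      have B: "exp_div \<alpha> (c n) = 2 powr ((\<alpha> - 1) * b)" unfolding b exp_div_def by simp
      have "ln (q' ^ n) \<le> ln (real (n + 1) powr e * (q ^ n * 2 powr ((\<alpha> - 1) * b)))"
        using le \<open>0 < q' ^ n\<close> pos unfolding B by (subst ln_le_cancel_iff) auto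
      also have "\<dots> = e * ln (real (n + 1)) + (real n * ln q + (\<alpha> - 1) * b * ln 2)"
        using q by (simp add: ln_mult ln_powr ln_realpow)
      finally have "real n * ln q' \<le> e * ln (real (n + 1)) + (real n * ln q + (\<alpha> - 1) * b * ln 2)"
        using q' by (simp add: ln_realpow)
      then have "real n * (ln q' - ln q) - e * ln (real (n + 1)) \<le> ((\<alpha> - 1) * ln 2) * b" by (simp add: algebra_simps)
      then have "(real n * (ln q' - ln q) - e * ln (real (n + 1))) / ((\<alpha> - 1) * ln 2) \<le> b"
        using a by (simp add: pos_divide_le_eq mult.commute)
      moreover have "(real n * (ln q' - ln q) - e * ln (real (n + 1))) / ((\<alpha> - 1) * ln 2) = real n * \<delta> - C * ln (real (n + 1))"
        unfolding \<delta>_def C_def log_def by (simp add: diff_divide_distrib right_diff_distrib mult_ac)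
      ultimately have "real n * \<delta> - C * ln (real (n + 1)) \<le> b" by simp
      then have "(real n * \<delta> - C * ln (real (n + 1))) / real n \<le> b / real n" by (intro divide_right_mono) auto
      then have "\<delta> - C * (ln (real (n + 1)) / real n) \<le> b / real n" using n by (simp add: diff_divide_distrib)
      then show ?thesis using n unfolding b by simp
    qed
    have "(\<lambda>n. \<delta> - C * (ln (real (n + 1)) / real n)) \<longlonglongrightarrow> \<delta> - C * 0"
      by (intro tendsto_diff tendsto_mult tendsto_const ln_Suc_over_n)
    then have "(\<lambda>n. ereal (\<delta> - C * (ln (real (n + 1)) / real n))) \<longlonglongrightarrow> ereal \<delta>" by simp
    then have "eventually (\<lambda>n. y < ereal (\<delta> - C * (ln (real (n + 1)) / real n))) sequentially"
      using y\<delta> by (rule order_tendstoD(1))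
    then show ?thesis using eventually_gt_at_top[of "0::nat"]
      unfolding c_def[symmetric] by eventually_elim (rule less_le_trans[OF _ le])
  qed
qed

theorem theorem5p3:
  fixes dx dy :: nat and \<alpha> :: real and N M :: "complex mat \<Rightarrow> complex mat"
  assumes "dx > 0" and "dy > 0"
    and "cp_map dx dy N" and "cp_map dx dy M"
    and "\<alpha> > 1"
  shows "(\<lambda>n. chan_div \<alpha> (dx ^ n) (dy ^ n) (tpow dx dy n N) (tpow dx dy n M) / ereal (real n))
           \<longlonglongrightarrow> amort_div \<alpha> dx dy N M"
\<comment> \<open>In the order topology: below the amortized divergence a single pair of inputs
  already exceeds y; a y above it exists only if the amortized divergence is not \<infinity>, and
  then the bound at each n > 0 applies.\<close>
proof (rule order_tendstoI)
  fix y assume "y < amort_div \<alpha> dx dy N M"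
  then obtain r P S where "density (r * dx) P" "density (r * dx) S" "sandwiched \<alpha> (r * dx) P S < \<infinity>"
    "y < sandwiched \<alpha> (r * dy) (id_tensor r dx dy N P) (id_tensor r dx dy M S) - sandwiched \<alpha> (r * dx) P S"
    unfolding amort_div_def less_SUP_iff by auto
  then show "eventually (\<lambda>n. y < chan_div \<alpha> (dx ^ n) (dy ^ n) (tpow dx dy n N) (tpow dx dy n M) / ereal (real n)) sequentially"
    by (rule amortized_term_le[OF assms(5,3,4)])
next
  fix y assume y: "amort_div \<alpha> dx dy N M < y"
  then have "amort_div \<alpha> dx dy N M \<noteq> \<infinity>" by auto
  from regularized_le_amortized[OF assms(5,3,4) this]
  show "eventually (\<lambda>n. chan_div \<alpha> (dx ^ n) (dy ^ n) (tpow dx dy n N) (tpow dx dy n M) / ereal (real n) < y) sequentially"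
    by (intro eventually_mono[OF eventually_gt_at_top[of "0::nat"]]) (rule le_less_trans[OF _ y])
qed

end
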